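(* Let $H$ be a CQG algebra and let $A\subseteq H$ be a coideal $*$-subalgebra, i.e. a unital subalgebra closed under $*$ and satisfying $\Delta(A)\subseteq A\otimes H$. Then $H$ is faithfully flat both as a left $A$-module and as a right $A$-module.
   Context: All objects are over $\mathbb{C}$; algebras are unital and associative. A Hopf $*$-algebra is a complex Hopf algebra that is also a $*$-algebra (conjugate-linear, involutive, multiplication-reversing $*$), such that the comultiplication $\Delta$ and counit $\varepsilon$ are $*$-algebra maps. For a finite-dimensional right $H$-comodule $M$ (coaction $m\mapsto m_0\otimes m_1$), let $M^*$ be its dual comodule (coaction determined by $\langle f_0,m\rangle f_1=\langle f,m_0\rangle S(m_1)$, $S$ the antipode) and $\overline{M}$ the complex conjugate vector space with coaction $m\mapsto m_0\otimes m_1^*$. An inner product on $M$ (regarded as a linear map $\overline{M}\to M^*$) is compatible if this map is a map of $H$-comodules. A CQG algebra is a Hopf $*$-algebra for which every finite-dimensional right comodule admits a compatible inner product. *)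

theory Defs
  imports
    Complex_Main
    "HOL-Library.Poly_Mapping"
    "HOL-Library.Function_Algebras"
    "HOL-Computational_Algebra.Group_Closure"
begin

section \<open>Complex vector spaces and algebras\<close>

class scaleC =
  fixes scaleC :: "complex \<Rightarrow> 'a \<Rightarrow> 'a" (infixr \<open>*\<^sub>C\<close> 75)

class complex_vector = scaleC + ab_group_add +
  assumes scaleC_add_right: "a *\<^sub>C (x + y) = a *\<^sub>C x + a *\<^sub>C y"
    and scaleC_add_left: "(a + b) *\<^sub>C x = a *\<^sub>C x + b *\<^sub>C x"
    and scaleC_scaleC: "a *\<^sub>C b *\<^sub>C x = (a * b) *\<^sub>C x"
    and scaleC_one: "1 *\<^sub>C x = x"

class complex_algebra_1 = complex_vector + ring_1 +
  assumes mult_scaleC_left: "a *\<^sub>C x * y = a *\<^sub>C (x * y)"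
    and mult_scaleC_right: "x * a *\<^sub>C y = a *\<^sub>C (x * y)"

interpretation complex_vector: vector_space "scaleC :: complex \<Rightarrow> 'a \<Rightarrow> 'a :: complex_vector"
  by unfold_locales (simp_all add: scaleC_add_right scaleC_add_left scaleC_scaleC scaleC_one)

abbreviation csubspace :: "'a::complex_vector set \<Rightarrow> bool"
  where "csubspace \<equiv> complex_vector.subspace"

abbreviation cspan :: "'a::complex_vector set \<Rightarrow> 'a set"
  where "cspan \<equiv> complex_vector.span"

abbreviation clinear :: "('a::complex_vector \<Rightarrow> 'b::complex_vector) \<Rightarrow> bool"
  where "clinear \<equiv> Vector_Spaces.linear (*\<^sub>C) (*\<^sub>C)"

definition clinear_on :: "'a::complex_vector set \<Rightarrow> ('a \<Rightarrow> 'b::complex_vector) \<Rightarrow> bool"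
  where "clinear_on V f \<longleftrightarrow>
    (\<forall>x\<in>V. \<forall>y\<in>V. f (x + y) = f x + f y) \<and> (\<forall>c. \<forall>x\<in>V. f (c *\<^sub>C x) = c *\<^sub>C f x)"

definition finite_dim :: "'a::complex_vector set \<Rightarrow> bool"
  where "finite_dim V \<longleftrightarrow> csubspace V \<and> (\<exists>B. finite B \<and> V = cspan B)"

instantiation complex :: complex_algebra_1
begin
definition scaleC_complex :: "complex \<Rightarrow> complex \<Rightarrow> complex"
  where "scaleC_complex c x = c * x"
instance
  by standard (simp_all add: scaleC_complex_def algebra_simps)
end

instantiation "fun" :: (type, complex_vector) complex_vector
begin
definition scaleC_fun :: "complex \<Rightarrow> ('a \<Rightarrow> 'b) \<Rightarrow> 'a \<Rightarrow> 'b"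
  where "scaleC_fun c f = (\<lambda>x. c *\<^sub>C f x)"
instance
  by standard
    (simp_all add: scaleC_fun_def fun_eq_iff scaleC_add_right scaleC_add_left scaleC_scaleC scaleC_one)
end

subsection \<open>The complex conjugate vector space\<close>

typedef 'a conj_space = "UNIV :: 'a set"
  morphisms from_conj to_conj ..

setup_lifting type_definition_conj_space

instantiation conj_space :: (complex_vector) complex_vector
begin
lift_definition zero_conj_space :: "'a conj_space" is 0 .
lift_definition plus_conj_space :: "'a conj_space \<Rightarrow> 'a conj_space \<Rightarrow> 'a conj_space" is "(+)" .
lift_definition minus_conj_space :: "'a conj_space \<Rightarrow> 'a conj_space \<Rightarrow> 'a conj_space" is "(-)" .
lift_definition uminus_conj_space :: "'a conj_space \<Rightarrow> 'a conj_space" is uminus .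
lift_definition scaleC_conj_space :: "complex \<Rightarrow> 'a conj_space \<Rightarrow> 'a conj_space"
  is "\<lambda>c x. cnj c *\<^sub>C x" .
instance
  by standard
    (transfer; simp add: algebra_simps scaleC_add_right scaleC_add_left scaleC_scaleC scaleC_one)+
end


section \<open>Tensor products\<close>

subsection \<open>Balanced tensor products over a (noncommutative) ring\<close>

text \<open>
  For a right \<open>A\<close>-module \<open>M\<close> (action \<open>r\<close>) and a left \<open>A\<close>-module \<open>N\<close> (action \<open>l\<close>), the group
  \<open>M \<otimes>\<^sub>A N\<close> is the free abelian group on \<open>M \<times> N\<close> modulo the subgroup generated by the relators.
\<close>

definition tensor_relators ::
  "'r set \<Rightarrow> ('m::ab_group_add \<Rightarrow> 'r \<Rightarrow> 'm) \<Rightarrow> ('r \<Rightarrow> 'n::ab_group_add \<Rightarrow> 'n) \<Rightarrow> ('m \<times> 'n \<Rightarrow>\<^sub>0 int) set"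
  where "tensor_relators A r l =
    {frag_of (x + x', y) - frag_of (x, y) - frag_of (x', y) | x x' y. True} \<union>
    {frag_of (x, y + y') - frag_of (x, y) - frag_of (x, y') | x y y'. True} \<union>
    {frag_of (r x a, y) - frag_of (x, l a y) | x a y. a \<in> A}"

definition tensor_cong ::
  "'r set \<Rightarrow> ('m::ab_group_add \<Rightarrow> 'r \<Rightarrow> 'm) \<Rightarrow> ('r \<Rightarrow> 'n::ab_group_add \<Rightarrow> 'n)
    \<Rightarrow> (('m \<times> 'n \<Rightarrow>\<^sub>0 int) \<times> ('m \<times> 'n \<Rightarrow>\<^sub>0 int)) set"
  where "tensor_cong A r l = {(s, t). s - t \<in> group_closure (tensor_relators A r l)}"

definition tensor_over ::
  "'r set \<Rightarrow> ('m::ab_group_add \<Rightarrow> 'r \<Rightarrow> 'm) \<Rightarrow> ('r \<Rightarrow> 'n::ab_group_add \<Rightarrow> 'n)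
    \<Rightarrow> ('m \<times> 'n \<Rightarrow>\<^sub>0 int) set set"
  where "tensor_over A r l = UNIV // tensor_cong A r l"

definition frag_tensor_map ::
  "('m \<Rightarrow> 'm') \<Rightarrow> ('n \<Rightarrow> 'n') \<Rightarrow> ('m \<times> 'n \<Rightarrow>\<^sub>0 int) \<Rightarrow> ('m' \<times> 'n' \<Rightarrow>\<^sub>0 int)"
  where "frag_tensor_map f g = frag_extend (\<lambda>(x, y). frag_of (f x, g y))"

text \<open>The map \<open>f \<otimes> g\<close> into \<open>M' \<otimes>\<^sub>A N'\<close>, where \<open>r'\<close>, \<open>l'\<close> are the actions on the target modules.\<close>

definition tensor_over_map ::
  "'r set \<Rightarrow> ('m'::ab_group_add \<Rightarrow> 'r \<Rightarrow> 'm') \<Rightarrow> ('r \<Rightarrow> 'n'::ab_group_add \<Rightarrow> 'n')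
    \<Rightarrow> ('m \<Rightarrow> 'm') \<Rightarrow> ('n \<Rightarrow> 'n') \<Rightarrow> ('m \<times> 'n \<Rightarrow>\<^sub>0 int) set \<Rightarrow> ('m' \<times> 'n' \<Rightarrow>\<^sub>0 int) set"
  where "tensor_over_map A r' l' f g X = (\<Union>s\<in>X. tensor_cong A r' l' `` {frag_tensor_map f g s})"

lemma equiv_tensor_cong: "equiv UNIV (tensor_cong A r l)"
proof (rule equivI)
  show "refl_on UNIV (tensor_cong A r l)"
    by (simp add: refl_on_def tensor_cong_def)
  show "sym (tensor_cong A r l)"
    unfolding sym_def tensor_cong_def
    by (metis (mono_tags, lifting) case_prodD case_prodI group_closure_minus_iff mem_Collect_eq minus_diff_eq)
  show "trans (tensor_cong A r l)"
  proof (rule transI)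
    fix s t u
    assume "(s, t) \<in> tensor_cong A r l" and "(t, u) \<in> tensor_cong A r l"
    then have "(s - t) + (t - u) \<in> group_closure (tensor_relators A r l)"
      unfolding tensor_cong_def by (simp only: mem_Collect_eq case_prod_conv group_closure_add)
    then show "(s, u) \<in> tensor_cong A r l"
      by (simp add: tensor_cong_def)
  qed
qed simp_all

lemma group_closure_frag_extend:
  assumes "s \<in> group_closure R" and "\<And>u. u \<in> R \<Longrightarrow> frag_extend h u \<in> group_closure R'"
  shows "frag_extend h s \<in> group_closure R'"
  using assms(1)
proof induction
  case (base s)
  then show ?case using assms(2) by auto
next
  case (diff s t)
  then show ?case by (simp add: frag_extend_diff group_closure.diff)
qed

subsection \<open>Tensor products of complex vector spaces\<close>

quotient_type (overloaded) ('a, 'b) ctensor =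
    "('a::complex_vector \<times> 'b::complex_vector) \<Rightarrow>\<^sub>0 int" /
    "\<lambda>s t. (s, t) \<in> tensor_cong (UNIV :: complex set) (\<lambda>x c. c *\<^sub>C x) (*\<^sub>C)"
  by (intro equivpI reflpI sympI transpI)
    (use equiv_tensor_cong in \<open>blast elim: equivE dest: refl_onD symD transD\<close>)+

lift_definition tensor :: "'a::complex_vector \<Rightarrow> 'b::complex_vector \<Rightarrow> ('a, 'b) ctensor" (infixr \<open>\<otimes>\<close> 72)
  is "\<lambda>x y. frag_of (x, y)" .

instantiation ctensor :: (complex_vector, complex_vector) complex_vector
begin

lift_definition zero_ctensor :: "('a, 'b) ctensor" is 0 .

lift_definition plus_ctensor :: "('a, 'b) ctensor \<Rightarrow> ('a, 'b) ctensor \<Rightarrow> ('a, 'b) ctensor" is "(+)"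
  unfolding tensor_cong_def
  by (simp only: mem_Collect_eq case_prod_conv add_diff_add group_closure_add)

lift_definition minus_ctensor :: "('a, 'b) ctensor \<Rightarrow> ('a, 'b) ctensor \<Rightarrow> ('a, 'b) ctensor" is "(-)"
proof -
  fix s s' t t' :: "'a \<times> 'b \<Rightarrow>\<^sub>0 int"
  have eq: "(s - t) - (s' - t') = (s - s') - (t - t')" by simp
  assume "(s, s') \<in> tensor_cong (UNIV :: complex set) (\<lambda>x c. c *\<^sub>C x) (*\<^sub>C)"
    and "(t, t') \<in> tensor_cong (UNIV :: complex set) (\<lambda>x c. c *\<^sub>C x) (*\<^sub>C)"
  then show "(s - t, s' - t') \<in> tensor_cong (UNIV :: complex set) (\<lambda>x c. c *\<^sub>C x) (*\<^sub>C)"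
    unfolding tensor_cong_def by (simp only: mem_Collect_eq case_prod_conv eq group_closure.diff)
qed

lift_definition uminus_ctensor :: "('a, 'b) ctensor \<Rightarrow> ('a, 'b) ctensor" is uminus
proof -
  fix s s' :: "'a \<times> 'b \<Rightarrow>\<^sub>0 int"
  have eq: "- s - - s' = - (s - s')" by simp
  assume "(s, s') \<in> tensor_cong (UNIV :: complex set) (\<lambda>x c. c *\<^sub>C x) (*\<^sub>C)"
  then show "(- s, - s') \<in> tensor_cong (UNIV :: complex set) (\<lambda>x c. c *\<^sub>C x) (*\<^sub>C)"
    unfolding tensor_cong_def by (simp only: mem_Collect_eq case_prod_conv eq group_closure_minus_iff)
qed

lift_definition scaleC_ctensor :: "complex \<Rightarrow> ('a, 'b) ctensor \<Rightarrow> ('a, 'b) ctensor"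
  is "\<lambda>c. frag_tensor_map (\<lambda>x. c *\<^sub>C x) (\<lambda>y. y)"
proof -
  fix c and s s' :: "'a \<times> 'b \<Rightarrow>\<^sub>0 int"
  let ?R = "tensor_relators (UNIV :: complex set) (\<lambda>(x::'a) c. c *\<^sub>C x) (\<lambda>c (y::'b). c *\<^sub>C y)"
  have *: "frag_tensor_map (\<lambda>x. c *\<^sub>C x) (\<lambda>y. y) u \<in> group_closure ?R" if "u \<in> ?R" for u
  proof -
    have "frag_tensor_map (\<lambda>x. c *\<^sub>C x) (\<lambda>y. y) u \<in> ?R"
      using that unfolding tensor_relators_def frag_tensor_map_def
      by (auto simp: frag_extend_diff scaleC_add_right scaleC_scaleC) (metis mult.commute scaleC_scaleC)+
    then show ?thesis by (simp add: group_closure.base)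
  qed
  assume "(s, s') \<in> tensor_cong (UNIV :: complex set) (\<lambda>x c. c *\<^sub>C x) (*\<^sub>C)"
  then have "frag_tensor_map (\<lambda>x. c *\<^sub>C x) (\<lambda>y. y) (s - s') \<in> group_closure ?R"
    using * unfolding tensor_cong_def frag_tensor_map_def
    by (auto intro: group_closure_frag_extend)
  then show "(frag_tensor_map (\<lambda>x. c *\<^sub>C x) (\<lambda>y. y) s, frag_tensor_map (\<lambda>x. c *\<^sub>C x) (\<lambda>y. y) s')
      \<in> tensor_cong (UNIV :: complex set) (\<lambda>x c. c *\<^sub>C x) (*\<^sub>C)"
    by (simp add: tensor_cong_def frag_tensor_map_def frag_extend_diff)
qed

instance
proof
  fix a b :: complex and x y z :: "('a, 'b) ctensor"
  show "x + y + z = x + (y + z)" by transfer (simp add: tensor_cong_def add.assoc)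
  show "x + y = y + x" by transfer (simp add: tensor_cong_def add.commute)
  show "0 + x = x" by transfer (simp add: tensor_cong_def)
  show "- x + x = 0" by transfer (simp add: tensor_cong_def)
  show "x - y = x + - y" by transfer (simp add: tensor_cong_def)
  show "a *\<^sub>C (x + y) = a *\<^sub>C x + a *\<^sub>C y"
    by transfer (simp add: tensor_cong_def frag_tensor_map_def frag_extend_add)
  show "1 *\<^sub>C x = x"
  proof transfer
    fix s :: "'a \<times> 'b \<Rightarrow>\<^sub>0 int"
    have "frag_tensor_map (\<lambda>x. 1 *\<^sub>C x) (\<lambda>y. y) s = s"
      unfolding frag_tensor_map_def
      by (induction s rule: frag_induction[OF subset_UNIV])
        (simp_all add: frag_extend_diff split_beta scaleC_one)
    then show "(frag_tensor_map (\<lambda>x. 1 *\<^sub>C x) (\<lambda>y. y) s, s)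
        \<in> tensor_cong (UNIV :: complex set) (\<lambda>x c. c *\<^sub>C x) (*\<^sub>C)"
      by (simp add: tensor_cong_def)
  qed
  show "a *\<^sub>C b *\<^sub>C x = (a * b) *\<^sub>C x"
  proof transfer
    fix a b :: complex and s :: "'a \<times> 'b \<Rightarrow>\<^sub>0 int"
    have "frag_tensor_map (\<lambda>x. a *\<^sub>C x) (\<lambda>y. y) (frag_tensor_map (\<lambda>x. b *\<^sub>C x) (\<lambda>y. y) s)
        = frag_tensor_map (\<lambda>x. (a * b) *\<^sub>C x) (\<lambda>y. y) s"
      unfolding frag_tensor_map_def
      by (induction s rule: frag_induction[OF subset_UNIV])
        (simp_all add: frag_extend_diff split_beta scaleC_scaleC)
    then show "(frag_tensor_map (\<lambda>x. a *\<^sub>C x) (\<lambda>y. y) (frag_tensor_map (\<lambda>x. b *\<^sub>C x) (\<lambda>y. y) s),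
        frag_tensor_map (\<lambda>x. (a * b) *\<^sub>C x) (\<lambda>y. y) s)
        \<in> tensor_cong (UNIV :: complex set) (\<lambda>x c. c *\<^sub>C x) (*\<^sub>C)"
      by (simp add: tensor_cong_def)
  qed
  show "(a + b) *\<^sub>C x = a *\<^sub>C x + b *\<^sub>C x"
  proof transfer
    fix a b :: complex and s :: "'a \<times> 'b \<Rightarrow>\<^sub>0 int"
    let ?R = "tensor_relators (UNIV :: complex set) (\<lambda>(x::'a) c. c *\<^sub>C x) (\<lambda>c (y::'b). c *\<^sub>C y)"
    let ?m = "\<lambda>c. frag_tensor_map (\<lambda>x::'a. c *\<^sub>C x) (\<lambda>y::'b. y)"
    have "?m (a + b) s - (?m a s + ?m b s) \<in> group_closure ?R"
    proof (induction s rule: frag_induction[OF subset_UNIV])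
      case 1
      show ?case by (simp add: frag_tensor_map_def)
    next
      case (2 p)
      obtain x y where p: "p = (x, y)" by force
      have "?m (a + b) (frag_of p) - (?m a (frag_of p) + ?m b (frag_of p))
          = frag_of (a *\<^sub>C x + b *\<^sub>C x, y) - frag_of (a *\<^sub>C x, y) - frag_of (b *\<^sub>C x, y)"
        by (simp add: frag_tensor_map_def p scaleC_add_left diff_diff_eq)
      also have "\<dots> \<in> ?R"
        unfolding tensor_relators_def by blast
      finally show ?case
        by (simp add: group_closure.base)
    next
      case (3 u v)
      have "?m (a + b) (u - v) - (?m a (u - v) + ?m b (u - v))
          = (?m (a + b) u - (?m a u + ?m b u)) - (?m (a + b) v - (?m a v + ?m b v))"
        by (simp add: frag_tensor_map_def frag_extend_diff algebra_simps)
      then show ?case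
        by (simp only: group_closure.diff[OF 3])
    qed
    then show "(?m (a + b) s, ?m a s + ?m b s)
        \<in> tensor_cong (UNIV :: complex set) (\<lambda>x c. c *\<^sub>C x) (*\<^sub>C)"
      by (simp add: tensor_cong_def)
  qed
qed

end

text \<open>
  For subspaces \<open>V\<close> and \<open>W\<close> of ambient spaces, \<open>V \<otimes> W\<close> is realised inside the ambient tensor
  product; over a field the canonical map from \<open>V \<otimes> W\<close> is injective.
\<close>

definition tensor_subspace ::
  "'a::complex_vector set \<Rightarrow> 'b::complex_vector set \<Rightarrow> ('a, 'b) ctensor set"
  where "tensor_subspace V W = cspan {x \<otimes> y | x y. x \<in> V \<and> y \<in> W}"

text \<open>
  The additive map \<open>V \<otimes> W \<rightarrow> T\<close>, \<open>\<Sum>\<^sub>i x\<^sub>i \<otimes> y\<^sub>i \<mapsto> \<Sum>\<^sub>i b x\<^sub>i y\<^sub>i\<close>, induced by a biadditive map \<open>b\<close> on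
  \<open>V \<times> W\<close> with \<open>b (c x) y = b x (c y)\<close>.  Linearity of \<open>b\<close> is not required, so that conjugate-linear
  maps are covered as well.  In Sweedler notation, \<open>tensor_lift V W b (\<rho> v)\<close> is \<open>b v\<^sub>0 v\<^sub>1\<close>.
\<close>

definition tensor_lift ::
  "'a::complex_vector set \<Rightarrow> 'b::complex_vector set \<Rightarrow> ('a \<Rightarrow> 'b \<Rightarrow> 'c::ab_group_add)
    \<Rightarrow> ('a, 'b) ctensor \<Rightarrow> 'c"
  where "tensor_lift V W b t =
    (THE z. \<exists>ps. set ps \<subseteq> V \<times> W \<and> t = (\<Sum>(x, y)\<leftarrow>ps. x \<otimes> y) \<and> z = (\<Sum>(x, y)\<leftarrow>ps. b x y))"

definition tensor_map ::
  "('a::complex_vector \<Rightarrow> 'c::complex_vector) \<Rightarrow> ('b::complex_vector \<Rightarrow> 'd::complex_vector)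
    \<Rightarrow> ('a, 'b) ctensor \<Rightarrow> ('c, 'd) ctensor"
  where "tensor_map f g = tensor_lift UNIV UNIV (\<lambda>x y. f x \<otimes> g y)"

definition tensor_assoc ::
  "(('a::complex_vector, 'b::complex_vector) ctensor, 'c::complex_vector) ctensor
    \<Rightarrow> ('a, ('b, 'c) ctensor) ctensor"
  where "tensor_assoc =
    tensor_lift UNIV UNIV (\<lambda>t z. tensor_lift UNIV UNIV (\<lambda>x y. x \<otimes> (y \<otimes> z)) t)"

definition tensor_mult ::
  "('a::complex_algebra_1, 'b::complex_algebra_1) ctensor \<Rightarrow> ('a, 'b) ctensor \<Rightarrow> ('a, 'b) ctensor"
  where "tensor_mult s t =
    tensor_lift UNIV UNIV (\<lambda>x y. tensor_lift UNIV UNIV (\<lambda>x' y'. (x * x') \<otimes> (y * y')) t) s"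


section \<open>Hopf *-algebras\<close>

locale hopf_algebra =
  fixes \<Delta> :: "'h::complex_algebra_1 \<Rightarrow> ('h, 'h) ctensor"
    and \<epsilon> :: "'h \<Rightarrow> complex"
    and S :: "'h \<Rightarrow> 'h"
  assumes comult_linear: "clinear \<Delta>"
    and counit_linear: "clinear \<epsilon>"
    and antipode_linear: "clinear S"
    and coassoc: "tensor_assoc (tensor_map \<Delta> (\<lambda>x. x) (\<Delta> h)) = tensor_map (\<lambda>x. x) \<Delta> (\<Delta> h)"
    and counit_left: "tensor_lift UNIV UNIV (\<lambda>x y. \<epsilon> x *\<^sub>C y) (\<Delta> h) = h"
    and counit_right: "tensor_lift UNIV UNIV (\<lambda>x y. \<epsilon> y *\<^sub>C x) (\<Delta> h) = h"
    and comult_mult: "\<Delta> (g * h) = tensor_mult (\<Delta> g) (\<Delta> h)"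
    and comult_one: "\<Delta> 1 = 1 \<otimes> 1"
    and counit_mult: "\<epsilon> (g * h) = \<epsilon> g * \<epsilon> h"
    and counit_one: "\<epsilon> 1 = 1"
    and antipode_left: "tensor_lift UNIV UNIV (\<lambda>x y. S x * y) (\<Delta> h) = \<epsilon> h *\<^sub>C 1"
    and antipode_right: "tensor_lift UNIV UNIV (\<lambda>x y. x * S y) (\<Delta> h) = \<epsilon> h *\<^sub>C 1"

locale hopf_star_algebra = hopf_algebra \<Delta> \<epsilon> S
  for \<Delta> :: "'h::complex_algebra_1 \<Rightarrow> ('h, 'h) ctensor" and \<epsilon> S +
  fixes star :: "'h \<Rightarrow> 'h"
  assumes star_add: "star (g + h) = star g + star h"
    and star_scaleC: "star (c *\<^sub>C h) = cnj c *\<^sub>C star h"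
    and star_star: "star (star h) = h"
    and star_mult: "star (g * h) = star h * star g"
    and comult_star: "\<Delta> (star h) = tensor_map star star (\<Delta> h)"
    and counit_star: "\<epsilon> (star h) = cnj (\<epsilon> h)"


section \<open>Finite-dimensional comodules\<close>

text \<open>
  A comodule has as underlying space a subspace \<open>V\<close> of a type; only the values of the coaction on \<open>V\<close>
  matter.
\<close>

definition fd_right_comodule ::
  "('h::complex_algebra_1 \<Rightarrow> ('h, 'h) ctensor) \<Rightarrow> ('h \<Rightarrow> complex)
    \<Rightarrow> 'v::complex_vector set \<Rightarrow> ('v \<Rightarrow> ('v, 'h) ctensor) \<Rightarrow> bool"
  where "fd_right_comodule \<Delta> \<epsilon> V \<rho> \<longleftrightarrow>
    finite_dim V \<and> clinear_on V \<rho> \<and> \<rho> ` V \<subseteq> tensor_subspace V UNIV \<and>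
    (\<forall>v\<in>V. tensor_assoc (tensor_lift V UNIV (\<lambda>x h. \<rho> x \<otimes> h) (\<rho> v))
            = tensor_lift V UNIV (\<lambda>x h. x \<otimes> \<Delta> h) (\<rho> v)) \<and>
    (\<forall>v\<in>V. tensor_lift V UNIV (\<lambda>x h. \<epsilon> h *\<^sub>C x) (\<rho> v) = v)"

definition comodule_hom ::
  "'v::complex_vector set \<Rightarrow> ('v \<Rightarrow> ('v, 'h::complex_vector) ctensor)
    \<Rightarrow> 'w::complex_vector set \<Rightarrow> ('w \<Rightarrow> ('w, 'h) ctensor) \<Rightarrow> ('v \<Rightarrow> 'w) \<Rightarrow> bool"
  where "comodule_hom V \<rho> W \<sigma> T \<longleftrightarrow>
    clinear_on V T \<and> T ` V \<subseteq> W \<and>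
    (\<forall>v\<in>V. \<sigma> (T v) = tensor_lift V UNIV (\<lambda>x h. T x \<otimes> h) (\<rho> v))"

text \<open>Functionals on \<open>V\<close> are represented by their extension by zero to the ambient type.\<close>

definition dual_space :: "'v::complex_vector set \<Rightarrow> ('v \<Rightarrow> complex) set"
  where "dual_space V = {f. clinear_on V f \<and> (\<forall>x. x \<notin> V \<longrightarrow> f x = 0)}"

definition dual_coaction ::
  "('h::complex_vector \<Rightarrow> 'h) \<Rightarrow> 'v::complex_vector set \<Rightarrow> ('v \<Rightarrow> ('v, 'h) ctensor)
    \<Rightarrow> ('v \<Rightarrow> complex) \<Rightarrow> ('v \<Rightarrow> complex, 'h) ctensor"
  where "dual_coaction S V \<rho> f =
    (THE t. t \<in> tensor_subspace (dual_space V) UNIV \<and>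
      (\<forall>m\<in>V. tensor_lift (dual_space V) UNIV (\<lambda>g h. g m *\<^sub>C h) t
             = tensor_lift V UNIV (\<lambda>x h. f x *\<^sub>C S h) (\<rho> m)))"

definition conj_coaction ::
  "('h::complex_vector \<Rightarrow> 'h) \<Rightarrow> 'v::complex_vector set \<Rightarrow> ('v \<Rightarrow> ('v, 'h) ctensor)
    \<Rightarrow> 'v conj_space \<Rightarrow> ('v conj_space, 'h) ctensor"
  where "conj_coaction star V \<rho> m =
    tensor_lift V UNIV (\<lambda>x h. to_conj x \<otimes> star h) (\<rho> (from_conj m))"

text \<open>Inner products are conjugate-linear in the first argument.\<close>

definition inner_product_on ::
  "'v::complex_vector set \<Rightarrow> ('v \<Rightarrow> 'v \<Rightarrow> complex) \<Rightarrow> bool"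
  where "inner_product_on V ip \<longleftrightarrow>
    (\<forall>x\<in>V. clinear_on V (ip x)) \<and>
    (\<forall>x\<in>V. \<forall>y\<in>V. ip x y = cnj (ip y x)) \<and>
    (\<forall>x\<in>V. x \<noteq> 0 \<longrightarrow> 0 < Re (ip x x))"

definition inner_product_map ::
  "'v set \<Rightarrow> ('v \<Rightarrow> 'v \<Rightarrow> complex) \<Rightarrow> 'v conj_space \<Rightarrow> 'v \<Rightarrow> complex"
  where "inner_product_map V ip m = (\<lambda>y. if y \<in> V then ip (from_conj m) y else 0)"

definition compatible_inner_product ::
  "('h::complex_algebra_1 \<Rightarrow> 'h) \<Rightarrow> ('h \<Rightarrow> 'h) \<Rightarrow> 'v::complex_vector set
    \<Rightarrow> ('v \<Rightarrow> ('v, 'h) ctensor) \<Rightarrow> ('v \<Rightarrow> 'v \<Rightarrow> complex) \<Rightarrow> bool"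
  where "compatible_inner_product S star V \<rho> ip \<longleftrightarrow>
    inner_product_on V ip \<and>
    comodule_hom (to_conj ` V) (conj_coaction star V \<rho>) (dual_space V) (dual_coaction S V \<rho>)
      (inner_product_map V ip)"

text \<open>
  Quantifying over subspaces of \<open>nat \<Rightarrow> complex\<close> covers all finite-dimensional comodules up to
  isomorphism, since every finite-dimensional complex vector space embeds there.
\<close>

locale cqg_algebra = hopf_star_algebra \<Delta> \<epsilon> S star
  for \<Delta> :: "'h::complex_algebra_1 \<Rightarrow> ('h, 'h) ctensor" and \<epsilon> S star +
  assumes ex_compatible_inner_product:
    "\<And>(V :: (nat \<Rightarrow> complex) set) \<rho>. fd_right_comodule \<Delta> \<epsilon> V \<rho> \<Longrightarrow>
      \<exists>ip. compatible_inner_product S star V \<rho> ip"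

definition coideal_star_subalgebra ::
  "('h::complex_algebra_1 \<Rightarrow> ('h, 'h) ctensor) \<Rightarrow> ('h \<Rightarrow> 'h) \<Rightarrow> 'h set \<Rightarrow> bool"
  where "coideal_star_subalgebra \<Delta> star A \<longleftrightarrow>
    csubspace A \<and> 1 \<in> A \<and> (\<forall>x\<in>A. \<forall>y\<in>A. x * y \<in> A) \<and> (\<forall>x\<in>A. star x \<in> A) \<and>
    \<Delta> ` A \<subseteq> tensor_subspace A UNIV"


section \<open>Modules over a subring and faithful flatness\<close>

definition left_module :: "'r::ring_1 set \<Rightarrow> ('r \<Rightarrow> 'm::ab_group_add \<Rightarrow> 'm) \<Rightarrow> bool"
  where "left_module A act \<longleftrightarrow>
    (\<forall>a\<in>A. \<forall>x y. act a (x + y) = act a x + act a y) \<and>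
    (\<forall>a\<in>A. \<forall>b\<in>A. \<forall>x. act (a + b) x = act a x + act b x) \<and>
    (\<forall>a\<in>A. \<forall>b\<in>A. \<forall>x. act (a * b) x = act a (act b x)) \<and>
    (\<forall>x. act 1 x = x)"

definition right_module :: "'r::ring_1 set \<Rightarrow> ('m::ab_group_add \<Rightarrow> 'r \<Rightarrow> 'm) \<Rightarrow> bool"
  where "right_module A act \<longleftrightarrow>
    (\<forall>a\<in>A. \<forall>x y. act (x + y) a = act x a + act y a) \<and>
    (\<forall>a\<in>A. \<forall>b\<in>A. \<forall>x. act x (a + b) = act x a + act x b) \<and>
    (\<forall>a\<in>A. \<forall>b\<in>A. \<forall>x. act x (a * b) = act (act x a) b) \<and>
    (\<forall>x. act x 1 = x)"

definition left_module_hom ::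
  "'r set \<Rightarrow> ('r \<Rightarrow> 'm::ab_group_add \<Rightarrow> 'm) \<Rightarrow> ('r \<Rightarrow> 'n::ab_group_add \<Rightarrow> 'n) \<Rightarrow> ('m \<Rightarrow> 'n) \<Rightarrow> bool"
  where "left_module_hom A lM lN f \<longleftrightarrow>
    (\<forall>x y. f (x + y) = f x + f y) \<and> (\<forall>a\<in>A. \<forall>x. f (lM a x) = lN a (f x))"

definition right_module_hom ::
  "'r set \<Rightarrow> ('m::ab_group_add \<Rightarrow> 'r \<Rightarrow> 'm) \<Rightarrow> ('n::ab_group_add \<Rightarrow> 'r \<Rightarrow> 'n) \<Rightarrow> ('m \<Rightarrow> 'n) \<Rightarrow> bool"
  where "right_module_hom A rM rN f \<longleftrightarrow>
    (\<forall>x y. f (x + y) = f x + f y) \<and> (\<forall>a\<in>A. \<forall>x. f (rM x a) = rN (f x) a)"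

text \<open>
  A left \<open>A\<close>-module \<open>K\<close> is faithfully flat if a sequence \<open>M \<rightarrow> N \<rightarrow> P\<close> of right \<open>A\<close>-modules is exact
  if and only if \<open>M \<otimes>\<^sub>A K \<rightarrow> N \<otimes>\<^sub>A K \<rightarrow> P \<otimes>\<^sub>A K\<close> is exact.  The types of \<open>M\<close>, \<open>N\<close>, \<open>P\<close> cannot be
  quantified inside a definition, so they are passed as parameters; faithful flatness proper is the
  statement with these as free type variables.
\<close>

definition faithfully_flat_left ::
  "'m::ab_group_add itself \<Rightarrow> 'n::ab_group_add itself \<Rightarrow> 'p::ab_group_add itself
    \<Rightarrow> 'r::ring_1 set \<Rightarrow> ('r \<Rightarrow> 'k::ab_group_add \<Rightarrow> 'k) \<Rightarrow> bool"
  where "faithfully_flat_left _ _ _ A l \<longleftrightarrow>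
    left_module A l \<and>
    (\<forall>(rM :: 'm \<Rightarrow> 'r \<Rightarrow> 'm) (rN :: 'n \<Rightarrow> 'r \<Rightarrow> 'n) (rP :: 'p \<Rightarrow> 'r \<Rightarrow> 'p) f g.
      right_module A rM \<longrightarrow> right_module A rN \<longrightarrow> right_module A rP \<longrightarrow>
      right_module_hom A rM rN f \<longrightarrow> right_module_hom A rN rP g \<longrightarrow>
      (range f = {y. g y = 0} \<longleftrightarrow>
       tensor_over_map A rN l f (\<lambda>x. x) ` tensor_over A rM l =
         {Y \<in> tensor_over A rN l. tensor_over_map A rP l g (\<lambda>x. x) Y = tensor_cong A rP l `` {0}}))"

definition faithfully_flat_right ::
  "'m::ab_group_add itself \<Rightarrow> 'n::ab_group_add itself \<Rightarrow> 'p::ab_group_add itself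
    \<Rightarrow> 'r::ring_1 set \<Rightarrow> ('k::ab_group_add \<Rightarrow> 'r \<Rightarrow> 'k) \<Rightarrow> bool"
  where "faithfully_flat_right _ _ _ A r \<longleftrightarrow>
    right_module A r \<and>
    (\<forall>(lM :: 'r \<Rightarrow> 'm \<Rightarrow> 'm) (lN :: 'r \<Rightarrow> 'n \<Rightarrow> 'n) (lP :: 'r \<Rightarrow> 'p \<Rightarrow> 'p) f g.
      left_module A lM \<longrightarrow> left_module A lN \<longrightarrow> left_module A lP \<longrightarrow>
      left_module_hom A lM lN f \<longrightarrow> left_module_hom A lN lP g \<longrightarrow>
      (range f = {y. g y = 0} \<longleftrightarrow>
       tensor_over_map A r lN (\<lambda>x. x) f ` tensor_over A r lM =
         {Y \<in> tensor_over A r lN. tensor_over_map A r lP (\<lambda>x. x) g Y = tensor_cong A r lP `` {0}}))"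

end

theory Submission
  imports Defs "HOL-Computational_Algebra.Fundamental_Theorem_Algebra"
begin

text \<open>
  Compatible inner products make every finite-dimensional comodule unitary.  This yields a two-sided
  invariant functional \<open>h\<close> on \<open>H\<close> with \<open>h(x\<^sup>* x) > 0\<close> for \<open>x \<noteq> 0\<close>.  For the inner product \<open>h(x\<^sup>* y)\<close>, left
  multiplication by \<open>a\<close> is adjoint to left multiplication by \<open>a\<^sup>*\<close>, and subcomodules of \<open>H\<^sup>n\<close> are
  orthogonally complemented because isotypic components are finite-dimensional; so relative Hopf
  modules split off \<open>A\<close>-linearly.  Hence \<open>A\<close> is a left \<open>A\<close>-linear retract of \<open>H\<close>, and every \<open>x\<close> in \<open>H\<close> can be
  written as \<open>\<Sum>\<^sub>l s\<^sub>l(x) e\<^sub>l\<close> with left \<open>A\<close>-linear \<open>s\<^sub>l : H \<rightarrow> A\<close>.  Applying such functionals to the second tensor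
  factor moves exactness back and forth between \<open>N\<close> and \<open>N \<otimes>\<^sub>A H\<close>.
\<close>

text \<open>\<open>H\<close> is only a pre-Hilbert space, and \<open>A\<close> and the modules of
  columns over it may be infinite-dimensional, so orthogonal projections cannot be taken from
  completeness. They are found inside a finite-dimensional coefficient space \<open>C\<close>: the
  projection onto \<open>C\<close> is self-adjoint and maps every subcomodule into itself, so
  vectors with entries in \<open>C\<close> can be projected without leaving \<open>C\<close>.
  Closure of \<open>A\<close> under \<open>star\<close> is what makes the resulting projection onto
  an \<open>A\<close>-submodule \<open>A\<close>-linear. Two outputs matter at the end. A retraction
  \<open>E\<close> with \<open>E 1 = 1\<close> gives faithfulness. Expansions valid simultaneously
  for a finite family of elements give flatness; no basis of all of \<open>H\<close> is sought,
  because one tensor involves only finitely many elements of \<open>H\<close>. Positivity of the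
  Haar functional is not visible from its construction: Schur's lemma makes its form on a simple
  subcomodule a multiple of a Euclidean one, and a coinvariant element decides the sign of that
  multiple. The statement for right modules is reduced to the one for left modules by
  \<open>star\<close>, with the tensor factors exchanged.\<close>

interpretation complex_vector_pair: vector_space_pair
  "scaleC :: complex \<Rightarrow> 'a \<Rightarrow> 'a::complex_vector" "scaleC :: complex \<Rightarrow> 'b \<Rightarrow> 'b::complex_vector"
  by unfold_locales

lemma clinearI:
  assumes "\<And>x y. f (x + y) = f x + f y" "\<And>c x. f (c *\<^sub>C x) = c *\<^sub>C f x"
  shows "clinear f"
  using assms by (simp add: Vector_Spaces.linear_iff complex_vector.vector_space_axioms)

lemma clinear_add: "clinear f \<Longrightarrow> f (x + y) = f x + f y"
  and clinear_scale: "clinear f \<Longrightarrow> f (c *\<^sub>C x) = c *\<^sub>C f x"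
  and clinear_sum: "clinear f \<Longrightarrow> f (sum g I) = (\<Sum>i\<in>I. f (g i))"
  and clinear_zero: "clinear f \<Longrightarrow> f 0 = 0"
  and clinear_diff: "clinear f \<Longrightarrow> f (x - y) = f x - f y"
  by (simp_all add: complex_vector_pair.linear_add complex_vector_pair.linear_scale
      complex_vector_pair.linear_sum complex_vector_pair.linear_0 complex_vector_pair.linear_diff)

section \<open>Maps out of tensor products\<close>

definition int_scale :: "int \<Rightarrow> 'a::ab_group_add \<Rightarrow> 'a"
  where "int_scale k x = (\<Sum>i<nat k. x) - (\<Sum>i<nat (- k). x)"

lemma int_scale_0 [simp]: "int_scale 0 x = 0" and int_scale_1 [simp]: "int_scale 1 x = x"
  by (simp_all add: int_scale_def lessThan_Suc)

lemma int_scale_diff_nat: "int_scale (int a - int b) x = (\<Sum>i<a. x) - (\<Sum>i<b. x)"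
proof -
  have add: "(\<Sum>i<m + n. x) = (\<Sum>i<m. x) + (\<Sum>i<n. x)" for m n :: nat
    by (induction m) (simp_all add: add.assoc)
  show ?thesis
  proof (cases "b \<le> a")
    case True
    then have "nat (int a - int b) = a - b" "nat (- (int a - int b)) = 0" by auto
    then show ?thesis
      using add[of "a - b" b] True by (simp add: int_scale_def algebra_simps)
  next
    case False
    then have "nat (int a - int b) = 0" "nat (- (int a - int b)) = b - a" by auto
    then show ?thesis
      using add[of "b - a" a] False by (simp add: int_scale_def algebra_simps)
  qed
qed

lemma int_scale_diff: "int_scale (k - l) x = int_scale k x - int_scale l x"
proof -
  obtain a b where k: "k = int a - int b" by (rule int_diff_cases)
  obtain c d where l: "l = int c - int d" by (rule int_diff_cases)
  have add: "(\<Sum>i<m + n. x) = (\<Sum>i<m. x) + (\<Sum>i<n. x)" for m n :: nat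
    by (induction m) (simp_all add: add.assoc)
  have "k - l = int (a + d) - int (b + c)" by (simp add: k l)
  then show ?thesis
    by (simp only: int_scale_diff_nat k l add) (simp add: algebra_simps)
qed

text \<open>The additive extension of \<open>b\<close> to the free abelian group.
  \<open>frag_extend\<close> reaches only free abelian groups, while tensors have to be evaluated in
  arbitrary ones.\<close>

definition frag_eval :: "('a \<Rightarrow> 'b::ab_group_add) \<Rightarrow> ('a \<Rightarrow>\<^sub>0 int) \<Rightarrow> 'b"
  where "frag_eval b s = (\<Sum>p\<in>Poly_Mapping.keys s. int_scale (Poly_Mapping.lookup s p) (b p))"

lemma frag_eval_superset:
  assumes "finite K" "Poly_Mapping.keys s \<subseteq> K"
  shows "frag_eval b s = (\<Sum>p\<in>K. int_scale (Poly_Mapping.lookup s p) (b p))"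
  unfolding frag_eval_def
  by (rule sum.mono_neutral_left) (use assms in \<open>auto simp: in_keys_iff\<close>)

lemma frag_eval_diff: "frag_eval b (s - t) = frag_eval b s - frag_eval b t"
proof -
  let ?K = "Poly_Mapping.keys s \<union> Poly_Mapping.keys t"
  have "Poly_Mapping.keys (s - t) \<subseteq> ?K" by (rule keys_diff)
  then show ?thesis
    by (simp add: frag_eval_superset[of ?K] lookup_minus int_scale_diff sum_subtractf)
qed

lemma frag_eval_0 [simp]: "frag_eval b 0 = 0"
  by (simp add: frag_eval_def)

lemma frag_eval_of [simp]: "frag_eval b (frag_of p) = b p"
  by (simp add: frag_eval_def)

lemma frag_eval_add: "frag_eval b (s + t) = frag_eval b s + frag_eval b t"
  using frag_eval_diff[of b "s + t" t] by simp

lemma frag_eval_group_closure: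
  assumes "s \<in> group_closure R" "\<And>u. u \<in> R \<Longrightarrow> frag_eval b u = 0"
  shows "frag_eval b s = 0"
  using assms(1) by induction (auto simp: frag_eval_diff assms(2))

definition balanced_over ::
  "'r set \<Rightarrow> ('m::ab_group_add \<Rightarrow> 'r \<Rightarrow> 'm) \<Rightarrow> ('r \<Rightarrow> 'n::ab_group_add \<Rightarrow> 'n)
    \<Rightarrow> ('m \<Rightarrow> 'n \<Rightarrow> 'c::ab_group_add) \<Rightarrow> bool"
  where "balanced_over A r l b \<longleftrightarrow>
    (\<forall>x x' y. b (x + x') y = b x y + b x' y) \<and> (\<forall>x y y'. b x (y + y') = b x y + b x y') \<and>
    (\<forall>a\<in>A. \<forall>x y. b (r x a) y = b x (l a y))"

text \<open>A balanced map sends every relator to 0, and the formal sums that evaluate to 0 form a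
  subgroup.\<close>

lemma frag_eval_tensor_cong:
  assumes "balanced_over A r l b" "(s, t) \<in> tensor_cong A r l"
  shows "frag_eval (case_prod b) s = frag_eval (case_prod b) t"
proof -
  have "frag_eval (case_prod b) (s - t) = 0"
    by (rule frag_eval_group_closure[of _ "tensor_relators A r l"])
      (use assms in \<open>auto simp: tensor_cong_def tensor_relators_def balanced_over_def frag_eval_diff\<close>)
  then show ?thesis by (simp add: frag_eval_diff)
qed

section \<open>Calculus of the congruence behind balanced tensor products\<close>

lemma tensor_cong_refl [simp]: "(s, s) \<in> tensor_cong A r l"
  by (simp add: tensor_cong_def)

lemma tensor_cong_sym: "(s, t) \<in> tensor_cong A r l \<Longrightarrow> (t, s) \<in> tensor_cong A r l"
  using equiv_tensor_cong[of A r l] by (auto elim: equivE dest: symD)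

lemma tensor_cong_trans [trans]:
  "(s, t) \<in> tensor_cong A r l \<Longrightarrow> (t, u) \<in> tensor_cong A r l \<Longrightarrow> (s, u) \<in> tensor_cong A r l"
  using equiv_tensor_cong[of A r l] by (auto elim!: equivE dest: transD)

lemma tensor_cong_add:
  "(s, t) \<in> tensor_cong A r l \<Longrightarrow> (s', t') \<in> tensor_cong A r l \<Longrightarrow> (s + s', t + t') \<in> tensor_cong A r l"
  unfolding tensor_cong_def by (simp only: mem_Collect_eq case_prod_conv add_diff_add group_closure_add)

lemma tensor_cong_diff:
  assumes "(s, t) \<in> tensor_cong A r l" "(s', t') \<in> tensor_cong A r l"
  shows "(s - s', t - t') \<in> tensor_cong A r l"
proof -
  have "(s - s') - (t - t') = (s - t) - (s' - t')" by simp
  then show ?thesis using assms group_closure.diff[of "s - t" _ "s' - t'"]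
    by (simp only: tensor_cong_def mem_Collect_eq case_prod_conv)
qed

lemma tensor_cong_add_left:
  "(frag_of (x + x', y), frag_of (x, y) + frag_of (x', y)) \<in> tensor_cong A r l"
proof -
  have "frag_of (x + x', y) - frag_of (x, y) - frag_of (x', y) \<in> group_closure (tensor_relators A r l)"
    unfolding tensor_relators_def by (rule group_closure.base, rule insertI2) blast
  then show ?thesis by (simp add: tensor_cong_def diff_diff_eq)
qed

lemma tensor_cong_add_right:
  "(frag_of (x, y + y'), frag_of (x, y) + frag_of (x, y')) \<in> tensor_cong A r l"
proof -
  have "frag_of (x, y + y') - frag_of (x, y) - frag_of (x, y') \<in> group_closure (tensor_relators A r l)"
    unfolding tensor_relators_def by (rule group_closure.base, rule insertI2) blast
  then show ?thesis by (simp add: tensor_cong_def diff_diff_eq)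
qed

lemma tensor_cong_move:
  "a \<in> A \<Longrightarrow> (frag_of (r x a, y), frag_of (x, l a y)) \<in> tensor_cong A r l"
  unfolding tensor_cong_def tensor_relators_def mem_Collect_eq case_prod_conv
  by (rule group_closure.base, rule insertI2) blast

lemma tensor_cong_zero_left: "(frag_of (0, y), 0) \<in> tensor_cong A r l"
  using tensor_cong_diff[OF tensor_cong_add_left[of 0 0 y A r l] tensor_cong_refl[of "frag_of (0, y)"]]
  by (auto dest: tensor_cong_sym)

lemma tensor_cong_zero_right: "(frag_of (x, 0), 0) \<in> tensor_cong A r l"
  using tensor_cong_diff[OF tensor_cong_add_right[of x 0 0 A r l] tensor_cong_refl[of "frag_of (x, 0)"]]
  by (auto dest: tensor_cong_sym)

lemma tensor_cong_minus_left: "(frag_of (- x, y), - frag_of (x, y)) \<in> tensor_cong A r l"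
  using tensor_cong_diff[OF
      tensor_cong_trans[OF tensor_cong_sym[OF tensor_cong_add_left[of "- x" x y A r l]]]
      tensor_cong_refl[of "frag_of (x, y)"]] tensor_cong_zero_left[of y A r l]
  by force

lemma tensor_cong_sum_left:
  "(frag_of (sum f I, y), \<Sum>i\<in>I. frag_of (f i, y)) \<in> tensor_cong A r l"
proof (induction I rule: infinite_finite_induct)
  case (insert i I)
  then show ?case
    using tensor_cong_trans[OF tensor_cong_add_left tensor_cong_add[OF tensor_cong_refl insert.IH]]
    by simp
qed (simp_all add: tensor_cong_zero_left)

lemma tensor_cong_sum_right:
  "(frag_of (x, sum f I), \<Sum>i\<in>I. frag_of (x, f i)) \<in> tensor_cong A r l"
proof (induction I rule: infinite_finite_induct)
  case (insert i I)
  then show ?case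
    using tensor_cong_trans[OF tensor_cong_add_right tensor_cong_add[OF tensor_cong_refl insert.IH]]
    by simp
qed (simp_all add: tensor_cong_zero_right)

lemma tensor_cong_sum:
  "(\<And>i. i \<in> I \<Longrightarrow> (f i, g i) \<in> tensor_cong A r l) \<Longrightarrow> (sum f I, sum g I) \<in> tensor_cong A r l"
  by (induction I rule: infinite_finite_induct) (auto intro: tensor_cong_add)

text \<open>Concatenates two finite families into one; sums of pure tensors and, later, expansions
  over \<open>A\<close> are joined in this way.\<close>

lemma sum_append_index:
  fixes f g :: "nat \<Rightarrow> 'a::comm_monoid_add"
  shows "(\<Sum>i<m + n. if i < m then f i else g (i - m)) = (\<Sum>i<m. f i) + (\<Sum>i<n. g i)"
  by (induction n) (simp_all add: add.assoc)

text \<open>Integer coefficients can be avoided: multiplicities become repeated terms, and a minus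
  sign moves into the left factor.\<close>

lemma tensor_cong_frag_sum:
  "\<exists>n x y. (s, \<Sum>i<(n::nat). frag_of (x i, y i)) \<in> tensor_cong A r l"
proof (induction s rule: frag_induction[OF subset_UNIV])
  case 1
  show ?case by (rule exI[of _ 0]) simp
next
  case (2 p)
  show ?case by (rule exI[of _ 1], rule exI[of _ "\<lambda>_. fst p"], rule exI[of _ "\<lambda>_. snd p"]) simp
next
  case (3 s t)
  then obtain m n x y x' y' where
    s: "(s, \<Sum>i<(m::nat). frag_of (x i, y i)) \<in> tensor_cong A r l" and
    t: "(t, \<Sum>i<(n::nat). frag_of (x' i, y' i)) \<in> tensor_cong A r l" by blast
  let ?x = "\<lambda>i. if i < m then x i else - x' (i - m)" and ?y = "\<lambda>i. if i < m then y i else y' (i - m)"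
  have "(\<Sum>i<n. - frag_of (x' i, y' i), \<Sum>i<n. frag_of (- x' i, y' i)) \<in> tensor_cong A r l"
    by (intro tensor_cong_sum tensor_cong_sym[OF tensor_cong_minus_left])
  from tensor_cong_add[OF tensor_cong_refl[of "\<Sum>i<m. frag_of (x i, y i)"] this]
  have "((\<Sum>i<m. frag_of (x i, y i)) - (\<Sum>i<n. frag_of (x' i, y' i)),
      \<Sum>i<m + n. frag_of (?x i, ?y i)) \<in> tensor_cong A r l"
    by (simp add: if_distrib[of frag_of] if_distrib[of "\<lambda>x. (x, _)"] if_distrib[of "Pair _"] sum_negf
        sum_append_index[where f = "\<lambda>i. frag_of (x i, y i)" and g = "\<lambda>i. frag_of (- x' i, y' i)", symmetric]
        cong: if_cong)
  from tensor_cong_trans[OF tensor_cong_diff[OF s t] this] show ?case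
    by (intro exI)
qed

section \<open>Pure tensors over the complex numbers\<close>

lemma tensor_add_left: "(x + x') \<otimes> y = x \<otimes> y + x' \<otimes> y"
  by transfer (rule tensor_cong_add_left)

lemma tensor_add_right: "x \<otimes> (y + y') = x \<otimes> y + x \<otimes> y'"
  by transfer (rule tensor_cong_add_right)

lemma tensor_scale_left: "(c *\<^sub>C x) \<otimes> y = c *\<^sub>C (x \<otimes> y)"
  by transfer (simp add: frag_tensor_map_def)

lemma tensor_scale_right: "x \<otimes> (c *\<^sub>C y) = c *\<^sub>C (x \<otimes> y)"
  unfolding tensor_scale_left[symmetric]
  by transfer (rule tensor_cong_sym, rule tensor_cong_move, simp)

lemma tensor_zero_left [simp]: "0 \<otimes> y = 0"
  using tensor_add_left[of 0 0 y] by simp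

lemma tensor_zero_right [simp]: "x \<otimes> 0 = 0"
  using tensor_add_right[of x 0 0] by simp

lemma tensor_sum_left: "sum f I \<otimes> y = (\<Sum>i\<in>I. f i \<otimes> y)"
  by (induction I rule: infinite_finite_induct) (auto simp: tensor_add_left)

lemma tensor_sum_right: "x \<otimes> sum f I = (\<Sum>i\<in>I. x \<otimes> f i)"
  by (induction I rule: infinite_finite_induct) (auto simp: tensor_add_right)

text \<open>Stands in for Sweedler notation: identities about \<open>\<Delta>\<close> are checked on
  an arbitrary expansion of this kind.\<close>

lemma tensor_expand:
  fixes t :: "('a::complex_vector, 'b::complex_vector) ctensor"
  obtains n x y where "t = (\<Sum>i<(n::nat). x i \<otimes> y i)"
proof -
  have abs: "abs_ctensor (\<Sum>i<(n::nat). frag_of (x i, y i)) = (\<Sum>i<n. x i \<otimes> y i)"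
    for n and x :: "nat \<Rightarrow> 'a" and y :: "nat \<Rightarrow> 'b"
    by (induction n) (simp_all add: zero_ctensor_def tensor.abs_eq plus_ctensor.abs_eq[symmetric])
  obtain s where s: "t = abs_ctensor s"
    using Quotient3_abs_rep[OF Quotient3_ctensor, of t] by metis
  obtain n x y where
    "(s, \<Sum>i<(n::nat). frag_of (x i, y i)) \<in> tensor_cong UNIV (\<lambda>x c. c *\<^sub>C x) (*\<^sub>C)"
    using tensor_cong_frag_sum by blast
  then have "t = (\<Sum>i<n. x i \<otimes> y i)"
    unfolding s abs[symmetric] by (simp add: ctensor.abs_eq_iff)
  then show thesis by (rule that)
qed

section \<open>Well-definedness of \<open>tensor_lift\<close> on subspaces\<close>

definition balanced_on ::
  "'a::complex_vector set \<Rightarrow> 'b::complex_vector set \<Rightarrow> ('a \<Rightarrow> 'b \<Rightarrow> 'c::ab_group_add) \<Rightarrow> bool"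
  where "balanced_on V W b \<longleftrightarrow>
    (\<forall>x\<in>V. \<forall>x'\<in>V. \<forall>y\<in>W. b (x + x') y = b x y + b x' y) \<and>
    (\<forall>x\<in>V. \<forall>y\<in>W. \<forall>y'\<in>W. b x (y + y') = b x y + b x y') \<and>
    (\<forall>c. \<forall>x\<in>V. \<forall>y\<in>W. b (c *\<^sub>C x) y = b x (c *\<^sub>C y))"

lemma balanced_onI:
  assumes "\<And>x x' y. x \<in> V \<Longrightarrow> x' \<in> V \<Longrightarrow> y \<in> W \<Longrightarrow> b (x + x') y = b x y + b x' y"
    and "\<And>x y y'. x \<in> V \<Longrightarrow> y \<in> W \<Longrightarrow> y' \<in> W \<Longrightarrow> b x (y + y') = b x y + b x y'"
    and "\<And>c x y. x \<in> V \<Longrightarrow> y \<in> W \<Longrightarrow> b (c *\<^sub>C x) y = b x (c *\<^sub>C y)"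
  shows "balanced_on V W b"
  using assms by (simp add: balanced_on_def)

lemma subspace_projection:
  fixes V :: "'a::complex_vector set"
  assumes "csubspace V"
  obtains p where "clinear p" "\<And>x. p x \<in> V" "\<And>x. x \<in> V \<Longrightarrow> p x = x"
proof -
  have "clinear (\<lambda>x::'a. x)" by (rule complex_vector.linear_ident)
  from complex_vector_pair.linear_exists_left_inverse_on[OF this assms]
  obtain p :: "'a \<Rightarrow> 'a" where "p ` UNIV \<subseteq> V" "clinear p" "\<forall>v\<in>V. p v = v"
    by auto
  then show thesis by (intro that[of p]) auto
qed

text \<open>
  A linear projection onto \<open>V\<close> extends \<open>b\<close> to the ambient spaces, which shows that the definite
  description in \<open>tensor_lift\<close> has a value.
\<close>

lemma tensor_lift_extension:
  fixes b :: "'a::complex_vector \<Rightarrow> 'b::complex_vector \<Rightarrow> 'c::ab_group_add"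
  assumes V: "csubspace V" and W: "csubspace W" and b: "balanced_on V W b"
  obtains \<Phi> where "\<And>s t. \<Phi> (s + t) = \<Phi> s + \<Phi> t" "\<Phi> 0 = 0"
    "\<And>x y. x \<in> V \<Longrightarrow> y \<in> W \<Longrightarrow> \<Phi> (x \<otimes> y) = b x y"
    "\<And>ps. set ps \<subseteq> V \<times> W \<Longrightarrow>
      tensor_lift V W b (\<Sum>(x, y)\<leftarrow>ps. x \<otimes> y) = \<Phi> (\<Sum>(x, y)\<leftarrow>ps. x \<otimes> y)"
proof -
  obtain p where p: "clinear p" "\<And>x. p x \<in> V" "\<And>x. x \<in> V \<Longrightarrow> p x = x"
    using subspace_projection[OF V] by metis
  obtain q where q: "clinear q" "\<And>x. q x \<in> W" "\<And>x. x \<in> W \<Longrightarrow> q x = x"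
    using subspace_projection[OF W] by metis
  let ?b = "\<lambda>x y. b (p x) (q y)"
  have bal: "balanced_over (UNIV :: complex set) (\<lambda>x c. c *\<^sub>C x) (*\<^sub>C) ?b"
    using b p q by (simp add: balanced_over_def balanced_on_def clinear_add clinear_scale)
  define \<Phi> where "\<Phi> t = frag_eval (case_prod ?b) (rep_ctensor t)" for t
  have \<Phi>: "\<Phi> (abs_ctensor s) = frag_eval (case_prod ?b) s" for s
    unfolding \<Phi>_def using Quotient3_abs_rep[OF Quotient3_ctensor, of "abs_ctensor s"]
    by (intro frag_eval_tensor_cong[OF bal]) (simp add: ctensor.abs_eq_iff)
  have add: "\<Phi> (s + t) = \<Phi> s + \<Phi> t" for s t
    using Quotient3_abs_rep[OF Quotient3_ctensor, of s] Quotient3_abs_rep[OF Quotient3_ctensor, of t]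
    by (metis plus_ctensor.abs_eq \<Phi> frag_eval_add)
  have zero: "\<Phi> 0 = 0" by (simp add: zero_ctensor_def \<Phi>)
  have gen: "\<Phi> (x \<otimes> y) = b x y" if "x \<in> V" "y \<in> W" for x y
    using that p(3) q(3) by (simp add: tensor.abs_eq \<Phi>)
  have list: "\<Phi> (\<Sum>(x, y)\<leftarrow>ps. x \<otimes> y) = (\<Sum>(x, y)\<leftarrow>ps. b x y)" if "set ps \<subseteq> V \<times> W" for ps
    using that by (induction ps) (auto simp: zero add gen)
  have "tensor_lift V W b (\<Sum>(x, y)\<leftarrow>ps. x \<otimes> y) = \<Phi> (\<Sum>(x, y)\<leftarrow>ps. x \<otimes> y)"
    if ps: "set ps \<subseteq> V \<times> W" for ps
    unfolding tensor_lift_def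
  proof (rule the_equality)
    show "\<exists>qs. set qs \<subseteq> V \<times> W \<and> (\<Sum>(x, y)\<leftarrow>ps. x \<otimes> y) = (\<Sum>(x, y)\<leftarrow>qs. x \<otimes> y) \<and>
        \<Phi> (\<Sum>(x, y)\<leftarrow>ps. x \<otimes> y) = (\<Sum>(x, y)\<leftarrow>qs. b x y)"
      using ps list by blast
  qed (auto simp: list)
  with add zero gen show thesis by (rule that)
qed

lemma tensor_lift_sum:
  fixes b :: "'a::complex_vector \<Rightarrow> 'b::complex_vector \<Rightarrow> 'c::ab_group_add"
  assumes V: "csubspace V" and W: "csubspace W" and b: "balanced_on V W b"
    and x: "\<And>i. i < n \<Longrightarrow> x i \<in> V" and y: "\<And>i. i < n \<Longrightarrow> y i \<in> W"
  shows "tensor_lift V W b (\<Sum>i<(n::nat). x i \<otimes> y i) = (\<Sum>i<n. b (x i) (y i))"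
proof -
  obtain \<Phi> where \<Phi>: "\<And>s t. \<Phi> (s + t) = \<Phi> s + \<Phi> t" "\<Phi> 0 = 0"
    "\<And>x y. x \<in> V \<Longrightarrow> y \<in> W \<Longrightarrow> \<Phi> (x \<otimes> y) = b x y"
    "\<And>ps. set ps \<subseteq> V \<times> W \<Longrightarrow>
      tensor_lift V W b (\<Sum>(x, y)\<leftarrow>ps. x \<otimes> y) = \<Phi> (\<Sum>(x, y)\<leftarrow>ps. x \<otimes> y)"
    using tensor_lift_extension[OF V W b] by metis
  have "(\<Sum>i<n. x i \<otimes> y i) = (\<Sum>(x, y)\<leftarrow>map (\<lambda>i. (x i, y i)) [0..<n]. x \<otimes> y)"
    by (simp add: o_def interv_sum_list_conv_sum_set_nat atLeast0LessThan)
  with \<Phi>(4)[of "map (\<lambda>i. (x i, y i)) [0..<n]"] x y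
  have "tensor_lift V W b (\<Sum>i<n. x i \<otimes> y i) = \<Phi> (\<Sum>i<n. x i \<otimes> y i)"
    by (simp add: image_subset_iff)
  also have "m \<le> n \<Longrightarrow> \<Phi> (\<Sum>i<m. x i \<otimes> y i) = (\<Sum>i<m. b (x i) (y i))" for m
    by (induction m) (simp_all add: \<Phi> x y)
  finally show ?thesis by simp
qed

lemma tensor_lift_sum_UNIV:
  assumes "balanced_on UNIV UNIV b"
  shows "tensor_lift UNIV UNIV b (\<Sum>i<(n::nat). x i \<otimes> y i) = (\<Sum>i<n. b (x i) (y i))"
  using assms by (intro tensor_lift_sum) simp_all

lemma tensor_lift_tensor:
  assumes "balanced_on UNIV UNIV b"
  shows "tensor_lift UNIV UNIV b (x \<otimes> y) = b x y"
  using tensor_lift_sum_UNIV[OF assms, of "\<lambda>_. x" "\<lambda>_. y" 1] by simp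

lemma tensor_lift_add:
  assumes "balanced_on UNIV UNIV b"
  shows "tensor_lift UNIV UNIV b (s + t) = tensor_lift UNIV UNIV b s + tensor_lift UNIV UNIV b t"
proof -
  obtain m x y where s: "s = (\<Sum>i<(m::nat). x i \<otimes> y i)" by (rule tensor_expand)
  obtain n x' y' where t: "t = (\<Sum>i<(n::nat). x' i \<otimes> y' i)" by (rule tensor_expand)
  let ?x = "\<lambda>i. if i < m then x i else x' (i - m)" and ?y = "\<lambda>i. if i < m then y i else y' (i - m)"
  have *: "(\<Sum>i<m + n. h (?x i) (?y i)) = (\<Sum>i<m. h (x i) (y i)) + (\<Sum>i<n. h (x' i) (y' i))"
    for h :: "'a \<Rightarrow> 'b \<Rightarrow> 'd::ab_group_add"
    unfolding sum_append_index[symmetric] by (rule sum.cong) auto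
  show ?thesis
    using *[of tensor] *[of b]
    by (simp only: s t tensor_lift_sum_UNIV[OF assms] flip: *)
qed

lemma tensor_lift_clinear:
  fixes b :: "'a::complex_vector \<Rightarrow> 'b::complex_vector \<Rightarrow> 'c::complex_vector"
  assumes b: "balanced_on UNIV UNIV b" and scale: "\<And>c x y. b (c *\<^sub>C x) y = c *\<^sub>C b x y"
  shows "clinear (tensor_lift UNIV UNIV b)"
proof (rule clinearI)
  show "tensor_lift UNIV UNIV b (c *\<^sub>C t) = c *\<^sub>C tensor_lift UNIV UNIV b t" for c t
  proof -
    obtain m x y where t: "t = (\<Sum>i<(m::nat). x i \<otimes> y i)" by (rule tensor_expand)
    have "c *\<^sub>C t = (\<Sum>i<m. (c *\<^sub>C x i) \<otimes> y i)"
      by (simp add: t complex_vector.scale_sum_right tensor_scale_left)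
    then show ?thesis
      by (simp add: tensor_lift_sum_UNIV[OF b] t scale complex_vector.scale_sum_right)
  qed
qed (rule tensor_lift_add[OF b])

section \<open>Finite-dimensional linear algebra\<close>

lemma scaleC_complex [simp]: "c *\<^sub>C (x :: complex) = c * x"
  by (simp add: scaleC_complex_def)

text \<open>The coordinate functionals are linear on the whole type, so that arbitrary tensors can
  be sliced by them; only the expansion is tied to \<open>V\<close>.\<close>

definition dual_basis ::
  "nat \<Rightarrow> (nat \<Rightarrow> 'a::complex_vector) \<Rightarrow> (nat \<Rightarrow> 'a \<Rightarrow> complex) \<Rightarrow> 'a set \<Rightarrow> bool"
  where "dual_basis n e \<psi> V \<longleftrightarrow> (\<forall>i<n. e i \<in> V) \<and> (\<forall>k<n. clinear (\<psi> k)) \<and>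
    (\<forall>k<n. \<forall>i<n. \<psi> k (e i) = (if k = i then 1 else 0)) \<and> (\<forall>v\<in>V. (\<Sum>i<n. \<psi> i v *\<^sub>C e i) = v)"

lemma dual_basisD:
  assumes "dual_basis n e \<psi> V"
  shows "i < n \<Longrightarrow> e i \<in> V" "i < n \<Longrightarrow> clinear (\<psi> i)"
    "k < n \<Longrightarrow> i < n \<Longrightarrow> \<psi> k (e i) = (if k = i then 1 else 0)"
    "v \<in> V \<Longrightarrow> (\<Sum>i<n. \<psi> i v *\<^sub>C e i) = v"
  using assms by (auto simp: dual_basis_def)

lemma clinear_sum_scale:
  assumes "\<And>i. i \<in> I \<Longrightarrow> clinear (\<psi> i)"
  shows "clinear (\<lambda>v. \<Sum>i\<in>I. \<psi> i v *\<^sub>C e i)"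
  using assms
  by (intro clinearI) (simp_all add: clinear_add clinear_scale scaleC_add_left sum.distrib
      complex_vector.scale_sum_right scaleC_scaleC)

lemma dual_basis_of_independent:
  assumes "complex_vector.independent C" "finite C"
  shows "\<exists>n e \<psi>. dual_basis n e \<psi> (cspan C) \<and> e ` {..<n} = C \<and> inj_on e {..<n}"
proof -
  obtain e where e: "bij_betw e {0..<card C} C"
    using ex_bij_betw_nat_finite[OF assms(2)] by blast
  define n where "n = card C"
  have C: "C = e ` {..<n}" and inj: "inj_on e {..<n}"
    using e by (auto simp: bij_betw_def n_def atLeast0LessThan)
  have "\<exists>g :: 'a \<Rightarrow> complex. clinear g \<and> (\<forall>x\<in>C. g x = (if x = e k then 1 else 0))" for k
    using complex_vector_pair.linear_independent_extend[OF assms(1), of "\<lambda>x. if x = e k then 1 else 0"]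
    by simp
  then obtain \<psi> :: "nat \<Rightarrow> 'a \<Rightarrow> complex"
    where \<psi>: "\<And>k. clinear (\<psi> k)" "\<And>k x. x \<in> C \<Longrightarrow> \<psi> k x = (if x = e k then 1 else 0)"
    by metis
  have \<psi>e: "\<psi> k (e i) = (if k = i then 1 else 0)" if "k < n" "i < n" for k i
    using that inj by (auto simp: \<psi>(2) C inj_on_def)
  have exp: "(\<Sum>i<n. \<psi> i v *\<^sub>C e i) = v" if "v \<in> cspan C" for v
  proof (rule complex_vector_pair.linear_eq_on_span[OF _ _ _ that])
    show "clinear (\<lambda>v. \<Sum>i<n. \<psi> i v *\<^sub>C e i)" by (rule clinear_sum_scale) (rule \<psi>)
    show "clinear (\<lambda>v. v :: 'a)" by (rule complex_vector.linear_ident)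
    show "(\<Sum>i<n. \<psi> i x *\<^sub>C e i) = x" if x: "x \<in> C" for x
    proof -
      obtain j where j: "j < n" "x = e j" using x C by auto
      then have "(\<Sum>i<n. \<psi> i x *\<^sub>C e i) = (\<Sum>i<n. if i = j then e i else 0)"
        by (intro sum.cong) (auto simp: \<psi>e scaleC_one)
      then show ?thesis using j by simp
    qed
  qed
  have "dual_basis n e \<psi> (cspan C)"
    using exp \<psi>e \<psi>(1) by (auto simp: dual_basis_def C intro: complex_vector.span_base)
  then show ?thesis using C inj by blast
qed

lemma finite_subset_span:
  assumes "csubspace V" "V \<subseteq> cspan B" "finite B"
  shows "\<exists>C. finite C \<and> complex_vector.independent C \<and> C \<subseteq> V \<and> cspan C = V \<and> card C \<le> card B"
proof -
  obtain C where C: "C \<subseteq> V" "complex_vector.independent C" "V \<subseteq> cspan C"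
    using complex_vector.basis_exists[of V] by metis
  then have "finite C \<and> card C \<le> card B"
    using complex_vector.independent_span_bound[OF assms(3) C(2)] assms(2) by blast
  moreover have "cspan C = V"
    using C assms(1) by (simp add: complex_vector.span_minimal subset_antisym)
  ultimately show ?thesis using C by blast
qed

lemma dual_basis_exists:
  assumes "csubspace V" "V \<subseteq> cspan B" "finite B"
  obtains n e \<psi> where "dual_basis n e \<psi> V"
proof -
  obtain C where "finite C" "complex_vector.independent C" "cspan C = V"
    using finite_subset_span[OF assms] by blast
  then show thesis using dual_basis_of_independent[of C] that by blast
qed

lemma finite_dimI: "csubspace V \<Longrightarrow> V \<subseteq> cspan B \<Longrightarrow> finite B \<Longrightarrow> finite_dim V"
  using finite_subset_span[of V B] by (auto simp: finite_dim_def)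

lemma finite_dim_subset: "finite_dim V \<Longrightarrow> csubspace W \<Longrightarrow> W \<subseteq> V \<Longrightarrow> finite_dim W"
  unfolding finite_dim_def using finite_subset_span[of W] by metis

lemma finite_dim_dual_basis:
  assumes "finite_dim V"
  obtains n e \<psi> where "dual_basis n e \<psi> V"
proof -
  obtain B where "csubspace V" "finite B" "V = cspan B" using assms by (auto simp: finite_dim_def)
  then show thesis using dual_basis_exists[of V B] that by blast
qed

lemma finite_dim_subspace: "finite_dim V \<Longrightarrow> csubspace V"
  by (simp add: finite_dim_def)

lemma sum_delta_scaleC:
  fixes f :: "nat \<Rightarrow> 'a::complex_vector"
  assumes "j < n"
  shows "(\<Sum>i<n. (if i = j then 1 else 0) *\<^sub>C f i) = f j" "(\<Sum>i<n. (if j = i then 1 else 0) *\<^sub>C f i) = f j"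
proof -
  have "(\<Sum>i<n. (if i = j then 1 else 0) *\<^sub>C f i) = (\<Sum>i<n. if i = j then f i else 0)"
    by (intro sum.cong) (auto simp: scaleC_one)
  then show "(\<Sum>i<n. (if i = j then 1 else 0) *\<^sub>C f i) = f j" using assms by simp
  then show "(\<Sum>i<n. (if j = i then 1 else 0) *\<^sub>C f i) = f j" by (simp add: eq_commute)
qed

subsection \<open>Slices of tensors\<close>

text \<open>The slice map \<phi> \<otimes> id. Slices on either side serve to compare tensors and to
  locate their legs in subspaces.\<close>

definition slice1 :: "('a::complex_vector \<Rightarrow> complex) \<Rightarrow> ('a, 'b::complex_vector) ctensor \<Rightarrow> 'b"
  where "slice1 \<phi> = tensor_lift UNIV UNIV (\<lambda>x y. \<phi> x *\<^sub>C y)"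

definition slice2 :: "('b::complex_vector \<Rightarrow> complex) \<Rightarrow> ('a::complex_vector, 'b) ctensor \<Rightarrow> 'a"
  where "slice2 \<phi> = tensor_lift UNIV UNIV (\<lambda>x y. \<phi> y *\<^sub>C x)"

lemma balanced_slice1: "clinear \<phi> \<Longrightarrow> balanced_on UNIV UNIV (\<lambda>x y. \<phi> x *\<^sub>C y)"
  by (simp add: balanced_on_def clinear_add clinear_scale scaleC_add_left scaleC_add_right scaleC_scaleC mult.commute)

lemma balanced_slice2: "clinear \<phi> \<Longrightarrow> balanced_on UNIV UNIV (\<lambda>x y. \<phi> y *\<^sub>C x)"
  by (simp add: balanced_on_def clinear_add clinear_scale scaleC_add_left scaleC_add_right scaleC_scaleC mult.commute)

lemma slice1_sum: "clinear \<phi> \<Longrightarrow> slice1 \<phi> (\<Sum>i<(n::nat). x i \<otimes> y i) = (\<Sum>i<n. \<phi> (x i) *\<^sub>C y i)"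
  by (simp add: slice1_def tensor_lift_sum_UNIV balanced_slice1)

lemma slice2_sum: "clinear \<phi> \<Longrightarrow> slice2 \<phi> (\<Sum>i<(n::nat). x i \<otimes> y i) = (\<Sum>i<n. \<phi> (y i) *\<^sub>C x i)"
  by (simp add: slice2_def tensor_lift_sum_UNIV balanced_slice2)

lemma clinear_slice1: "clinear \<phi> \<Longrightarrow> clinear (slice1 \<phi>)"
  unfolding slice1_def
  by (rule tensor_lift_clinear[OF balanced_slice1]) (simp_all add: clinear_scale scaleC_scaleC)

lemma clinear_slice2: "clinear \<phi> \<Longrightarrow> clinear (slice2 \<phi>)"
  unfolding slice2_def
  by (rule tensor_lift_clinear[OF balanced_slice2]) (simp_all add: scaleC_scaleC mult.commute)

lemma slice1_tensor: "clinear \<phi> \<Longrightarrow> slice1 \<phi> (x \<otimes> y) = \<phi> x *\<^sub>C y"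
  by (simp add: slice1_def tensor_lift_tensor balanced_slice1)

lemma slice2_tensor: "clinear \<phi> \<Longrightarrow> slice2 \<phi> (x \<otimes> y) = \<phi> y *\<^sub>C x"
  by (simp add: slice2_def tensor_lift_tensor balanced_slice2)

text \<open>Expanding the right legs in a basis of their span turns the new left legs into slices of
  \<open>t\<close> itself. Whatever is known of all slices then holds for the left legs.\<close>

lemma tensor_expand_dual:
  fixes t :: "('a::complex_vector, 'b::complex_vector) ctensor"
  obtains n x y \<beta> where "t = (\<Sum>i<(n::nat). x i \<otimes> y i)" "\<And>i. i < n \<Longrightarrow> clinear (\<beta> i)"
    "\<And>i. i < n \<Longrightarrow> x i = slice2 (\<beta> i) t"
proof -
  obtain m x y where t: "t = (\<Sum>i<(m::nat). x i \<otimes> y i)" by (rule tensor_expand)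
  obtain n b \<beta> where b: "dual_basis n b \<beta> (cspan (y ` {..<m}))"
    using dual_basis_exists[OF complex_vector.subspace_span order_refl, of "y ` {..<m}"] by auto
  note b = dual_basisD[OF b]
  have "t = (\<Sum>r<m. x r \<otimes> (\<Sum>i<n. \<beta> i (y r) *\<^sub>C b i))"
    unfolding t by (intro sum.cong refl) (simp add: b(4) complex_vector.span_base)
  also have "\<dots> = (\<Sum>i<n. (\<Sum>r<m. \<beta> i (y r) *\<^sub>C x r) \<otimes> b i)"
    by (simp add: tensor_sum_right tensor_sum_left tensor_scale_left tensor_scale_right) (rule sum.swap)
  finally have t': "t = (\<Sum>i<n. (\<Sum>r<m. \<beta> i (y r) *\<^sub>C x r) \<otimes> b i)" .
  show thesis
    by (rule that[OF t', of \<beta>]) (simp_all add: b t slice2_sum)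
qed

text \<open>Membership in V \<otimes> H is tested by slices: if all of them lie in \<open>V\<close>,
  some expansion has its left legs in \<open>V\<close>, and these expand in the basis.\<close>

lemma tensor_left_basis:
  assumes "dual_basis n e \<psi> V" "\<And>\<phi>. clinear \<phi> \<Longrightarrow> slice2 \<phi> t \<in> V"
  shows "t = (\<Sum>i<n. e i \<otimes> slice1 (\<psi> i) t)"
proof (rule tensor_expand_dual[of t])
  fix m x y \<beta>
  assume t: "t = (\<Sum>i<(m::nat). x i \<otimes> y i)" "\<And>i. i < m \<Longrightarrow> clinear (\<beta> i)"
    "\<And>i. i < m \<Longrightarrow> x i = slice2 (\<beta> i) t"
  note e = dual_basisD[OF assms(1)]
  have "t = (\<Sum>r<m. (\<Sum>i<n. \<psi> i (x r) *\<^sub>C e i) \<otimes> y r)"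
    using t(3) by (subst t(1), intro sum.cong refl) (simp add: e(4) t(2) assms(2))
  also have "\<dots> = (\<Sum>i<n. e i \<otimes> (\<Sum>r<m. \<psi> i (x r) *\<^sub>C y r))"
    by (simp add: tensor_sum_right tensor_sum_left tensor_scale_left tensor_scale_right) (rule sum.swap)
  also have "\<dots> = (\<Sum>i<n. e i \<otimes> slice1 (\<psi> i) t)"
    by (subst t(1)) (simp add: slice1_sum e(2))
  finally show ?thesis .
qed

text \<open>Slicing by the i-th coordinate functional isolates the i-th right leg.\<close>

lemma tensor_left_cancel:
  assumes "dual_basis n e \<psi> V" "(\<Sum>i<n. e i \<otimes> x i) = (\<Sum>i<n. e i \<otimes> y i)" "i < n"
  shows "x i = y i"
proof -
  note e = dual_basisD[OF assms(1)]
  have "(\<Sum>j<n. \<psi> i (e j) *\<^sub>C x j) = (\<Sum>j<n. \<psi> i (e j) *\<^sub>C y j)"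
    using arg_cong[OF assms(2), of "slice1 (\<psi> i)"] assms(3) by (simp add: slice1_sum e)
  moreover have "(\<Sum>j<n. \<psi> i (e j) *\<^sub>C z j) = z i" for z :: "nat \<Rightarrow> 'b"
  proof -
    have "(\<Sum>j<n. \<psi> i (e j) *\<^sub>C z j) = (\<Sum>j<n. (if i = j then 1 else 0) *\<^sub>C z j)"
      by (intro sum.cong refl) (simp add: e(3) assms(3))
    also have "\<dots> = z i" by (rule sum_delta_scaleC(2)[OF assms(3)])
    finally show ?thesis .
  qed
  ultimately show ?thesis by simp
qed

lemma functionals_separate:
  fixes x y :: "'a::complex_vector"
  assumes "\<And>\<phi> :: 'a \<Rightarrow> complex. clinear \<phi> \<Longrightarrow> \<phi> x = \<phi> y"
  shows "x = y"
proof -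
  obtain n e \<psi> where d: "dual_basis n e \<psi> (cspan {x - y})"
    using dual_basis_exists[OF complex_vector.subspace_span order_refl, of "{x - y}"] by auto
  note d = dual_basisD[OF d]
  have "x - y = (\<Sum>i<n. \<psi> i (x - y) *\<^sub>C e i)"
    by (rule d(4)[symmetric]) (simp add: complex_vector.span_base)
  also have "\<dots> = 0"
  proof (intro sum.neutral ballI)
    fix i assume "i \<in> {..<n}"
    then have "clinear (\<psi> i)" by (simp add: d(2))
    then show "\<psi> i (x - y) *\<^sub>C e i = 0" using assms[of "\<psi> i"] by (simp add: clinear_diff)
  qed
  finally show ?thesis by simp
qed

subsection \<open>Inner products\<close>

lemma inner_product_onD:
  assumes "inner_product_on V ip" "csubspace V"
  shows "x \<in> V \<Longrightarrow> y \<in> V \<Longrightarrow> z \<in> V \<Longrightarrow> ip x (y + z) = ip x y + ip x z"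
    and "x \<in> V \<Longrightarrow> y \<in> V \<Longrightarrow> ip x (c *\<^sub>C y) = c * ip x y"
    and "x \<in> V \<Longrightarrow> y \<in> V \<Longrightarrow> z \<in> V \<Longrightarrow> ip (x + y) z = ip x z + ip y z"
    and "x \<in> V \<Longrightarrow> y \<in> V \<Longrightarrow> ip (c *\<^sub>C x) y = cnj c * ip x y"
    and "x \<in> V \<Longrightarrow> y \<in> V \<Longrightarrow> cnj (ip x y) = ip y x"
    and "x \<in> V \<Longrightarrow> x \<noteq> 0 \<Longrightarrow> 0 < Re (ip x x)"
    and "x \<in> V \<Longrightarrow> ip x x = complex_of_real (Re (ip x x))"
proof -
  have sym: "ip x y = cnj (ip y x)" if "x \<in> V" "y \<in> V" for x y
    using assms that unfolding inner_product_on_def by blast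
  have add: "ip x (y + z) = ip x y + ip x z" if "x \<in> V" "y \<in> V" "z \<in> V" for x y z
    using assms that unfolding inner_product_on_def clinear_on_def by blast
  have scale: "ip x (c *\<^sub>C y) = c * ip x y" if "x \<in> V" "y \<in> V" for x y c
    using assms that unfolding inner_product_on_def clinear_on_def scaleC_complex by blast
  note cl = complex_vector.subspace_add[OF assms(2)] complex_vector.subspace_scale[OF assms(2)]
  show "x \<in> V \<Longrightarrow> y \<in> V \<Longrightarrow> z \<in> V \<Longrightarrow> ip x (y + z) = ip x y + ip x z"
    "x \<in> V \<Longrightarrow> y \<in> V \<Longrightarrow> ip x (c *\<^sub>C y) = c * ip x y" by (fact add scale)+
  show "ip (x + y) z = ip x z + ip y z" if "x \<in> V" "y \<in> V" "z \<in> V"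
    using that by (simp add: sym[of "x + y" z] sym[of x z] sym[of y z] add cl)
  show "ip (c *\<^sub>C x) y = cnj c * ip x y" if "x \<in> V" "y \<in> V"
    using that by (simp add: sym[of "c *\<^sub>C x" y] sym[of x y] scale cl)
  show "cnj (ip x y) = ip y x" if "x \<in> V" "y \<in> V" using sym[OF that(2,1)] by simp
  show "0 < Re (ip x x)" if "x \<in> V" "x \<noteq> 0" using assms that unfolding inner_product_on_def by blast
  show "ip x x = complex_of_real (Re (ip x x))" if "x \<in> V"
    using sym[OF that that] by (metis Reals_cnj_iff of_real_Re)
qed

lemma inner_product_on_sum_right:
  assumes "inner_product_on V ip" "csubspace V" "x \<in> V" "\<And>i. i \<in> I \<Longrightarrow> f i \<in> V"
  shows "ip x (\<Sum>i\<in>I. c i *\<^sub>C f i) = (\<Sum>i\<in>I. c i * ip x (f i))"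
proof -
  note ip = inner_product_onD[OF assms(1,2)]
  note cl = complex_vector.subspace_sum[OF assms(2)] complex_vector.subspace_scale[OF assms(2)]
    complex_vector.subspace_0[OF assms(2)]
  have "ip x 0 = 0" using ip(2)[of x 0 0] assms(3) cl(3) by simp
  then show ?thesis using assms(4)
    by (induction I rule: infinite_finite_induct) (simp_all add: ip assms(3) cl)
qed

lemma inner_product_on_sum_left:
  assumes "inner_product_on V ip" "csubspace V" "x \<in> V" "\<And>i. i \<in> I \<Longrightarrow> f i \<in> V"
  shows "ip (\<Sum>i\<in>I. c i *\<^sub>C f i) x = (\<Sum>i\<in>I. cnj (c i) * ip (f i) x)"
proof -
  note ip = inner_product_onD[OF assms(1,2)]
  have V: "(\<Sum>i\<in>I. c i *\<^sub>C f i) \<in> V"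
    using assms by (intro complex_vector.subspace_sum complex_vector.subspace_scale) auto
  have "ip (\<Sum>i\<in>I. c i *\<^sub>C f i) x = cnj (ip x (\<Sum>i\<in>I. c i *\<^sub>C f i))"
    using V assms(3) by (simp add: ip)
  then show ?thesis
    using assms by (simp add: inner_product_on_sum_right ip cong: sum.cong)
qed

definition orthonormal_basis ::
  "('v::complex_vector \<Rightarrow> 'v \<Rightarrow> complex) \<Rightarrow> nat \<Rightarrow> (nat \<Rightarrow> 'v) \<Rightarrow> 'v set \<Rightarrow> bool"
  where "orthonormal_basis ip n e W \<longleftrightarrow> (\<forall>i<n. e i \<in> W) \<and>
    (\<forall>i<n. \<forall>j<n. ip (e i) (e j) = (if i = j then 1 else 0)) \<and>
    (\<forall>w\<in>W. (\<Sum>i<n. ip (e i) w *\<^sub>C e i) = w)"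

lemma orthonormal_basisD:
  assumes "orthonormal_basis ip n e W"
  shows "i < n \<Longrightarrow> e i \<in> W" "i < n \<Longrightarrow> j < n \<Longrightarrow> ip (e i) (e j) = (if i = j then 1 else 0)"
    "w \<in> W \<Longrightarrow> (\<Sum>i<n. ip (e i) w *\<^sub>C e i) = w"
  using assms by (auto simp: orthonormal_basis_def)

lemma sum_delta_mult:
  fixes f :: "nat \<Rightarrow> 'a::semiring_1"
  assumes "j < n"
  shows "(\<Sum>i<n. (if i = j then 1 else 0) * f i) = f j" "(\<Sum>i<n. (if j = i then 1 else 0) * f i) = f j"
    "(\<Sum>i<n. f i * (if i = j then 1 else 0)) = f j" "(\<Sum>i<n. f i * (if j = i then 1 else 0)) = f j"
proof -
  have *: "(\<Sum>i<n. (if i = j then 1 else 0) * f i) = (\<Sum>i<n. if i = j then f i else 0)"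
    "(\<Sum>i<n. f i * (if i = j then 1 else 0)) = (\<Sum>i<n. if i = j then f i else 0)"
    by (intro sum.cong; auto)+
  then show "(\<Sum>i<n. (if i = j then 1 else 0) * f i) = f j" "(\<Sum>i<n. f i * (if i = j then 1 else 0)) = f j"
    using assms by simp_all
  then show "(\<Sum>i<n. (if j = i then 1 else 0) * f i) = f j" "(\<Sum>i<n. f i * (if j = i then 1 else 0)) = f j"
    by (simp_all add: eq_commute)
qed

text \<open>A finite orthonormal basis of \<open>W\<close> is enough to project vectors of a
  possibly infinite-dimensional \<open>V\<close>; this is how the lemma is used for \<open>H\<close>
  and its powers.\<close>

lemma orthonormal_basis_orthogonal:
  assumes ip: "inner_product_on V ip" "csubspace V" and "W \<subseteq> V" "orthonormal_basis ip n e W" "x \<in> V" "w \<in> W"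
  shows "ip w (x - (\<Sum>i<n. ip (e i) x *\<^sub>C e i)) = 0"
proof -
  note i = inner_product_onD[OF ip] and e = orthonormal_basisD[OF assms(4)]
  note cl = complex_vector.subspace_sum[OF ip(2)] complex_vector.subspace_scale[OF ip(2)]
    complex_vector.subspace_diff[OF ip(2)]
  have eV: "i < n \<Longrightarrow> e i \<in> V" for i using e(1) assms(3) by blast
  define k where "k = (\<Sum>i<n. ip (e i) x *\<^sub>C e i)"
  have k: "k \<in> V" unfolding k_def by (intro cl) (use eV in auto)
  have ek: "ip (e j) (x - k) = 0" if "j < n" for j
  proof -
    have "ip (e j) k = (\<Sum>i<n. ip (e i) x * ip (e j) (e i))"
      unfolding k_def by (rule inner_product_on_sum_right[OF ip]) (use eV that in auto)
    also have "\<dots> = (\<Sum>i<n. ip (e i) x * (if i = j then 1 else 0))"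
      by (intro sum.cong) (use that in \<open>auto simp: e\<close>)
    also have "\<dots> = ip (e j) x" using that by (rule sum_delta_mult)
    finally have "ip (e j) k = ip (e j) x" .
    moreover have "ip (e j) (x - k) + ip (e j) k = ip (e j) x"
      using i(1)[of "e j" "x - k" k] eV[OF that] k assms(5) cl(3) by simp
    ultimately show ?thesis by simp
  qed
  have "ip w (x - k) = ip (\<Sum>i<n. ip (e i) w *\<^sub>C e i) (x - k)" by (simp add: e(3) assms(6))
  also have "\<dots> = (\<Sum>i<n. cnj (ip (e i) w) * ip (e i) (x - k))"
    by (rule inner_product_on_sum_left[OF ip]) (use eV k assms(5) cl(3) in auto)
  also have "\<dots> = 0" by (simp add: ek)
  finally show ?thesis by (simp add: k_def)
qed

text \<open>Gram-Schmidt on a generating set that may be dependent, whence the case of a vanishing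
  remainder \<open>r\<close>.\<close>

lemma orthonormal_basis_span:
  assumes ip: "inner_product_on V ip" "csubspace V" and "finite B" "B \<subseteq> V"
  shows "\<exists>n e. orthonormal_basis ip n e (cspan B)"
  using assms(3,4)
proof (induction B rule: finite_induct)
  case empty
  show ?case by (rule exI[of _ 0]) (simp add: orthonormal_basis_def)
next
  case (insert b B)
  then obtain n e where ob: "orthonormal_basis ip n e (cspan B)" by auto
  note i = inner_product_onD[OF ip] and e = orthonormal_basisD[OF ob]
  note cl = complex_vector.subspace_sum[OF ip(2)] complex_vector.subspace_scale[OF ip(2)]
    complex_vector.subspace_diff[OF ip(2)]
  have BV: "cspan B \<subseteq> V" using insert.prems ip(2) by (intro complex_vector.span_minimal) auto
  define k where "k = (\<Sum>i<n. ip (e i) b *\<^sub>C e i)"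
  define r where "r = b - k"
  have kB: "k \<in> cspan B" unfolding k_def
    by (intro complex_vector.span_sum complex_vector.span_scale) (auto simp: e)
  have bV: "b \<in> V" using insert.prems by simp
  have rV: "r \<in> V" unfolding r_def using bV kB BV by (intro cl) auto
  have orth: "ip w r = 0" "ip r w = 0" if "w \<in> cspan B" for w
  proof -
    show "ip w r = 0"
      unfolding r_def k_def by (rule orthonormal_basis_orthogonal[OF ip BV ob bV that])
    then show "ip r w = 0" using i(5)[of w r] that BV rV by auto
  qed
  \<comment> \<open>\<open>b\<close> and \<open>r\<close> differ by an element of the old span, so
    the enlarged span can be described with the orthogonal vector \<open>r\<close>.\<close>
  have ins: "cspan (insert b B) = {x. \<exists>c. x - c *\<^sub>C r \<in> cspan B}"
  proof -
    have "x - c *\<^sub>C b \<in> cspan B \<longleftrightarrow> x - c *\<^sub>C r \<in> cspan B" for x c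
    proof -
      have "x - c *\<^sub>C r = x - c *\<^sub>C b + c *\<^sub>C k"
        by (simp add: r_def complex_vector.scale_right_diff_distrib)
      show ?thesis
        unfolding \<open>x - c *\<^sub>C r = x - c *\<^sub>C b + c *\<^sub>C k\<close>
        using complex_vector.span_add_eq2[OF complex_vector.span_scale[OF kB], of "x - c *\<^sub>C b" c] by blast
    qed
    then show ?thesis by (simp add: complex_vector.span_insert)
  qed
  show ?case
  proof (cases "r = 0")
    case True
    then have "cspan (insert b B) = cspan B" using ins by simp
    then show ?thesis using ob by auto
  next
    case False
    define \<rho> where "\<rho> = sqrt (Re (ip r r))"
    have pos: "0 < Re (ip r r)" using i(6) rV False by blast
    then have \<rho>: "0 < \<rho>" "complex_of_real \<rho> * complex_of_real \<rho> = ip r r"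
      using i(7)[OF rV] by (simp_all add: \<rho>_def flip: of_real_mult)
    define f where "f = complex_of_real (1 / \<rho>) *\<^sub>C r"
    define e' where "e' = e(n := f)"
    have fV: "f \<in> V" unfolding f_def by (intro cl rV)
    have ff: "ip f f = 1"
    proof -
      have "ip f f = complex_of_real (1 / \<rho>) * (complex_of_real (1 / \<rho>) * ip r r)"
        unfolding f_def using rV by (simp only: i(2,4) cl complex_cnj_complex_of_real)
      also have "\<dots> = 1" unfolding \<rho>(2)[symmetric] using \<rho>(1) by simp
      finally show ?thesis .
    qed
    have fo: "ip w f = 0" "ip f w = 0" if "w \<in> cspan B" for w
      unfolding f_def using orth[OF that] subsetD[OF BV that] rV by (simp_all only: i(2,4) cl mult_zero_right)
    have e'V: "i < n \<Longrightarrow> e i \<in> V" for i using e(1) BV by blast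
    have "orthonormal_basis ip (Suc n) e' (cspan (insert b B))"
      unfolding orthonormal_basis_def
    proof (intro conjI allI impI ballI)
      fix i assume "i < Suc n"
      moreover have "f \<in> cspan (insert b B)"
        unfolding ins mem_Collect_eq f_def
        by (rule exI[of _ "complex_of_real (1 / \<rho>)"]) (simp add: complex_vector.span_zero)
      ultimately show "e' i \<in> cspan (insert b B)"
        using e(1)[of i] complex_vector.span_mono[of B "insert b B", OF subset_insertI]
        by (cases "i = n") (auto simp: e'_def)
    next
      fix i j assume "i < Suc n" "j < Suc n"
      then consider "i < n" "j < n" | "i = n" "j < n" | "i < n" "j = n" | "i = n" "j = n" by linarith
      then show "ip (e' i) (e' j) = (if i = j then 1 else 0)"
        by cases (simp_all add: e'_def e(1,2) fo ff)
    next
      fix w assume "w \<in> cspan (insert b B)"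
      then obtain c where c: "w - c *\<^sub>C r \<in> cspan B" unfolding ins by auto
      define v where "v = w - c *\<^sub>C r"
      have vB: "v \<in> cspan B" and vV: "v \<in> V" using c BV by (auto simp: v_def)
      have w: "w = v + (c * complex_of_real \<rho>) *\<^sub>C f"
        using \<rho>(1) by (simp add: v_def f_def scaleC_scaleC)
      have "ip f w = c * complex_of_real \<rho>"
        unfolding w using vV fV vB by (simp only: i(1,2) cl fo ff) simp
      moreover have "ip (e i) w = ip (e i) v" if "i < n" for i
        unfolding w using vV fV e'V[OF that] e(1)[OF that] by (simp only: i(1,2) cl fo) simp
      ultimately have "(\<Sum>i<Suc n. ip (e' i) w *\<^sub>C e' i) = (\<Sum>i<n. ip (e i) v *\<^sub>C e i) + (c * complex_of_real \<rho>) *\<^sub>C f"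
        by (simp add: e'_def)
      then show "(\<Sum>i<Suc n. ip (e' i) w *\<^sub>C e' i) = w" using e(3)[OF vB] w by simp
    qed
    then show ?thesis by blast
  qed
qed

lemma orthonormal_basis_exists:
  assumes "inner_product_on V ip" "csubspace V" "finite_dim W" "W \<subseteq> V"
  obtains n e where "orthonormal_basis ip n e W"
proof -
  obtain B where "finite B" "W = cspan B" using assms(3) by (auto simp: finite_dim_def)
  then show thesis
    using orthonormal_basis_span[OF assms(1,2), of B] assms(4) that complex_vector.span_superset by blast
qed

declare scaleC_complex [simp del]

subsection \<open>Eigenvectors\<close>

text \<open>This is the vector p(T) v, computed by Horner's scheme.\<close>

definition poly_orbit :: "('a::complex_vector \<Rightarrow> 'a) \<Rightarrow> 'a \<Rightarrow> complex poly \<Rightarrow> 'a"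
  where "poly_orbit T v p = fold_coeffs (\<lambda>a x. a *\<^sub>C v + T x) p 0"

lemma poly_orbit_pCons:
  assumes "clinear T"
  shows "poly_orbit T v (pCons a p) = a *\<^sub>C v + T (poly_orbit T v p)"
  by (cases "a = 0 \<and> p = 0") (auto simp: poly_orbit_def clinear_zero[OF assms])

lemma poly_orbit_0 [simp]: "poly_orbit T v 0 = 0"
  by (simp add: poly_orbit_def)

lemma poly_orbit_add:
  assumes "clinear T"
  shows "poly_orbit T v (p + q) = poly_orbit T v p + poly_orbit T v q"
  by (induction p q rule: poly_induct2)
    (simp_all only: add_pCons add_0_left add_0_right poly_orbit_0 poly_orbit_pCons[OF assms] clinear_add[OF assms]
      scaleC_add_left ac_simps)

lemma poly_orbit_smult:
  assumes "clinear T"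
  shows "poly_orbit T v (smult c p) = c *\<^sub>C poly_orbit T v p"
  by (induction p)
    (simp_all add: poly_orbit_pCons[OF assms] clinear_scale[OF assms] scaleC_add_right scaleC_scaleC)

lemma poly_orbit_monom:
  assumes "clinear T"
  shows "poly_orbit T v (monom a i) = a *\<^sub>C (T ^^ i) v"
  by (induction i)
    (simp_all add: monom_0 monom_Suc poly_orbit_pCons[OF assms] clinear_zero[OF assms] clinear_scale[OF assms])

lemma poly_orbit_sum:
  assumes "clinear T"
  shows "poly_orbit T v (sum f I) = (\<Sum>i\<in>I. poly_orbit T v (f i))"
  by (induction I rule: infinite_finite_induct) (simp_all add: poly_orbit_add[OF assms])

text \<open>Take \<open>p\<close> of least degree with p(T) v = 0, split off a linear factor X - z,
  and let \<open>q\<close> be the cofactor. By minimality q(T) v is nonzero, and T - z kills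
  it.\<close>

lemma eigenvector_exists:
  assumes T: "clinear T" and fin: "finite_dim V" and TV: "\<And>x. x \<in> V \<Longrightarrow> T x \<in> V"
    and v: "v \<in> V" "v \<noteq> 0"
  obtains z w where "w \<in> V" "w \<noteq> 0" "T w = z *\<^sub>C w"
proof -
  let ?E = "poly_orbit T v"
  obtain B where B: "finite B" "V = cspan B" using fin by (auto simp: finite_dim_def)
  have TiV: "(T ^^ i) v \<in> V" for i by (induction i) (auto simp: v TV)
  \<comment> \<open>A repetition among the first iterates gives a difference of two monomials;
    otherwise there are more iterates than spanning vectors, and they are dependent.\<close>
  have "\<exists>p. p \<noteq> 0 \<and> ?E p = 0"
  proof (cases "inj_on (\<lambda>i. (T ^^ i) v) {..card B}")
    case False
    then obtain i j where "i \<noteq> j" "(T ^^ i) v = (T ^^ j) v" by (auto simp: inj_on_def)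
    then have "monom 1 i + smult (- 1) (monom 1 j) \<noteq> (0 :: complex poly)"
      "?E (monom 1 i + smult (- 1) (monom 1 j)) = 0"
      by (auto simp: poly_orbit_add[OF T] poly_orbit_smult[OF T] poly_orbit_monom[OF T]
          poly_eq_iff scaleC_one simp del: smult_minus_left)
    then show ?thesis by blast
  next
    case True
    define S where "S = (\<lambda>i. (T ^^ i) v) ` {..card B}"
    have card: "card S = Suc (card B)" using True by (simp add: S_def card_image)
    have "complex_vector.dependent S"
    proof (rule ccontr)
      assume "complex_vector.independent S"
      from complex_vector.independent_span_bound[OF B(1) this]
      show False using TiV B(2) card by (auto simp: S_def)
    qed
    then obtain u where u: "\<exists>x\<in>S. u x \<noteq> 0" "(\<Sum>x\<in>S. u x *\<^sub>C x) = 0"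
      using complex_vector.dependent_finite[of S] by (auto simp: S_def)
    define p where "p = (\<Sum>i\<le>card B. monom (u ((T ^^ i) v)) i)"
    have "?E p = (\<Sum>i\<le>card B. u ((T ^^ i) v) *\<^sub>C (T ^^ i) v)"
      by (simp add: p_def poly_orbit_sum[OF T] poly_orbit_monom[OF T])
    also have "\<dots> = 0"
      using u(2) True by (simp add: S_def sum.reindex)
    finally have "?E p = 0" .
    moreover have "p \<noteq> 0"
    proof -
      obtain i where i: "i \<le> card B" "u ((T ^^ i) v) \<noteq> 0" using u(1) by (auto simp: S_def)
      then have "coeff p i \<noteq> 0"
        by (simp add: p_def coeff_sum if_distrib[of "coeff _"] cong: if_cong)
      then show ?thesis by auto
    qed
    ultimately show ?thesis by blast
  qed
  then obtain p where p: "p \<noteq> 0" "?E p = 0" "\<And>q. q \<noteq> 0 \<Longrightarrow> ?E q = 0 \<Longrightarrow> degree p \<le> degree q"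
    using exists_least_iff[of "\<lambda>d. \<exists>p. p \<noteq> 0 \<and> ?E p = 0 \<and> degree p = d"]
    by (metis linorder_not_le)
  have "degree p \<noteq> 0"
  proof
    assume "degree p = 0"
    then obtain a where a: "p = [:a:]" by (metis degree_eq_zeroE)
    then have "a *\<^sub>C v = 0" "a \<noteq> 0"
      using p by (auto simp: poly_orbit_pCons[OF T] clinear_zero[OF T])
    then show False using v by simp
  qed
  then have "\<not> constant (poly p)" by (simp add: constant_degree)
  then obtain z where "poly p z = 0" using fundamental_theorem_of_algebra by blast
  then obtain q where q: "p = [:- z, 1:] * q" by (auto simp: poly_eq_0_iff_dvd dvd_def)
  then have "q \<noteq> 0" using p by auto
  then have "degree q < degree p" unfolding q by (subst degree_mult_eq) simp_all
  then have Eq: "?E q \<noteq> 0" using p(3)[of q] \<open>q \<noteq> 0\<close> by auto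
  have "p = pCons 0 q + smult (- z) q" by (simp add: q)
  then have "T (?E q) + (- z) *\<^sub>C ?E q = 0"
    using p(2) by (simp add: poly_orbit_add[OF T] poly_orbit_smult[OF T] poly_orbit_pCons[OF T] del: smult_minus_left)
  then have "T (?E q) = z *\<^sub>C ?E q" by simp
  moreover have "?E q \<in> V"
  proof (induction q)
    case 0
    then show ?case using complex_vector.subspace_0[OF finite_dim_subspace[OF fin]] by simp
  next
    case (pCons a q)
    then show ?case
      unfolding poly_orbit_pCons[OF T]
      by (intro complex_vector.subspace_add complex_vector.subspace_scale finite_dim_subspace[OF fin] v TV)
  qed
  ultimately show thesis using Eq that by blast
qed

section \<open>Hopf algebras\<close>

lemma tensor_map_sum:
  assumes "balanced_on UNIV UNIV (\<lambda>x y. f x \<otimes> g y)"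
  shows "tensor_map f g (\<Sum>i<(n::nat). x i \<otimes> y i) = (\<Sum>i<n. f (x i) \<otimes> g (y i))"
  unfolding tensor_map_def by (rule tensor_lift_sum_UNIV[OF assms])

lemma balanced_tensor_map: "clinear f \<Longrightarrow> clinear g \<Longrightarrow> balanced_on UNIV UNIV (\<lambda>x y. f x \<otimes> g y)"
  by (intro balanced_onI) (simp_all add: clinear_add clinear_scale tensor_add_left tensor_add_right
      tensor_scale_left tensor_scale_right)

lemma clinear_ident: "clinear (\<lambda>x. x)"
  by (intro clinearI) simp_all

lemma clinear_compose: "clinear f \<Longrightarrow> clinear g \<Longrightarrow> clinear (\<lambda>x. f (g x))"
  by (intro clinearI) (simp_all add: clinear_add clinear_scale)

lemma balanced_assoc_inner:
  "balanced_on UNIV UNIV (\<lambda>x y. x \<otimes> (y \<otimes> z))"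
  by (intro balanced_onI) (simp_all add: tensor_add_left tensor_add_right tensor_scale_left tensor_scale_right)

lemma balanced_assoc:
  "balanced_on UNIV UNIV (\<lambda>t z. tensor_lift UNIV UNIV (\<lambda>x y. x \<otimes> (y \<otimes> z)) t)"
proof (rule balanced_onI)
  fix t t' :: "('a, 'b) ctensor" and z z' :: 'c and c :: complex
  obtain n x y where t: "t = (\<Sum>i<(n::nat). x i \<otimes> y i)" by (rule tensor_expand)
  show "tensor_lift UNIV UNIV (\<lambda>x y. x \<otimes> (y \<otimes> z)) (t + t') =
      tensor_lift UNIV UNIV (\<lambda>x y. x \<otimes> (y \<otimes> z)) t + tensor_lift UNIV UNIV (\<lambda>x y. x \<otimes> (y \<otimes> z)) t'"
    by (rule tensor_lift_add[OF balanced_assoc_inner])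
  show "tensor_lift UNIV UNIV (\<lambda>x y. x \<otimes> (y \<otimes> (z + z'))) t =
      tensor_lift UNIV UNIV (\<lambda>x y. x \<otimes> (y \<otimes> z)) t + tensor_lift UNIV UNIV (\<lambda>x y. x \<otimes> (y \<otimes> z')) t"
    by (simp only: t tensor_lift_sum_UNIV[OF balanced_assoc_inner]) (simp only: tensor_add_right sum.distrib)
  have ct: "c *\<^sub>C t = (\<Sum>i<n. (c *\<^sub>C x i) \<otimes> y i)"
    by (simp add: t complex_vector.scale_sum_right tensor_scale_left)
  show "tensor_lift UNIV UNIV (\<lambda>x y. x \<otimes> (y \<otimes> z)) (c *\<^sub>C t) =
      tensor_lift UNIV UNIV (\<lambda>x y. x \<otimes> (y \<otimes> (c *\<^sub>C z))) t"
    by (simp only: ct, simp only: t tensor_lift_sum_UNIV[OF balanced_assoc_inner])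
      (simp only: tensor_scale_left tensor_scale_right)
qed

lemma tensor_assoc_sum:
  "tensor_assoc (\<Sum>i<(n::nat). t i \<otimes> z i) = (\<Sum>i<n. tensor_assoc (t i \<otimes> z i))"
  unfolding tensor_assoc_def by (simp add: tensor_lift_sum_UNIV[OF balanced_assoc] tensor_lift_tensor[OF balanced_assoc])

lemma tensor_assoc_tensor:
  "tensor_assoc ((\<Sum>i<(n::nat). x i \<otimes> y i) \<otimes> z) = (\<Sum>i<n. x i \<otimes> (y i \<otimes> z))"
  unfolding tensor_assoc_def
  by (simp add: tensor_lift_tensor[OF balanced_assoc] tensor_lift_sum_UNIV[OF balanced_assoc_inner])

lemma mult_sum_scale:
  fixes x :: "'a::complex_algebra_1"
  shows "x * (\<Sum>i\<in>I. c i *\<^sub>C y i) = (\<Sum>i\<in>I. c i *\<^sub>C (x * y i))"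
    "(\<Sum>i\<in>I. c i *\<^sub>C y i) * x = (\<Sum>i\<in>I. c i *\<^sub>C (y i * x))"
  by (simp_all add: sum_distrib_left sum_distrib_right mult_scaleC_left mult_scaleC_right)

lemma balanced_mult_inner:
  fixes x :: "'a::complex_algebra_1" and y :: "'b::complex_algebra_1"
  shows "balanced_on UNIV UNIV (\<lambda>x' y'. (x * x') \<otimes> (y * y'))"
  by (rule balanced_onI) (simp_all add: distrib_left tensor_add_left tensor_add_right mult_scaleC_right
      tensor_scale_left tensor_scale_right)

lemma balanced_mult_outer:
  fixes t :: "('a::complex_algebra_1, 'b::complex_algebra_1) ctensor"
  shows "balanced_on UNIV UNIV (\<lambda>x y. tensor_lift UNIV UNIV (\<lambda>x' y'. (x * x') \<otimes> (y * y')) t)"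
proof -
  obtain n a b where t: "t = (\<Sum>i<(n::nat). a i \<otimes> b i)" by (rule tensor_expand)
  show ?thesis
    unfolding t tensor_lift_sum_UNIV[OF balanced_mult_inner]
    by (rule balanced_onI) (simp_all add: distrib_right tensor_add_left tensor_add_right mult_scaleC_left
      tensor_scale_left tensor_scale_right sum.distrib)
qed

lemma tensor_mult_sum:
  "tensor_mult (\<Sum>i<(m::nat). x i \<otimes> y i) (\<Sum>j<(n::nat). x' j \<otimes> y' j)
    = (\<Sum>i<m. \<Sum>j<n. (x i * x' j) \<otimes> (y i * y' j))"
  unfolding tensor_mult_def tensor_lift_sum_UNIV[OF balanced_mult_outer]
  by (simp add: tensor_lift_sum_UNIV[OF balanced_mult_inner])

text \<open>In Sweedler notation, \<open>act \<phi> x = \<phi>(x\<^sub>2) x\<^sub>1\<close>.\<close>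

definition (in hopf_algebra) act :: "('h \<Rightarrow> complex) \<Rightarrow> 'h \<Rightarrow> 'h"
  where "act \<phi> x = slice2 \<phi> (\<Delta> x)"

text \<open>Encodes \<Delta>(V) \<subseteq> V \<otimes> H by slices. Closure under intersections is
  then immediate, and no tensor product of subspaces is needed.\<close>

definition (in hopf_algebra) subcomodule :: "'h set \<Rightarrow> bool"
  where "subcomodule V \<longleftrightarrow> csubspace V \<and> (\<forall>\<phi>. clinear \<phi> \<longrightarrow> (\<forall>v\<in>V. act \<phi> v \<in> V))"

text \<open>A matrix of coefficients of a comodule. Its invertibility is not part of the definition:
  \<open>S\<close> applied entrywise provides the inverse, see
  \<open>corep_antipode\<close>.\<close>

definition (in hopf_algebra) corep :: "nat \<Rightarrow> (nat \<Rightarrow> nat \<Rightarrow> 'h) \<Rightarrow> bool"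
  where "corep n u \<longleftrightarrow> (\<forall>i<n. \<forall>j<n. \<Delta> (u i j) = (\<Sum>k<n. u i k \<otimes> u k j) \<and> \<epsilon> (u i j) = (if i = j then 1 else 0))"

section \<open>Slices, subcomodules and matrix corepresentations\<close>

context hopf_algebra
begin

lemma act_sum: "clinear \<phi> \<Longrightarrow> \<Delta> x = (\<Sum>i<(n::nat). a i \<otimes> b i) \<Longrightarrow> act \<phi> x = (\<Sum>i<n. \<phi> (b i) *\<^sub>C a i)"
  by (simp add: act_def slice2_sum)

lemma clinear_act: "clinear \<phi> \<Longrightarrow> clinear (act \<phi>)"
  unfolding act_def by (rule clinear_compose[OF clinear_slice2 comult_linear])

lemma act_counit: "act \<epsilon> x = x"
  unfolding act_def slice2_def by (rule counit_right)

lemma slice1_counit: "slice1 \<epsilon> (\<Delta> x) = x"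
  unfolding slice1_def by (rule counit_left)

text \<open>By coassociativity both sides are \<phi>(x_2) \<phi>'(x_3) x_1.\<close>

lemma act_act:
  assumes "clinear \<phi>" "clinear \<phi>'"
  shows "act \<phi> (act \<phi>' x) = act (\<lambda>z. \<phi> (act \<phi>' z)) x"
proof -
  let ?\<chi> = "\<lambda>t. \<phi> (slice2 \<phi>' t)"
  have \<chi>: "clinear ?\<chi>" by (rule clinear_compose[OF assms(1) clinear_slice2[OF assms(2)]])
  obtain n a b where x: "\<Delta> x = (\<Sum>r<(n::nat). a r \<otimes> b r)" by (rule tensor_expand)
  have assoc: "slice2 ?\<chi> (tensor_assoc (t \<otimes> z)) = \<phi>' z *\<^sub>C slice2 \<phi> t" for t :: "('h, 'h) ctensor" and z :: 'h
  proof -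
    obtain m c d where t: "t = (\<Sum>r<(m::nat). c r \<otimes> d r)" by (rule tensor_expand)
    show ?thesis
      by (simp add: t tensor_assoc_tensor slice2_sum[OF \<chi>] slice2_sum[OF assms(1)] slice2_tensor[OF assms(2)]
          clinear_scale[OF assms(1)] scaleC_complex complex_vector.scale_sum_right scaleC_scaleC)
  qed
  have "act \<phi> (act \<phi>' x) = (\<Sum>r<n. \<phi>' (b r) *\<^sub>C slice2 \<phi> (\<Delta> (a r)))"
    unfolding act_sum[OF assms(2) x] clinear_sum[OF clinear_act[OF assms(1)]]
      clinear_scale[OF clinear_act[OF assms(1)]] by (simp add: act_def)
  also have "\<dots> = slice2 ?\<chi> (tensor_assoc (tensor_map \<Delta> (\<lambda>x. x) (\<Delta> x)))"
    by (simp add: x tensor_map_sum balanced_tensor_map comult_linear clinear_ident tensor_assoc_sum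
        clinear_sum[OF clinear_slice2[OF \<chi>]] assoc)
  also have "\<dots> = (\<Sum>r<n. ?\<chi> (\<Delta> (b r)) *\<^sub>C a r)"
    unfolding coassoc
    by (simp add: x tensor_map_sum balanced_tensor_map comult_linear clinear_ident slice2_sum[OF \<chi>])
  also have "\<dots> = act (\<lambda>z. \<phi> (act \<phi>' z)) x"
    by (simp add: act_sum[OF clinear_compose[OF assms(1) clinear_act[OF assms(2)]] x]) (simp add: act_def)
  finally show ?thesis .
qed

lemma subcomoduleD:
  "subcomodule V \<Longrightarrow> csubspace V" "subcomodule V \<Longrightarrow> clinear \<phi> \<Longrightarrow> v \<in> V \<Longrightarrow> act \<phi> v \<in> V"
  by (auto simp: subcomodule_def)

lemma corepD:
  assumes "corep n u" "i < n" "j < n"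
  shows "\<Delta> (u i j) = (\<Sum>k<n. u i k \<otimes> u k j)" "\<epsilon> (u i j) = (if i = j then 1 else 0)"
  using assms by (auto simp: corep_def)

text \<open>The entries are the right legs of \<open>\<Delta> (e j)\<close> in the given basis;
  comparing coefficients in coassociativity and in the counit law at \<open>e j\<close> gives the
  corepresentation equations.\<close>

lemma corep_of_subcomodule:
  assumes V: "subcomodule V" and d: "dual_basis n e \<psi> V"
  obtains u where "corep n u" "\<And>j. j < n \<Longrightarrow> \<Delta> (e j) = (\<Sum>i<n. e i \<otimes> u i j)"
proof -
  note e = dual_basisD[OF d]
  define u where "u i j = slice1 (\<psi> i) (\<Delta> (e j))" for i j
  have \<Delta>e: "\<Delta> (e j) = (\<Sum>i<n. e i \<otimes> u i j)" if "j < n" for j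
    unfolding u_def using subcomoduleD(2)[OF V _ e(1)[OF that]]
    by (intro tensor_left_basis[OF d]) (simp add: act_def)
  have "corep n u"
    unfolding corep_def
  proof (intro allI impI conjI)
    fix i j assume ij: "i < n" "j < n"
    have "(\<Sum>i<n. e i \<otimes> \<Delta> (u i j)) = tensor_map (\<lambda>x. x) \<Delta> (\<Delta> (e j))"
      by (simp add: \<Delta>e[OF ij(2)] tensor_map_sum balanced_tensor_map comult_linear clinear_ident)
    also have "\<dots> = tensor_assoc (tensor_map \<Delta> (\<lambda>x. x) (\<Delta> (e j)))" by (simp add: coassoc)
    also have "\<dots> = (\<Sum>k<n. tensor_assoc (\<Delta> (e k) \<otimes> u k j))"
      by (simp add: \<Delta>e[OF ij(2)] tensor_map_sum balanced_tensor_map comult_linear clinear_ident tensor_assoc_sum)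
    also have "\<dots> = (\<Sum>k<n. \<Sum>i<n. e i \<otimes> (u i k \<otimes> u k j))"
      by (intro sum.cong refl) (simp add: \<Delta>e tensor_assoc_tensor)
    also have "\<dots> = (\<Sum>i<n. e i \<otimes> (\<Sum>k<n. u i k \<otimes> u k j))"
      unfolding tensor_sum_right by (rule sum.swap)
    finally show "\<Delta> (u i j) = (\<Sum>k<n. u i k \<otimes> u k j)"
      by (rule tensor_left_cancel[OF d _ ij(1)])
    have "\<psi> i (act \<epsilon> (e j)) = (\<Sum>k<n. \<epsilon> (u k j) * (if i = k then 1 else 0))"
      unfolding act_sum[OF counit_linear \<Delta>e[OF ij(2)]] clinear_sum[OF e(2)[OF ij(1)]]
      by (intro sum.cong refl) (simp add: clinear_scale[OF e(2)[OF ij(1)]] scaleC_complex e(3) ij)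
    also have "\<dots> = \<epsilon> (u i j)" by (rule sum_delta_mult[OF ij(1)])
    finally show "\<epsilon> (u i j) = (if i = j then 1 else 0)" by (simp add: act_counit e(3) ij)
  qed
  then show thesis using that \<Delta>e by blast
qed

lemma subcomodule_span_orbit: "subcomodule (cspan (\<Union>x\<in>F. {act \<phi> x | \<phi>. clinear \<phi>}))"
  (is "subcomodule (cspan ?X)")
  unfolding subcomodule_def
proof (intro conjI allI impI ballI complex_vector.subspace_span)
  fix \<phi> :: "'h \<Rightarrow> complex" and v assume \<phi>: "clinear \<phi>" and "v \<in> cspan ?X"
  from this(2) show "act \<phi> v \<in> cspan ?X"
  proof (induction rule: complex_vector.span_induct_alt)
    case base
    then show ?case by (simp add: clinear_zero[OF clinear_act[OF \<phi>]] complex_vector.span_zero)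
  next
    case (step c x y)
    then obtain z \<phi>' where z: "z \<in> F" "clinear \<phi>'" "x = act \<phi>' z" by blast
    have "act \<phi> x = act (\<lambda>z. \<phi> (act \<phi>' z)) z" by (simp add: z act_act \<phi>)
    moreover have "clinear (\<lambda>z. \<phi> (act \<phi>' z))" by (rule clinear_compose[OF \<phi> clinear_act[OF z(2)]])
    ultimately have "act \<phi> x \<in> ?X" using z(1) by blast
    then show ?case
      unfolding clinear_add[OF clinear_act[OF \<phi>]] clinear_scale[OF clinear_act[OF \<phi>]]
      by (intro complex_vector.span_add complex_vector.span_scale complex_vector.span_base step.IH)
  qed
qed

text \<open>Local finiteness of comodules: all slices of \<open>\<Delta> x\<close> lie in the span
  of the finitely many left legs of one expansion, and \<open>x\<close> is itself the slice by
  \<open>\<epsilon>\<close>. By \<open>act_act\<close> the span of all slices is stable.\<close>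

lemma finite_dim_subcomodule:
  assumes "finite F"
  obtains V where "subcomodule V" "finite_dim V" "F \<subseteq> V"
proof -
  let ?X = "\<Union>x\<in>F. {act \<phi> x | \<phi>. clinear \<phi>}"
  have "\<exists>B. finite B \<and> {act \<phi> x | \<phi>. clinear \<phi>} \<subseteq> cspan B" for x
  proof -
    obtain n a b where x: "\<Delta> x = (\<Sum>r<(n::nat). a r \<otimes> b r)" by (rule tensor_expand)
    have "act \<phi> x \<in> cspan (a ` {..<n})" if "clinear \<phi>" for \<phi>
      unfolding act_sum[OF that x]
      by (intro complex_vector.span_sum complex_vector.span_scale complex_vector.span_base) auto
    then show ?thesis by (intro exI[of _ "a ` {..<n}"] conjI finite_imageI finite_lessThan subsetI) blast
  qed
  then have "\<exists>B. \<forall>x. finite (B x) \<and> {act \<phi> x | \<phi>. clinear \<phi>} \<subseteq> cspan (B x)" by (intro choice allI)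
  then obtain B where B: "\<And>x. finite (B x)" "\<And>x. {act \<phi> x | \<phi>. clinear \<phi>} \<subseteq> cspan (B x)" by blast
  have "cspan ?X \<subseteq> cspan (\<Union>x\<in>F. B x)"
  proof (rule complex_vector.span_minimal)
    show "?X \<subseteq> cspan (\<Union>x\<in>F. B x)"
    proof (rule UN_least)
      fix x assume "x \<in> F"
      then have "cspan (B x) \<subseteq> cspan (\<Union>x\<in>F. B x)" by (intro complex_vector.span_mono) auto
      then show "{act \<phi> x | \<phi>. clinear \<phi>} \<subseteq> cspan (\<Union>x\<in>F. B x)" using B(2)[of x] by (rule order_trans[rotated])
    qed
  qed simp
  then have "finite_dim (cspan ?X)"
    by (rule finite_dimI[OF complex_vector.subspace_span]) (simp add: assms B(1))
  moreover have "F \<subseteq> cspan ?X"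
  proof
    fix x assume "x \<in> F"
    moreover have "x = act \<epsilon> x" by (simp add: act_counit)
    ultimately have "x \<in> ?X" using counit_linear by blast
    then show "x \<in> cspan ?X" by (rule complex_vector.span_base)
  qed
  ultimately show thesis using subcomodule_span_orbit that by blast
qed

lemma balanced_antipode:
  "balanced_on UNIV UNIV (\<lambda>x y. S x * y)" "balanced_on UNIV UNIV (\<lambda>x y. x * S y)"
  using antipode_linear
  by (intro balanced_onI; simp add: clinear_add clinear_scale distrib_left distrib_right mult_scaleC_left mult_scaleC_right)+

lemma corep_antipode:
  assumes "corep n u" "i < n" "j < n"
  shows "(\<Sum>k<n. S (u i k) * u k j) = (if i = j then 1 else 0)"
    "(\<Sum>k<n. u i k * S (u k j)) = (if i = j then 1 else 0)"
  using antipode_left[of "u i j"] antipode_right[of "u i j"]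
  by (auto simp: corepD[OF assms] tensor_lift_sum_UNIV balanced_antipode scaleC_one)

lemma comult_mult_sum:
  assumes "\<Delta> x = (\<Sum>i<(m::nat). a i \<otimes> b i)" "\<Delta> y = (\<Sum>j<(n::nat). c j \<otimes> d j)"
  shows "\<Delta> (x * y) = (\<Sum>i<m. \<Sum>j<n. (a i * c j) \<otimes> (b i * d j))"
  unfolding comult_mult assms tensor_mult_sum ..

text \<open>The left counit law. It places a comodule inside the span of its own matrix
  coefficients.\<close>

lemma corep_expand:
  assumes "dual_basis n e \<psi> V" "\<And>j. j < n \<Longrightarrow> \<Delta> (e j) = (\<Sum>i<n. e i \<otimes> u i j)" "j < n"
  shows "e j = (\<Sum>i<n. \<epsilon> (e i) *\<^sub>C u i j)"
  using slice1_counit[of "e j"] assms by (simp add: slice1_sum counit_linear)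

lemma act_one: "clinear \<phi> \<Longrightarrow> act \<phi> 1 = \<phi> 1 *\<^sub>C 1"
  by (simp add: act_def comult_one slice2_tensor)

end

section \<open>The coaction and the involution\<close>

context hopf_star_algebra
begin

lemma star_zero [simp]: "star 0 = 0"
  using star_add[of 0 0] by simp

lemma star_sum: "star (sum f I) = (\<Sum>i\<in>I. star (f i))"
  by (induction I rule: infinite_finite_induct) (simp_all add: star_add)

lemma star_one [simp]: "star 1 = 1"
  using star_mult[of "star 1" 1] by (simp add: star_star)

lemma comult_star_sum:
  assumes "\<Delta> x = (\<Sum>i<(n::nat). a i \<otimes> b i)"
  shows "\<Delta> (star x) = (\<Sum>i<n. star (a i) \<otimes> star (b i))"
proof -
  have "balanced_on UNIV UNIV (\<lambda>x y. star x \<otimes> star y)"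
    by (rule balanced_onI) (simp_all add: star_add star_scaleC tensor_add_left tensor_add_right
        tensor_scale_left tensor_scale_right)
  then show ?thesis unfolding comult_star assms by (rule tensor_map_sum)
qed

lemma corep_star: "corep n u \<Longrightarrow> corep n (\<lambda>i j. star (u i j))"
  unfolding corep_def by (auto simp: counit_star intro: comult_star_sum)

lemma clinear_star_conj: "clinear \<phi> \<Longrightarrow> clinear (\<lambda>z. cnj (\<phi> (star z)))"
  by (intro clinearI) (simp_all add: star_add star_scaleC clinear_add clinear_scale scaleC_complex)

text \<open>Since \<open>\<Delta>\<close> commutes with \<open>star\<close>, a slice of
  \<open>star x\<close> is \<open>star\<close> of a slice of \<open>x\<close> by the conjugated
  functional; hence \<open>star\<close> preserves subcomodules.\<close>

lemma act_star:
  assumes "clinear \<phi>"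
  shows "act \<phi> (star x) = star (act (\<lambda>z. cnj (\<phi> (star z))) x)"
proof -
  obtain n a b where x: "\<Delta> x = (\<Sum>r<(n::nat). a r \<otimes> b r)" by (rule tensor_expand)
  show ?thesis
    by (simp add: act_sum[OF assms comult_star_sum[OF x]] act_sum[OF clinear_star_conj[OF assms] x]
        star_sum star_scaleC)
qed

lemma subcomodule_star: "subcomodule V \<Longrightarrow> subcomodule (star ` V)"
  unfolding subcomodule_def
proof (intro conjI allI impI ballI)
  assume V: "csubspace V \<and> (\<forall>\<phi>. clinear \<phi> \<longrightarrow> (\<forall>v\<in>V. act \<phi> v \<in> V))"
  show "csubspace (star ` V)"
    unfolding complex_vector.subspace_def
  proof (intro conjI allI ballI)
    show "0 \<in> star ` V" using V complex_vector.subspace_0[of V] by (metis image_eqI star_zero)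
    show "x + y \<in> star ` V" if "x \<in> star ` V" "y \<in> star ` V" for x y
      using that V complex_vector.subspace_add[of V] by (auto simp flip: star_add)
    show "c *\<^sub>C x \<in> star ` V" if x: "x \<in> star ` V" for c x
    proof -
      obtain y where y: "y \<in> V" "x = star y" using x by auto
      then have "c *\<^sub>C x = star (cnj c *\<^sub>C y)" by (simp add: star_scaleC)
      then show ?thesis using V y complex_vector.subspace_scale[of V] by blast
    qed
  qed
  fix \<phi> :: "'h \<Rightarrow> complex" and v assume "clinear \<phi>" "v \<in> star ` V"
  then show "act \<phi> v \<in> star ` V" using V by (auto simp: act_star clinear_star_conj)
qed

end

section \<open>Unitary corepresentations\<close>

definition unit_vec :: "nat \<Rightarrow> nat \<Rightarrow> complex"
  where "unit_vec i = (\<lambda>j. if j = i then 1 else 0)"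

text \<open>A copy of C^n inside \<open>nat \<Rightarrow> complex\<close>, the type on which
  \<open>cqg_algebra\<close> supplies inner products.\<close>

definition coord_space :: "nat \<Rightarrow> (nat \<Rightarrow> complex) set"
  where "coord_space n = {f. \<forall>i\<ge>n. f i = 0}"

lemma subspace_coord_space: "csubspace (coord_space n)"
  by (simp add: complex_vector.subspace_def coord_space_def scaleC_fun_def scaleC_complex)

lemma unit_vec_in_coord_space: "i < n \<Longrightarrow> unit_vec i \<in> coord_space n"
  by (simp add: unit_vec_def coord_space_def)

lemma sum_scaleC_fun_apply: "(\<Sum>i\<in>I. c i *\<^sub>C f i) x = (\<Sum>i\<in>I. c i *\<^sub>C f i x)"
  by (induction I rule: infinite_finite_induct) (simp_all add: scaleC_fun_def)

lemma coord_space_expand: "f \<in> coord_space n \<Longrightarrow> (\<Sum>i<n. f i *\<^sub>C unit_vec i) = f"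
proof
  fix j assume f: "f \<in> coord_space n"
  have "(\<Sum>i<n. f i *\<^sub>C unit_vec i) j = (\<Sum>i<n. f i * (if j = i then 1 else 0))"
    by (simp add: sum_scaleC_fun_apply unit_vec_def scaleC_complex)
  also have "\<dots> = f j"
  proof (cases "j < n")
    case True
    then show ?thesis by (rule sum_delta_mult)
  next
    case False
    then show ?thesis using f by (auto simp: coord_space_def intro!: sum.neutral)
  qed
  finally show "(\<Sum>i<n. f i *\<^sub>C unit_vec i) j = f j" .
qed

lemma finite_dim_coord_space: "finite_dim (coord_space n)"
proof (rule finite_dimI[OF subspace_coord_space])
  show "coord_space n \<subseteq> cspan (unit_vec ` {..<n})"
  proof
    fix f assume "f \<in> coord_space n"
    then have "f = (\<Sum>i<n. f i *\<^sub>C unit_vec i)" by (simp add: coord_space_expand)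
    also have "\<dots> \<in> cspan (unit_vec ` {..<n})"
      by (intro complex_vector.span_sum complex_vector.span_scale complex_vector.span_base) auto
    finally show "f \<in> cspan (unit_vec ` {..<n})" .
  qed
qed simp

text \<open>Leads from \<open>tensor_subspace\<close>, in which comodules and coideals are defined,
  to the slice criterion used by \<open>subcomodule\<close>.\<close>

lemma slice2_tensor_subspace:
  assumes "csubspace V" "t \<in> tensor_subspace V UNIV" "clinear \<phi>"
  shows "slice2 \<phi> t \<in> V"
  using assms(2) unfolding tensor_subspace_def
proof (induction rule: complex_vector.span_induct_alt)
  case base
  then show ?case by (simp add: clinear_zero clinear_slice2 assms complex_vector.subspace_0)
next
  case (step c x y)
  then show ?case
    by (auto simp: clinear_add clinear_scale clinear_slice2 slice2_tensor assms complex_vector.subspace_add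
        complex_vector.subspace_scale)
qed

lemma tensor_sum_in_subspace:
  assumes "\<And>i. i < n \<Longrightarrow> x i \<in> V"
  shows "(\<Sum>i<(n::nat). x i \<otimes> y i) \<in> tensor_subspace V UNIV"
  unfolding tensor_subspace_def
  by (intro complex_vector.span_sum complex_vector.span_base) (use assms in auto)

lemma subspace_dual_space: "csubspace (dual_space V)"
  by (auto simp: complex_vector.subspace_def dual_space_def clinear_on_def scaleC_fun_def scaleC_add_right scaleC_scaleC
      mult.commute scaleC_complex algebra_simps)

lemma clinear_eval: "clinear (\<lambda>g. g x)"
  by (intro clinearI) (simp_all add: scaleC_fun_def)

lemma dual_basis_dual_space:
  "dual_basis n (\<lambda>i y. if y \<in> coord_space n then y i else 0) (\<lambda>i g. g (unit_vec i)) (dual_space (coord_space n))"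
  unfolding dual_basis_def
proof (intro conjI allI impI ballI clinear_eval)
  fix i assume "i < n"
  show "(\<lambda>y. if y \<in> coord_space n then y i else 0) \<in> dual_space (coord_space n)"
    using subspace_coord_space[of n]
    by (auto simp: dual_space_def clinear_on_def complex_vector.subspace_def scaleC_fun_def)
next
  fix k i assume "k < n" "i < n"
  then show "(if unit_vec k \<in> coord_space n then unit_vec k i else 0) = (if k = i then 1 else 0)"
    by (simp add: unit_vec_in_coord_space) (simp add: unit_vec_def)
next
  fix g assume g: "g \<in> dual_space (coord_space n)"
  show "(\<Sum>i<n. g (unit_vec i) *\<^sub>C (\<lambda>y. if y \<in> coord_space n then y i else 0)) = g"
  proof
    fix y
    show "(\<Sum>i<n. g (unit_vec i) *\<^sub>C (\<lambda>y. if y \<in> coord_space n then y i else 0)) y = g y"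
    proof (cases "y \<in> coord_space n")
      case True
      have g_add: "g (x + z) = g x + g z" if "x \<in> coord_space n" "z \<in> coord_space n" for x z
        using g that by (auto simp: dual_space_def clinear_on_def)
      have g_scale: "g (c *\<^sub>C x) = c *\<^sub>C g x" if "x \<in> coord_space n" for x c
        using g that by (auto simp: dual_space_def clinear_on_def)
      have cl: "(\<Sum>i<m. y i *\<^sub>C unit_vec i) \<in> coord_space n" "y m *\<^sub>C unit_vec m \<in> coord_space n" if "m < n" for m
        using that by (auto intro!: complex_vector.subspace_sum complex_vector.subspace_scale
            subspace_coord_space unit_vec_in_coord_space)
      have g0: "g 0 = 0"
        using g_scale[OF complex_vector.subspace_0, OF subspace_coord_space, of 0]
        by (simp add: scaleC_complex)
      have "m \<le> n \<Longrightarrow> g (\<Sum>i<m. y i *\<^sub>C unit_vec i) = (\<Sum>i<m. y i *\<^sub>C g (unit_vec i))" for m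
        by (induction m) (simp_all add: g0 g_add cl g_scale[OF unit_vec_in_coord_space])
      from this[of n] show ?thesis
        using True by (simp add: coord_space_expand sum_scaleC_fun_apply scaleC_complex mult.commute)
    next
      case False
      then show ?thesis using g by (simp add: sum_scaleC_fun_apply scaleC_complex dual_space_def)
    qed
  qed
qed

lemma conj_space_simps:
  "from_conj (to_conj x) = x" "to_conj (x + y) = to_conj x + to_conj y"
  "c *\<^sub>C to_conj x = to_conj (cnj c *\<^sub>C x)"
  by (simp_all add: to_conj_inverse plus_conj_space_def scaleC_conj_space_def)

context cqg_algebra
begin

text \<open>The matrix \<open>u\<close> makes C^n a comodule. The identity is the compatibility
  condition at the conjugate of \<open>x\<close>, with the functionals on the left legs evaluated at
  \<open>y\<close>.\<close>

lemma corep_invariant_inner_product: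
  assumes u: "corep n u"
  obtains ip where "inner_product_on (coord_space n) ip"
    "\<And>x y. x \<in> coord_space n \<Longrightarrow> y \<in> coord_space n \<Longrightarrow>
      (\<Sum>i<n. ip (unit_vec i) y *\<^sub>C star (\<Sum>j<n. x j *\<^sub>C u i j)) =
      (\<Sum>k<n. ip x (unit_vec k) *\<^sub>C S (\<Sum>i<n. y i *\<^sub>C u k i))"
proof -
  let ?V = "coord_space n"
  define w where "w f i = (\<Sum>j<n. f j *\<^sub>C u i j)" for f i
  define \<rho> where "\<rho> f = (\<Sum>i<n. unit_vec i \<otimes> w f i)" for f
  note [simp] = subspace_coord_space unit_vec_in_coord_space
  have w_add: "w (f + g) i = w f i + w g i" and w_scale: "w (c *\<^sub>C f) i = c *\<^sub>C w f i" for f g i c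
    by (simp_all add: w_def scaleC_fun_def scaleC_add_left sum.distrib complex_vector.scale_sum_right
        scaleC_scaleC scaleC_complex)
  have \<rho>_add: "\<rho> (f + g) = \<rho> f + \<rho> g" and \<rho>_scale: "\<rho> (c *\<^sub>C f) = c *\<^sub>C \<rho> f" for f g c
    by (simp_all add: \<rho>_def w_add w_scale tensor_add_right tensor_scale_right sum.distrib complex_vector.scale_sum_right)
  have w_unit: "w (unit_vec j) i = u i j" if "j < n" for i j
    using sum_delta_scaleC(1)[OF that, of "u i"] by (simp add: w_def unit_vec_def)
  have lift: "tensor_lift ?V UNIV b (\<rho> f) = (\<Sum>i<n. b (unit_vec i) (w f i))"
    if "balanced_on ?V UNIV b" for b :: "(nat \<Rightarrow> complex) \<Rightarrow> 'h \<Rightarrow> 'z::ab_group_add" and f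
    unfolding \<rho>_def by (rule tensor_lift_sum) (use that in auto)
  have \<Delta>w: "\<Delta> (w f k) = (\<Sum>i<n. u k i \<otimes> w f i)" if "k < n" for f k
  proof -
    have "\<Delta> (w f k) = (\<Sum>j<n. f j *\<^sub>C (\<Sum>i<n. u k i \<otimes> u i j))"
      by (simp add: w_def clinear_sum[OF comult_linear] clinear_scale[OF comult_linear] corepD[OF u that])
    also have "\<dots> = (\<Sum>i<n. u k i \<otimes> w f i)"
      by (simp add: w_def tensor_sum_right tensor_scale_right complex_vector.scale_sum_right) (rule sum.swap)
    finally show ?thesis .
  qed
  have \<epsilon>w: "\<epsilon> (w f k) = f k" if "k < n" for f k
  proof -
    have "\<epsilon> (w f k) = (\<Sum>j<n. f j * (if k = j then 1 else 0))"
      unfolding w_def clinear_sum[OF counit_linear]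
      by (intro sum.cong refl) (simp add: clinear_scale[OF counit_linear] scaleC_complex corepD[OF u that])
    also have "\<dots> = f k" by (rule sum_delta_mult[OF that])
    finally show ?thesis .
  qed
  have "fd_right_comodule \<Delta> \<epsilon> ?V \<rho>"
    unfolding fd_right_comodule_def
  proof (intro conjI ballI)
    show "finite_dim ?V" by (rule finite_dim_coord_space)
    show "clinear_on ?V \<rho>" by (simp add: clinear_on_def \<rho>_add \<rho>_scale)
    show "\<rho> ` ?V \<subseteq> tensor_subspace ?V UNIV" by (auto simp: \<rho>_def intro!: tensor_sum_in_subspace)
    fix v assume v: "v \<in> ?V"
    have b1: "balanced_on ?V UNIV (\<lambda>x (h::'h). \<rho> x \<otimes> h)"
      by (intro balanced_onI) (simp_all add: \<rho>_add \<rho>_scale tensor_add_left tensor_add_right tensor_scale_left tensor_scale_right)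
    have b2: "balanced_on ?V UNIV (\<lambda>x h. x \<otimes> \<Delta> h)"
      by (intro balanced_onI) (simp_all add: clinear_add[OF comult_linear] clinear_scale[OF comult_linear]
          tensor_add_left tensor_add_right tensor_scale_left tensor_scale_right)
    have b3: "balanced_on ?V UNIV (\<lambda>x h. \<epsilon> h *\<^sub>C x)"
      by (intro balanced_onI) (simp_all add: clinear_add[OF counit_linear] clinear_scale[OF counit_linear]
          scaleC_add_left scaleC_add_right scaleC_scaleC scaleC_complex mult.commute)
    have "tensor_assoc (tensor_lift ?V UNIV (\<lambda>x h. \<rho> x \<otimes> h) (\<rho> v)) =
        (\<Sum>i<n. tensor_assoc ((\<Sum>k<n. unit_vec k \<otimes> u k i) \<otimes> w v i))"
      unfolding lift[OF b1] tensor_assoc_sum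
      by (intro sum.cong refl arg_cong[where f = tensor_assoc] arg_cong2[where f = tensor]) (simp add: \<rho>_def w_unit)
    also have "\<dots> = (\<Sum>k<n. unit_vec k \<otimes> (\<Sum>i<n. u k i \<otimes> w v i))"
      unfolding tensor_assoc_tensor tensor_sum_right by (rule sum.swap)
    also have "\<dots> = tensor_lift ?V UNIV (\<lambda>x h. x \<otimes> \<Delta> h) (\<rho> v)"
      unfolding lift[OF b2] by (simp add: \<Delta>w)
    finally show "tensor_assoc (tensor_lift ?V UNIV (\<lambda>x h. \<rho> x \<otimes> h) (\<rho> v)) =
        tensor_lift ?V UNIV (\<lambda>x h. x \<otimes> \<Delta> h) (\<rho> v)" .
    show "tensor_lift ?V UNIV (\<lambda>x h. \<epsilon> h *\<^sub>C x) (\<rho> v) = v"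
      unfolding lift[OF b3] by (simp add: \<epsilon>w coord_space_expand v)
  qed
  then obtain ip where "compatible_inner_product S star ?V \<rho> ip"
    using ex_compatible_inner_product by blast
  then have ip: "inner_product_on ?V ip" and
    hom: "comodule_hom (to_conj ` ?V) (conj_coaction star ?V \<rho>) (dual_space ?V) (dual_coaction S ?V \<rho>)
      (inner_product_map ?V ip)"
    by (simp_all add: compatible_inner_product_def)
  let ?J = "inner_product_map ?V ip" and ?d = "\<lambda>i y. if y \<in> ?V then y i else (0::complex)"
  note ipD = inner_product_onD[OF ip subspace_coord_space]
  have J: "?J (to_conj x) \<in> dual_space ?V" if "x \<in> ?V" for x
    using hom that by (auto simp: comodule_hom_def)
  have main: "(\<Sum>i<n. ip (unit_vec i) y *\<^sub>C star (w x i)) = (\<Sum>k<n. ip x (unit_vec k) *\<^sub>C S (w y k))"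
    if x: "x \<in> ?V" and y: "y \<in> ?V" for x y
  proof -
    let ?f = "?J (to_conj x)"
    \<comment> \<open>The value of the dual coaction at \<open>?f\<close>: the coefficient of
      \<open>?d i\<close> is forced by the defining equation at the i-th unit vector. Existence and
      uniqueness together resolve the definite description.\<close>
    define t where "t = (\<Sum>i<n. ?d i \<otimes> (\<Sum>k<n. ?f (unit_vec k) *\<^sub>C S (u k i)))"
    have f_add: "?f (a + b) = ?f a + ?f b" and f_scale: "?f (c *\<^sub>C a) = c * ?f a" if "a \<in> ?V" "b \<in> ?V" for a b c
      using J[OF x] that by (auto simp: dual_space_def clinear_on_def scaleC_complex)
    have b4: "balanced_on ?V UNIV (\<lambda>x h. ?f x *\<^sub>C S h)"
      by (intro balanced_onI) (simp_all add: f_add f_scale clinear_add[OF antipode_linear]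
          clinear_scale[OF antipode_linear] scaleC_add_left scaleC_add_right scaleC_scaleC mult.commute)
    have b5: "balanced_on (dual_space ?V) UNIV (\<lambda>g (h::'h). g m *\<^sub>C h)" for m
      by (intro balanced_onI) (simp_all add: scaleC_fun_def scaleC_add_left scaleC_add_right scaleC_scaleC scaleC_complex mult.commute)
    have lift_d: "tensor_lift (dual_space ?V) UNIV (\<lambda>g h. g m *\<^sub>C h) (\<Sum>i<n. ?d i \<otimes> h i) = (\<Sum>i<n. m i *\<^sub>C h i)"
      if "m \<in> ?V" for m and h :: "nat \<Rightarrow> 'h"
      using that dual_basisD(1)[OF dual_basis_dual_space]
      by (subst tensor_lift_sum[OF subspace_dual_space complex_vector.subspace_UNIV b5]) auto
    have rhs: "tensor_lift ?V UNIV (\<lambda>x h. ?f x *\<^sub>C S h) (\<rho> m) = (\<Sum>i<n. m i *\<^sub>C (\<Sum>k<n. ?f (unit_vec k) *\<^sub>C S (u k i)))"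
      for m
    proof -
      have "tensor_lift ?V UNIV (\<lambda>x h. ?f x *\<^sub>C S h) (\<rho> m) = (\<Sum>k<n. ?f (unit_vec k) *\<^sub>C (\<Sum>i<n. m i *\<^sub>C S (u k i)))"
        unfolding lift[OF b4] w_def by (simp add: clinear_sum[OF antipode_linear] clinear_scale[OF antipode_linear])
      also have "\<dots> = (\<Sum>i<n. m i *\<^sub>C (\<Sum>k<n. ?f (unit_vec k) *\<^sub>C S (u k i)))"
        by (simp add: complex_vector.scale_sum_right scaleC_scaleC mult.commute) (rule sum.swap)
      finally show ?thesis .
    qed
    have "dual_coaction S ?V \<rho> ?f = t"
      unfolding dual_coaction_def
    proof (rule the_equality)
      show "t \<in> tensor_subspace (dual_space ?V) UNIV \<and>
          (\<forall>m\<in>?V. tensor_lift (dual_space ?V) UNIV (\<lambda>g h. g m *\<^sub>C h) t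
             = tensor_lift ?V UNIV (\<lambda>x h. ?f x *\<^sub>C S h) (\<rho> m))"
        unfolding t_def using dual_basisD(1)[OF dual_basis_dual_space]
        by (auto simp only: rhs lift_d intro!: tensor_sum_in_subspace)
    next
      fix s assume s: "s \<in> tensor_subspace (dual_space ?V) UNIV \<and>
          (\<forall>m\<in>?V. tensor_lift (dual_space ?V) UNIV (\<lambda>g h. g m *\<^sub>C h) s
             = tensor_lift ?V UNIV (\<lambda>x h. ?f x *\<^sub>C S h) (\<rho> m))"
      define h where "h i = slice1 (\<lambda>g. g (unit_vec i)) s" for i
      have s_eq: "s = (\<Sum>i<n. ?d i \<otimes> h i)"
        unfolding h_def
        by (rule tensor_left_basis[OF dual_basis_dual_space]) (use s slice2_tensor_subspace[OF subspace_dual_space] in auto)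
      have "h i = (\<Sum>k<n. ?f (unit_vec k) *\<^sub>C S (u k i))" if i: "i < n" for i
      proof -
        have "(\<Sum>j<n. unit_vec i j *\<^sub>C h j) = (\<Sum>j<n. unit_vec i j *\<^sub>C (\<Sum>k<n. ?f (unit_vec k) *\<^sub>C S (u k j)))"
          using s i unfolding s_eq rhs[symmetric] by (subst lift_d[symmetric]) auto
        then show ?thesis using i by (simp add: unit_vec_def sum_delta_scaleC)
      qed
      then show "s = t" unfolding s_eq t_def by (intro sum.cong refl) simp
    qed
    moreover have "dual_coaction S ?V \<rho> ?f = tensor_lift (to_conj ` ?V) UNIV (\<lambda>x h. ?J x \<otimes> h) (conj_coaction star ?V \<rho> (to_conj x))"
      using hom x by (auto simp: comodule_hom_def)
    moreover have "conj_coaction star ?V \<rho> (to_conj x) = (\<Sum>i<n. to_conj (unit_vec i) \<otimes> star (w x i))"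
      unfolding conj_coaction_def conj_space_simps(1)
    proof (rule lift)
      show "balanced_on ?V UNIV (\<lambda>x h. to_conj x \<otimes> star h)"
        by (rule balanced_onI)
          (simp_all add: conj_space_simps star_add star_scaleC tensor_add_left tensor_add_right tensor_scale_right
            flip: tensor_scale_left)
    qed
    moreover have "tensor_lift (to_conj ` ?V) UNIV (\<lambda>x h. ?J x \<otimes> h) (\<Sum>i<n. to_conj (unit_vec i) \<otimes> star (w x i))
        = (\<Sum>i<n. ?J (to_conj (unit_vec i)) \<otimes> star (w x i))"
    proof (rule tensor_lift_sum)
      show "csubspace (to_conj ` ?V)"
      proof (rule complex_vector.subspaceI)
        show "0 \<in> to_conj ` ?V"
          using complex_vector.subspace_0[OF subspace_coord_space] by (auto simp: zero_conj_space_def)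
        show "a + b \<in> to_conj ` ?V" if "a \<in> to_conj ` ?V" "b \<in> to_conj ` ?V" for a b
          using that complex_vector.subspace_add[OF subspace_coord_space] by (auto simp flip: conj_space_simps)
        show "c *\<^sub>C a \<in> to_conj ` ?V" if "a \<in> to_conj ` ?V" for a c
          using that complex_vector.subspace_scale[OF subspace_coord_space] by (auto simp: conj_space_simps)
      qed
      show "balanced_on (to_conj ` ?V) UNIV (\<lambda>x (h::'h). ?J x \<otimes> h)"
      proof (rule balanced_onI)
        have Jadd: "?J (a + b) = ?J a + ?J b" and Jscale: "?J (c *\<^sub>C a) = c *\<^sub>C ?J a"
          if "a \<in> to_conj ` ?V" "b \<in> to_conj ` ?V" for a b c
          using hom that by (auto simp: comodule_hom_def clinear_on_def)
        fix a b :: "(nat \<Rightarrow> complex) conj_space" and c and g h :: 'h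
        assume a: "a \<in> to_conj ` ?V"
        show "?J (a + b) \<otimes> h = ?J a \<otimes> h + ?J b \<otimes> h" if "b \<in> to_conj ` ?V"
          using Jadd[OF a that] by (simp add: tensor_add_left)
        show "?J a \<otimes> (g + h) = ?J a \<otimes> g + ?J a \<otimes> h" by (rule tensor_add_right)
        show "?J (c *\<^sub>C a) \<otimes> h = ?J a \<otimes> (c *\<^sub>C h)"
          using Jscale[OF a a] by (simp add: tensor_scale_left tensor_scale_right)
      qed
    qed auto
    ultimately have "(\<Sum>i<n. ?J (to_conj (unit_vec i)) \<otimes> star (w x i)) = t" by simp
    \<comment> \<open>Evaluating the left legs at \<open>y\<close> turns the identity of tensors
      into one in \<open>H\<close>.\<close>
    from arg_cong[OF this, of "slice1 (\<lambda>g. g y)"]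
    have "(\<Sum>i<n. ?J (to_conj (unit_vec i)) y *\<^sub>C star (w x i)) =
        (\<Sum>i<n. y i *\<^sub>C (\<Sum>k<n. ?f (unit_vec k) *\<^sub>C S (u k i)))"
      unfolding t_def slice1_sum[OF clinear_eval] using y by simp
    also have "\<dots> = (\<Sum>k<n. ?f (unit_vec k) *\<^sub>C S (w y k))"
      unfolding rhs[symmetric] lift[OF b4] ..
    finally show ?thesis
      using y by (simp add: inner_product_map_def conj_space_simps)
  qed
  show thesis
    by (rule that[OF ip]) (use main in \<open>simp add: w_def\<close>)
qed

text \<open>The last clause is unitarity of \<open>u\<close>, because the inverse matrix of
  \<open>u\<close> has the entries \<open>S (u i j)\<close>. The inner product behind it is not
  recorded.\<close>

definition unitary_basis :: "nat \<Rightarrow> (nat \<Rightarrow> 'h) \<Rightarrow> (nat \<Rightarrow> 'h \<Rightarrow> complex) \<Rightarrow> (nat \<Rightarrow> nat \<Rightarrow> 'h) \<Rightarrow> 'h set \<Rightarrow> bool"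
  where "unitary_basis n e \<psi> u V \<longleftrightarrow> dual_basis n e \<psi> V \<and> corep n u \<and>
    (\<forall>j<n. \<Delta> (e j) = (\<Sum>i<n. e i \<otimes> u i j)) \<and> (\<forall>i<n. \<forall>j<n. S (u i j) = star (u j i))"

lemma unitary_basisD:
  assumes "unitary_basis n e \<psi> u V"
  shows "dual_basis n e \<psi> V" "corep n u" "j < n \<Longrightarrow> \<Delta> (e j) = (\<Sum>i<n. e i \<otimes> u i j)"
    "i < n \<Longrightarrow> j < n \<Longrightarrow> (\<Sum>k<n. star (u k i) * u k j) = (if i = j then 1 else 0)"
    "i < n \<Longrightarrow> j < n \<Longrightarrow> (\<Sum>k<n. u i k * star (u j k)) = (if i = j then 1 else 0)"
proof -
  have u: "corep n u" and S: "\<And>i j. i < n \<Longrightarrow> j < n \<Longrightarrow> S (u i j) = star (u j i)"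
    using assms by (auto simp: unitary_basis_def)
  show "dual_basis n e \<psi> V" "corep n u" "j < n \<Longrightarrow> \<Delta> (e j) = (\<Sum>i<n. e i \<otimes> u i j)"
    using assms by (auto simp: unitary_basis_def)
  assume ij: "i < n" "j < n"
  show "(\<Sum>k<n. star (u k i) * u k j) = (if i = j then 1 else 0)"
    using corep_antipode(1)[OF u ij] ij by (simp add: S)
  show "(\<Sum>k<n. u i k * star (u j k)) = (if i = j then 1 else 0)"
    using corep_antipode(2)[OF u ij] ij by (simp add: S)
qed

text \<open>In a basis that is orthonormal for the invariant inner product, the invariance identity
  reads S(u_kl) = u_lk^*. Such a basis is chosen among coordinate vectors and carried back to
  \<open>V\<close>.\<close>

lemma unitary_basis_exists:
  assumes V: "subcomodule V" and fin: "finite_dim V"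
  obtains n e \<psi> u where "unitary_basis n e \<psi> u V"
proof -
  obtain n b \<beta> where db: "dual_basis n b \<beta> V" using finite_dim_dual_basis[OF fin] by blast
  note b = dual_basisD[OF db]
  obtain v where v: "corep n v" "\<And>j. j < n \<Longrightarrow> \<Delta> (b j) = (\<Sum>i<n. b i \<otimes> v i j)"
    using corep_of_subcomodule[OF V db] by blast
  obtain ip where ip: "inner_product_on (coord_space n) ip" and
    inv: "\<And>x y. x \<in> coord_space n \<Longrightarrow> y \<in> coord_space n \<Longrightarrow>
      (\<Sum>i<n. ip (unit_vec i) y *\<^sub>C star (\<Sum>j<n. x j *\<^sub>C v i j)) =
      (\<Sum>k<n. ip x (unit_vec k) *\<^sub>C S (\<Sum>i<n. y i *\<^sub>C v k i))"
    using corep_invariant_inner_product[OF v(1)] by blast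
  note ipD = inner_product_onD[OF ip subspace_coord_space]
  obtain m f where ob: "orthonormal_basis ip m f (coord_space n)"
    using orthonormal_basis_exists[OF ip subspace_coord_space finite_dim_coord_space order_refl] by blast
  note f = orthonormal_basisD[OF ob]
  define coord where "coord x = (\<lambda>i. if i < n then \<beta> i x else 0)" for x
  have coord: "coord x \<in> coord_space n" for x by (simp add: coord_def coord_space_def)
  have clin_coord: "clinear coord"
    by (intro clinearI) (auto simp: coord_def fun_eq_iff scaleC_fun_def clinear_add[OF b(2)] clinear_scale[OF b(2)] scaleC_complex)
  define e where "e l = (\<Sum>i<n. f l i *\<^sub>C b i)" for l
  define \<psi> where "\<psi> l x = ip (f l) (coord x)" for l x
  have \<psi>: "clinear (\<psi> l)" if "l < m" for l
    using f(1)[OF that] by (intro clinearI) (simp_all add: \<psi>_def clinear_add[OF clin_coord]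
        clinear_scale[OF clin_coord] ipD coord scaleC_complex)
  have coord_b: "coord (b i) = unit_vec i" if "i < n" for i
    using that b(3) by (auto simp: coord_def unit_vec_def)
  have coord_e: "coord (e l) = f l" if "l < m" for l
    unfolding e_def clinear_sum[OF clin_coord] using f(1)[OF that]
    by (simp add: clinear_scale[OF clin_coord] coord_b coord_space_expand)
  have exp: "(\<Sum>l<m. \<psi> l x *\<^sub>C e l) = x" if "x \<in> V" for x
  proof -
    have "(\<Sum>l<m. \<psi> l x *\<^sub>C e l) = (\<Sum>i<n. (\<Sum>l<m. \<psi> l x *\<^sub>C f l) i *\<^sub>C b i)"
      by (simp add: e_def complex_vector.scale_sum_right complex_vector.scale_sum_left sum_scaleC_fun_apply scaleC_scaleC scaleC_complex)
        (rule sum.swap)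
    also have "(\<Sum>l<m. \<psi> l x *\<^sub>C f l) = coord x" unfolding \<psi>_def by (rule f(3)[OF coord])
    also have "(\<Sum>i<n. coord x i *\<^sub>C b i) = x" using b(4)[OF that] by (simp add: coord_def)
    finally show ?thesis .
  qed
  have de: "dual_basis m e \<psi> V"
    unfolding dual_basis_def
  proof (intro conjI allI impI ballI \<psi> exp)
    show "e l \<in> V" if "l < m" for l
      unfolding e_def
      by (intro complex_vector.subspace_sum complex_vector.subspace_scale subcomoduleD(1)[OF V] b(1)) simp
    show "\<psi> k (e l) = (if k = l then 1 else 0)" if "k < m" "l < m" for k l
      using that by (simp add: \<psi>_def coord_e f(2))
  qed
  obtain u where u: "corep m u" "\<And>j. j < m \<Longrightarrow> \<Delta> (e j) = (\<Sum>i<m. e i \<otimes> u i j)"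
    using corep_of_subcomodule[OF V de] by blast
  \<comment> \<open>Change of basis from \<open>b\<close> to \<open>e\<close>. The inner products
    with unit vectors are kept as they are, since the invariance identity is stated with
    them.\<close>
  have u_eq: "u k l = (\<Sum>i<n. ip (f k) (unit_vec i) *\<^sub>C (\<Sum>j<n. f l j *\<^sub>C v i j))" if kl: "k < m" "l < m" for k l
  proof -
    have "slice1 (\<psi> k) (\<Delta> (e l)) = (\<Sum>i<m. (if k = i then 1 else 0) *\<^sub>C u i l)"
      unfolding u(2)[OF kl(2)] slice1_sum[OF \<psi>[OF kl(1)]] using kl by (simp add: dual_basisD(3)[OF de])
    also have "\<dots> = u k l" by (rule sum_delta_scaleC[OF kl(1)])
    finally have "u k l = slice1 (\<psi> k) (\<Delta> (e l))" ..
    also have "\<Delta> (e l) = (\<Sum>j<n. f l j *\<^sub>C (\<Sum>i<n. b i \<otimes> v i j))"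
      unfolding e_def clinear_sum[OF comult_linear] clinear_scale[OF comult_linear] by (simp add: v(2))
    also have "slice1 (\<psi> k) \<dots> = (\<Sum>j<n. f l j *\<^sub>C (\<Sum>i<n. \<psi> k (b i) *\<^sub>C v i j))"
      unfolding clinear_sum[OF clinear_slice1[OF \<psi>[OF kl(1)]]] clinear_scale[OF clinear_slice1[OF \<psi>[OF kl(1)]]]
        slice1_tensor[OF \<psi>[OF kl(1)]] ..
    also have "\<dots> = (\<Sum>j<n. f l j *\<^sub>C (\<Sum>i<n. ip (f k) (unit_vec i) *\<^sub>C v i j))"
      by (simp add: \<psi>_def coord_b)
    also have "\<dots> = (\<Sum>i<n. ip (f k) (unit_vec i) *\<^sub>C (\<Sum>j<n. f l j *\<^sub>C v i j))"
      by (simp add: complex_vector.scale_sum_right scaleC_scaleC mult.commute) (rule sum.swap)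
    finally show ?thesis .
  qed
  have "S (u k l) = star (u l k)" if kl: "k < m" "l < m" for k l
  proof -
    have "S (u k l) = (\<Sum>i<n. ip (f k) (unit_vec i) *\<^sub>C S (\<Sum>j<n. f l j *\<^sub>C v i j))"
      unfolding u_eq[OF kl] clinear_sum[OF antipode_linear] clinear_scale[OF antipode_linear] ..
    also have "\<dots> = (\<Sum>i<n. ip (unit_vec i) (f l) *\<^sub>C star (\<Sum>j<n. f k j *\<^sub>C v i j))"
      using inv[OF f(1) f(1)] kl by simp
    also have "\<dots> = star (u l k)"
      unfolding u_eq[OF kl(2,1)] star_sum star_scaleC
      by (intro sum.cong refl) (simp add: ipD(5)[OF f(1)[OF kl(2)] unit_vec_in_coord_space])
    finally show ?thesis .
  qed
  with de u show thesis by (intro that[of m e \<psi> u]) (simp add: unitary_basis_def)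
qed

end

section \<open>The Haar functional\<close>

text \<open>Both sides are (\<chi> \<otimes> \<phi>)(t).\<close>

lemma slice_swap:
  assumes "clinear \<phi>" "clinear \<chi>"
  shows "\<phi> (slice1 \<chi> t) = \<chi> (slice2 \<phi> t)"
proof -
  obtain n a b where t: "t = (\<Sum>r<(n::nat). a r \<otimes> b r)" by (rule tensor_expand)
  show ?thesis
    unfolding t slice1_sum[OF assms(2)] slice2_sum[OF assms(1)] clinear_sum[OF assms(1)] clinear_sum[OF assms(2)]
      clinear_scale[OF assms(1)] clinear_scale[OF assms(2)] scaleC_complex
    by (simp add: mult.commute)
qed

text \<open>The invariance g(v_1) v_2 = g(v) 1, localised to \<open>V\<close> because existence and
  uniqueness are first proved on finite-dimensional subcomodules.\<close>

definition (in hopf_algebra) invariant_on :: "'h set \<Rightarrow> ('h \<Rightarrow> complex) \<Rightarrow> bool"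
  where "invariant_on V g \<longleftrightarrow> clinear g \<and> (\<forall>v\<in>V. slice1 g (\<Delta> v) = g v *\<^sub>C 1)"

context hopf_algebra
begin

lemma one_not_zero: "(1 :: 'h) \<noteq> 0"
  using counit_one clinear_zero[OF counit_linear] by auto

lemma subcomodule_Int: "subcomodule V \<Longrightarrow> subcomodule W \<Longrightarrow> subcomodule (V \<inter> W)"
  by (simp add: subcomodule_def complex_vector.subspace_inter)

lemma invariant_onD: "invariant_on V g \<Longrightarrow> clinear g" "invariant_on V g \<Longrightarrow> v \<in> V \<Longrightarrow> slice1 g (\<Delta> v) = g v *\<^sub>C 1"
  by (auto simp: invariant_on_def)

lemma invariant_on_subset: "invariant_on V g \<Longrightarrow> W \<subseteq> V \<Longrightarrow> invariant_on W g"
  by (auto simp: invariant_on_def)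

text \<open>The left legs of \<open>\<Delta> x\<close> can be taken in \<open>V\<close>, so only the
  values of the functional on \<open>V\<close> enter.\<close>

lemma slice1_cong_subcomodule:
  assumes V: "subcomodule V" "finite_dim V" and g: "clinear g" "clinear g'" "\<And>v. v \<in> V \<Longrightarrow> g v = g' v" and "x \<in> V"
  shows "slice1 g (\<Delta> x) = slice1 g' (\<Delta> x)"
proof -
  obtain n e \<psi> where d: "dual_basis n e \<psi> V" using finite_dim_dual_basis[OF V(2)] by blast
  define y where "y i = slice1 (\<psi> i) (\<Delta> x)" for i
  have \<Delta>x: "\<Delta> x = (\<Sum>i<n. e i \<otimes> y i)"
    unfolding y_def by (rule tensor_left_basis[OF d]) (use subcomoduleD(2)[OF V(1)] assms(6) in \<open>simp add: act_def\<close>)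
  show ?thesis
    unfolding \<Delta>x slice1_sum[OF g(1)] slice1_sum[OF g(2)]
    by (intro sum.cong refl) (simp add: g(3) dual_basisD(1)[OF d])
qed

lemma coinvariant:
  assumes "\<Delta> x = x \<otimes> 1"
  shows "x = \<epsilon> x *\<^sub>C 1"
  using slice1_counit[of x] unfolding assms slice1_tensor[OF counit_linear] by simp

end

lemma dual_basis_linear_eq:
  assumes "dual_basis n e \<psi> V" "clinear f" "clinear g" "\<And>i. i < n \<Longrightarrow> f (e i) = g (e i)" "v \<in> V"
  shows "f v = g v"
proof -
  have "f (\<Sum>i<n. \<psi> i v *\<^sub>C e i) = g (\<Sum>i<n. \<psi> i v *\<^sub>C e i)"
    unfolding clinear_sum[OF assms(2)] clinear_sum[OF assms(3)] clinear_scale[OF assms(2)] clinear_scale[OF assms(3)]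
    by (intro sum.cong refl) (simp add: assms(4))
  then show ?thesis by (simp add: dual_basisD(4)[OF assms(1,5)])
qed

section \<open>Existence, uniqueness and two-sided invariance of the Haar functional\<close>

context cqg_algebra
begin

lemma invariant_on_coefficients:
  assumes "invariant_on V g" "unitary_basis n e \<psi> u V" "l < n"
  shows "(\<Sum>k<n. g (e k) *\<^sub>C u k l) = g (e l) *\<^sub>C 1"
  using invariant_onD(2)[OF assms(1), of "e l"] dual_basisD(1)[OF unitary_basisD(1)[OF assms(2)] assms(3)]
  unfolding unitary_basisD(3)[OF assms(2,3)] slice1_sum[OF invariant_onD(1)[OF assms(1)]] .

text \<open>The coordinate vector \<open>t\<close> of 1 is fixed by \<open>u\<close>, since
  \<Delta>(1) = 1 \<otimes> 1. Unitarity makes the row of its conjugates fixed as well, so pairing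
  with \<open>t\<close> is an invariant functional.\<close>

lemma invariant_functional_exists:
  assumes V: "subcomodule V" "finite_dim V" "1 \<in> V"
  obtains g where "invariant_on V g" "g 1 = 1"
proof -
  obtain n e \<psi> u where ub: "unitary_basis n e \<psi> u V" using unitary_basis_exists[OF V(1,2)] by blast
  note u = unitary_basisD[OF ub] and d = dual_basisD[OF unitary_basisD(1)[OF ub]]
  define t where "t i = \<psi> i 1" for i
  have one: "(\<Sum>i<n. t i *\<^sub>C e i) = 1" unfolding t_def by (rule d(4)[OF V(3)])
  have t: "(\<Sum>j<n. t j *\<^sub>C u i j) = t i *\<^sub>C 1" if i: "i < n" for i
  proof -
    have "\<Delta> 1 = (\<Sum>j<n. t j *\<^sub>C (\<Sum>k<n. e k \<otimes> u k j))"
      unfolding one[symmetric] clinear_sum[OF comult_linear] clinear_scale[OF comult_linear] by (simp add: u(3))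
    from arg_cong[OF this, of "slice1 (\<psi> i)"]
    have "t i *\<^sub>C 1 = (\<Sum>j<n. t j *\<^sub>C (\<Sum>k<n. \<psi> i (e k) *\<^sub>C u k j))"
      unfolding comult_one slice1_tensor[OF d(2)[OF i]] clinear_sum[OF clinear_slice1[OF d(2)[OF i]]]
        clinear_scale[OF clinear_slice1[OF d(2)[OF i]]] t_def .
    also have "\<dots> = (\<Sum>j<n. t j *\<^sub>C u i j)"
    proof (intro sum.cong refl arg_cong2[where f = scaleC])
      fix j
      have "(\<Sum>k<n. \<psi> i (e k) *\<^sub>C u k j) = (\<Sum>k<n. (if i = k then 1 else 0) *\<^sub>C u k j)"
        by (intro sum.cong refl) (simp add: d(3) i)
      also have "\<dots> = u i j" by (rule sum_delta_scaleC(2)[OF i])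
      finally show "(\<Sum>k<n. \<psi> i (e k) *\<^sub>C u k j) = u i j" .
    qed
    finally show ?thesis ..
  qed
  have t_star: "(\<Sum>k<n. cnj (t k) *\<^sub>C u k l) = cnj (t l) *\<^sub>C 1" if l: "l < n" for l
  proof -
    have "(\<Sum>k<n. cnj (t k) *\<^sub>C u k l) = (\<Sum>k<n. star (t k *\<^sub>C 1) * u k l)"
      by (simp add: star_scaleC mult_scaleC_left)
    also have "\<dots> = (\<Sum>k<n. \<Sum>j<n. cnj (t j) *\<^sub>C (star (u k j) * u k l))"
      by (intro sum.cong refl) (simp add: t[symmetric] star_sum star_scaleC mult_sum_scale)
    also have "\<dots> = (\<Sum>j<n. cnj (t j) *\<^sub>C (\<Sum>k<n. star (u k j) * u k l))"
      unfolding complex_vector.scale_sum_right by (rule sum.swap)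
    also have "\<dots> = (\<Sum>j<n. (if j = l then 1 else 0) *\<^sub>C (cnj (t j) *\<^sub>C 1))"
      by (intro sum.cong refl) (simp add: u(4) l scaleC_one)
    also have "\<dots> = cnj (t l) *\<^sub>C 1" by (rule sum_delta_scaleC[OF l])
    finally show ?thesis .
  qed
  \<comment> \<open>The squared norm of \<open>t\<close>, by which the functional is divided to take
    the value 1 at 1. It is nonzero because 1 is nonzero in \<open>H\<close>.\<close>
  define N where "N = (\<Sum>j<n. cnj (t j) * t j)"
  have "N \<noteq> 0"
  proof
    assume "N = 0"
    have N: "N = complex_of_real (\<Sum>j<n. (cmod (t j))\<^sup>2)"
      unfolding N_def of_real_sum by (intro sum.cong refl) (simp only: complex_norm_square mult.commute)
    with \<open>N = 0\<close> have "(\<Sum>j<n. (cmod (t j))\<^sup>2) = 0" by (simp only: of_real_eq_0_iff)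
    then have "\<forall>j<n. t j = 0" by (simp add: sum_nonneg_eq_0_iff)
    then show False using one one_not_zero by simp
  qed
  define g where "g v = (1 / N) * (\<Sum>j<n. cnj (t j) * \<psi> j v)" for v
  have g: "clinear g"
    by (intro clinearI) (simp_all add: g_def clinear_add[OF d(2)] clinear_scale[OF d(2)] scaleC_complex
        distrib_left sum.distrib sum_distrib_left mult.left_commute add_divide_distrib)
  have ge: "g (e l) = (1 / N) * cnj (t l)" if l: "l < n" for l
  proof -
    have "(\<Sum>j<n. cnj (t j) * \<psi> j (e l)) = (\<Sum>j<n. cnj (t j) * (if j = l then 1 else 0))"
      by (intro sum.cong refl) (simp add: d(3) l)
    also have "\<dots> = cnj (t l)" by (rule sum_delta_mult[OF l])
    finally show ?thesis by (simp add: g_def)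
  qed
  have "slice1 g (\<Delta> v) = g v *\<^sub>C 1" if "v \<in> V" for v
  proof (rule dual_basis_linear_eq[OF u(1) _ _ _ that])
    show "clinear (\<lambda>v. slice1 g (\<Delta> v))" by (rule clinear_compose[OF clinear_slice1[OF g] comult_linear])
    show "clinear (\<lambda>v. g v *\<^sub>C 1)"
      using g by (intro clinearI) (simp_all add: clinear_add clinear_scale scaleC_add_left scaleC_scaleC scaleC_complex)
    fix l assume l: "l < n"
    have "slice1 g (\<Delta> (e l)) = (1 / N) *\<^sub>C (\<Sum>k<n. cnj (t k) *\<^sub>C u k l)"
      unfolding u(3)[OF l] slice1_sum[OF g] complex_vector.scale_sum_right
      by (intro sum.cong refl) (simp add: ge scaleC_scaleC)
    then show "slice1 g (\<Delta> (e l)) = g (e l) *\<^sub>C 1" by (simp only: t_star[OF l] ge[OF l] scaleC_scaleC)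
  qed
  moreover have "g 1 = 1" unfolding g_def t_def[symmetric] N_def[symmetric] using \<open>N \<noteq> 0\<close> by simp
  ultimately show thesis using g by (intro that[of g]) (simp_all add: invariant_on_def)
qed

text \<open>The converse passage: an invariant row (g(e_j)) gives, by unitarity, a fixed column
  \<open>c\<close> of conjugates. The vector \<open>v\<close> = \<Sum> c_j e_j is then coinvariant,
  hence a multiple of 1, so 0 = g(v) = \<Sum> |g(e_j)|^2.\<close>

lemma invariant_functional_zero:
  assumes V: "subcomodule V" "finite_dim V" and g: "invariant_on V g" "g 1 = 0" and "x \<in> V"
  shows "g x = 0"
proof -
  obtain n e \<psi> u where ub: "unitary_basis n e \<psi> u V" using unitary_basis_exists[OF V(1,2)] by blast
  note u = unitary_basisD[OF ub] and d = dual_basisD[OF unitary_basisD(1)[OF ub]]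
  note lin = invariant_onD(1)[OF g(1)]
  define c where "c i = cnj (g (e i))" for i
  have c: "(\<Sum>j<n. c j *\<^sub>C u i j) = c i *\<^sub>C 1" if i: "i < n" for i
  proof -
    have "(\<Sum>j<n. c j *\<^sub>C u i j) = (\<Sum>j<n. u i j * star (g (e j) *\<^sub>C 1))"
      by (simp add: star_scaleC mult_scaleC_right c_def)
    also have "\<dots> = (\<Sum>j<n. \<Sum>k<n. c k *\<^sub>C (u i j * star (u k j)))"
      by (intro sum.cong refl)
        (simp add: invariant_on_coefficients[OF g(1) ub, symmetric] star_sum star_scaleC mult_sum_scale c_def)
    also have "\<dots> = (\<Sum>k<n. c k *\<^sub>C (\<Sum>j<n. u i j * star (u k j)))"
      unfolding complex_vector.scale_sum_right by (rule sum.swap)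
    also have "\<dots> = (\<Sum>k<n. (if i = k then 1 else 0) *\<^sub>C (c k *\<^sub>C 1))"
      by (intro sum.cong refl) (simp add: u(5) i scaleC_one)
    also have "\<dots> = c i *\<^sub>C 1" by (rule sum_delta_scaleC[OF i])
    finally show ?thesis .
  qed
  define v where "v = (\<Sum>j<n. c j *\<^sub>C e j)"
  have "\<Delta> v = (\<Sum>j<n. c j *\<^sub>C (\<Sum>i<n. e i \<otimes> u i j))"
    unfolding v_def clinear_sum[OF comult_linear] clinear_scale[OF comult_linear] by (simp add: u(3))
  also have "\<dots> = (\<Sum>i<n. e i \<otimes> (\<Sum>j<n. c j *\<^sub>C u i j))"
    by (simp add: tensor_sum_right tensor_scale_right complex_vector.scale_sum_right) (rule sum.swap)
  also have "\<dots> = v \<otimes> 1"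
    by (simp add: c v_def tensor_sum_left tensor_scale_left tensor_scale_right)
  finally have "v = \<epsilon> v *\<^sub>C 1" by (rule coinvariant)
  then have "g v = \<epsilon> v * g 1" using clinear_scale[OF lin, of "\<epsilon> v" 1] by (simp add: scaleC_complex)
  then have "(\<Sum>j<n. c j * g (e j)) = 0"
    using g(2) by (simp add: v_def clinear_sum[OF lin] clinear_scale[OF lin] scaleC_complex)
  also have "(\<Sum>j<n. c j * g (e j)) = complex_of_real (\<Sum>j<n. (cmod (g (e j)))\<^sup>2)"
    unfolding of_real_sum by (intro sum.cong refl) (simp only: complex_norm_square mult.commute c_def)
  finally have "(\<Sum>j<n. (cmod (g (e j)))\<^sup>2) = 0" by (simp only: of_real_eq_0_iff)
  then have z: "\<And>j. j < n \<Longrightarrow> g (e j) = 0" by (simp add: sum_nonneg_eq_0_iff)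
  have "clinear (\<lambda>_. 0 :: complex)" by (intro clinearI) (simp_all add: scaleC_complex)
  from dual_basis_linear_eq[OF u(1) lin this z assms(5)] show ?thesis by simp
qed

lemma invariant_functional_unique:
  assumes "subcomodule V" "finite_dim V" "invariant_on V g" "invariant_on V g'" "g 1 = g' 1" "x \<in> V"
  shows "g x = g' x"
proof -
  have lin: "clinear (\<lambda>x. g x - g' x)"
    using invariant_onD(1)[OF assms(3)] invariant_onD(1)[OF assms(4)]
    by (intro clinearI) (simp_all add: clinear_add clinear_scale scaleC_complex algebra_simps)
  have "slice1 (\<lambda>x. g x - g' x) t = slice1 g t - slice1 g' t" for t :: "('h, 'h) ctensor"
  proof -
    obtain n a b where t: "t = (\<Sum>r<(n::nat). a r \<otimes> b r)" by (rule tensor_expand)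
    show ?thesis
      by (simp add: t slice1_sum lin invariant_onD(1)[OF assms(3)] invariant_onD(1)[OF assms(4)]
          complex_vector.scale_left_diff_distrib sum_subtractf)
  qed
  then have "invariant_on V (\<lambda>x. g x - g' x)"
    using assms(3,4) lin by (simp add: invariant_on_def complex_vector.scale_left_diff_distrib)
  from invariant_functional_zero[OF assms(1,2) this _ assms(6)] assms(5) show ?thesis by simp
qed

text \<open>Glued from normalised invariant functionals on finite-dimensional subcomodules
  containing 1; by uniqueness two of them agree on the intersection of their domains.\<close>

definition haar :: "'h \<Rightarrow> complex"
  where "haar x = (THE c. \<exists>V g. subcomodule V \<and> finite_dim V \<and> 1 \<in> V \<and> x \<in> V \<and> invariant_on V g \<and> g 1 = 1 \<and> c = g x)"

lemma haar_eq:
  assumes "subcomodule V" "finite_dim V" "1 \<in> V" "x \<in> V" "invariant_on V g" "g 1 = 1"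
  shows "haar x = g x"
  unfolding haar_def
proof (rule the_equality)
  show "\<exists>V g'. subcomodule V \<and> finite_dim V \<and> 1 \<in> V \<and> x \<in> V \<and> invariant_on V g' \<and> g' 1 = 1 \<and> g x = g' x"
    using assms by blast
  fix c assume "\<exists>V g. subcomodule V \<and> finite_dim V \<and> 1 \<in> V \<and> x \<in> V \<and> invariant_on V g \<and> g 1 = 1 \<and> c = g x"
  then obtain V' g' where V': "subcomodule V'" "finite_dim V'" "1 \<in> V'" "x \<in> V'" "invariant_on V' g'" "g' 1 = 1"
    "c = g' x" by blast
  \<comment> \<open>The intersection is a subcomodule that still contains 1 and \<open>x\<close>, so
    the uniqueness lemma applies to it.\<close>
  have VV': "subcomodule (V \<inter> V')" by (rule subcomodule_Int[OF assms(1) V'(1)])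
  have "g' x = g x"
  proof (rule invariant_functional_unique[OF VV'])
    show "finite_dim (V \<inter> V')" by (rule finite_dim_subset[OF assms(2) subcomoduleD(1)[OF VV']]) simp
    show "invariant_on (V \<inter> V') g'" "invariant_on (V \<inter> V') g"
      using invariant_on_subset[OF V'(5)] invariant_on_subset[OF assms(5)] by auto
  qed (use V' assms in auto)
  then show "c = g x" using V' by simp
qed

lemma haar_local:
  assumes "finite F"
  obtains V g where "subcomodule V" "finite_dim V" "1 \<in> V" "F \<subseteq> V" "invariant_on V g" "g 1 = 1"
    "\<And>x. x \<in> V \<Longrightarrow> haar x = g x"
proof -
  obtain V where V: "subcomodule V" "finite_dim V" "insert 1 F \<subseteq> V"
    using finite_dim_subcomodule[of "insert 1 F"] assms by blast
  then obtain g where "invariant_on V g" "g 1 = 1" using invariant_functional_exists[of V] by blast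
  with V show thesis
    by (intro that[of V g]) (auto intro: haar_eq)
qed

lemma haar_linear: "clinear haar"
proof (rule clinearI)
  fix x y c
  obtain V g where V: "subcomodule V" "{x, y} \<subseteq> V" "invariant_on V g" "\<And>x. x \<in> V \<Longrightarrow> haar x = g x"
    using haar_local[of "{x, y}"] by (metis finite.emptyI finite.insertI)
  note cl = complex_vector.subspace_add[OF subcomoduleD(1)[OF V(1)]] complex_vector.subspace_scale[OF subcomoduleD(1)[OF V(1)]]
  show "haar (x + y) = haar x + haar y" "haar (c *\<^sub>C x) = c *\<^sub>C haar x"
    using V(2) by (simp_all add: V(4) cl clinear_add[OF invariant_onD(1)[OF V(3)]] clinear_scale[OF invariant_onD(1)[OF V(3)]])
qed

lemma haar_one: "haar 1 = 1"
proof -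
  obtain V g where "1 \<in> V" "g 1 = 1" "\<And>x. x \<in> V \<Longrightarrow> haar x = g x"
    using haar_local[of "{}"] by (metis finite.emptyI)
  then show ?thesis by simp
qed

lemma haar_right_invariant: "slice1 haar (\<Delta> x) = haar x *\<^sub>C 1"
proof -
  obtain V g where V: "subcomodule V" "finite_dim V" "{x} \<subseteq> V" "invariant_on V g" "\<And>x. x \<in> V \<Longrightarrow> haar x = g x"
    using haar_local[of "{x}"] by (metis finite.emptyI finite.insertI)
  have "slice1 haar (\<Delta> x) = slice1 g (\<Delta> x)"
    by (rule slice1_cong_subcomodule[OF V(1,2) haar_linear invariant_onD(1)[OF V(4)] V(5)]) (use V(3) in auto)
  then show ?thesis using V by (simp add: invariant_onD(2))
qed

text \<open>Functionals derived from \<open>haar\<close> are identified with it in this way, in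
  \<open>haar_left_invariant\<close> and \<open>haar_star\<close>.\<close>

lemma haar_unique:
  assumes "invariant_on UNIV g"
  shows "g x = g 1 * haar x"
proof -
  obtain V where V: "subcomodule V" "finite_dim V" "{1, x} \<subseteq> V"
    using finite_dim_subcomodule[of "{1, x}"] by auto
  have lin: "clinear (\<lambda>x. g 1 * haar x)"
    using haar_linear by (intro clinearI) (simp_all add: clinear_add clinear_scale scaleC_complex algebra_simps)
  have "slice1 (\<lambda>x. g 1 * haar x) t = g 1 *\<^sub>C slice1 haar t" for t :: "('h, 'h) ctensor"
  proof -
    obtain n a b where t: "t = (\<Sum>r<(n::nat). a r \<otimes> b r)" by (rule tensor_expand)
    show ?thesis by (simp add: t slice1_sum lin haar_linear complex_vector.scale_sum_right scaleC_scaleC)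
  qed
  then have inv: "invariant_on V (\<lambda>x. g 1 * haar x)"
    using lin by (simp add: invariant_on_def haar_right_invariant scaleC_scaleC)
  show ?thesis
    by (rule invariant_functional_unique[OF V(1,2) invariant_on_subset[OF assms subset_UNIV] inv])
      (use V(3) in \<open>simp_all only: haar_one mult_1_right insert_subset\<close>)
qed

text \<open>For each \<phi> the functional z \<mapsto> \<phi>(z_1) haar(z_2) inherits the invariance
  already known for \<open>haar\<close>, so it is a multiple of \<open>haar\<close>; the factor is
  its value \<phi>(1) at 1.\<close>

lemma haar_left_invariant: "act haar x = haar x *\<^sub>C 1"
proof (rule functionals_separate)
  fix \<phi> :: "'h \<Rightarrow> complex" assume \<phi>: "clinear \<phi>"
  let ?k = "\<lambda>z. \<phi> (act haar z)"
  have k: "clinear ?k" by (rule clinear_compose[OF \<phi> clinear_act[OF haar_linear]])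
  have "slice1 ?k (\<Delta> z) = ?k z *\<^sub>C 1" for z
  proof (rule functionals_separate)
    fix \<chi> :: "'h \<Rightarrow> complex" assume \<chi>: "clinear \<chi>"
    have *: "haar (act \<chi> y) = \<chi> 1 * haar y" for y
      unfolding act_def slice_swap[OF \<chi> haar_linear, symmetric] haar_right_invariant clinear_scale[OF \<chi>] scaleC_complex
      by (rule mult.commute)
    have "\<chi> (slice1 ?k (\<Delta> z)) = ?k (act \<chi> z)"
      unfolding act_def[of \<chi>] by (rule slice_swap[OF \<chi> k])
    also have "\<dots> = \<phi> (act (\<lambda>y. \<chi> 1 * haar y) z)" by (simp add: act_act[OF haar_linear \<chi>] *)
    also have "act (\<lambda>y. \<chi> 1 * haar y) z = \<chi> 1 *\<^sub>C act haar z"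
    proof -
      obtain n a b where z: "\<Delta> z = (\<Sum>r<(n::nat). a r \<otimes> b r)" by (rule tensor_expand)
      have "clinear (\<lambda>y. \<chi> 1 * haar y)"
        using haar_linear by (intro clinearI) (simp_all add: clinear_add clinear_scale scaleC_complex algebra_simps)
      then show ?thesis
        by (simp add: act_sum[OF _ z] haar_linear complex_vector.scale_sum_right scaleC_scaleC)
    qed
    finally show "\<chi> (slice1 ?k (\<Delta> z)) = \<chi> (?k z *\<^sub>C 1)"
      by (simp add: clinear_scale[OF \<phi>] clinear_scale[OF \<chi>] scaleC_complex mult.commute)
  qed
  then have "invariant_on UNIV ?k" by (simp add: invariant_on_def k)
  from haar_unique[OF this, of x]
  show "\<phi> (act haar x) = \<phi> (haar x *\<^sub>C 1)"
    by (simp add: act_one haar_linear haar_one scaleC_one clinear_scale[OF \<phi>] scaleC_complex mult.commute)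
qed

lemma haar_star: "haar (star x) = cnj (haar x)"
proof -
  let ?g = "\<lambda>z. cnj (haar (star z))"
  have g: "clinear ?g" by (rule clinear_star_conj[OF haar_linear])
  have "slice1 ?g (\<Delta> z) = ?g z *\<^sub>C 1" for z
  proof -
    obtain n a b where z: "\<Delta> z = (\<Sum>r<(n::nat). a r \<otimes> b r)" by (rule tensor_expand)
    have "slice1 ?g (\<Delta> z) = star (slice1 haar (\<Delta> (star z)))"
      by (simp add: z comult_star_sum[OF z] slice1_sum[OF g] slice1_sum[OF haar_linear] star_sum star_scaleC star_star)
    then show ?thesis by (simp add: haar_right_invariant star_scaleC)
  qed
  then have "invariant_on UNIV ?g" by (simp add: invariant_on_def g)
  from haar_unique[OF this, of x] have "cnj (haar (star x)) = haar x" by (simp add: haar_one)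
  then show ?thesis by (metis complex_cnj_cnj)
qed

end

subsection \<open>Positivity of the Haar functional\<close>

text \<open>The number of spanning vectors drops, which is the induction measure in
  \<open>haar_positive_finite_dim\<close>.\<close>

lemma proper_subspace_smaller:
  assumes "csubspace W" "W \<subset> V" "V \<subseteq> cspan B" "finite B"
  shows "\<exists>C. finite C \<and> W = cspan C \<and> card C < card B"
proof -
  obtain C where C: "finite C" "complex_vector.independent C" "C \<subseteq> W" "cspan C = W"
    using finite_subset_span[OF assms(1) _ assms(4)] assms(2,3) by blast
  obtain x where x: "x \<in> V" "x \<notin> W" using assms(2) by blast
  then have "complex_vector.independent (insert x C)"
    using C by (intro complex_vector.independent_insertI) auto
  moreover have "insert x C \<subseteq> cspan B" using x C assms(2,3) by blast
  ultimately have "card (insert x C) \<le> card B"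
    using complex_vector.independent_span_bound[OF assms(4)] by blast
  moreover have "x \<notin> C" using C x by blast
  ultimately have "card C < card B" using C(1) by simp
  then show ?thesis using C by blast
qed

section \<open>The sesquilinear form of the Haar functional\<close>

context cqg_algebra
begin

abbreviation haar_form :: "'h \<Rightarrow> 'h \<Rightarrow> complex"
  where "haar_form x y \<equiv> haar (star x * y)"

lemma haar_form_linear: "clinear (haar_form x)"
  by (intro clinearI) (simp_all add: distrib_left mult_scaleC_right clinear_add[OF haar_linear] clinear_scale[OF haar_linear])

lemma haar_form_sym: "cnj (haar_form x y) = haar_form y x"
  by (simp add: haar_star[symmetric] star_mult star_star)

lemma haar_form_sum_left: "haar_form (\<Sum>i\<in>I. c i *\<^sub>C x i) y = (\<Sum>i\<in>I. cnj (c i) * haar_form (x i) y)"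
  by (simp add: star_sum star_scaleC sum_distrib_right mult_scaleC_left clinear_sum[OF haar_linear]
      clinear_scale[OF haar_linear] scaleC_complex)

lemma haar_form_add_left: "haar_form (x + y) z = haar_form x z + haar_form y z"
  by (simp add: star_add distrib_right clinear_add[OF haar_linear])

text \<open>Invariance applied to e_j^* y expresses the scalar h(e_j^* y) through the entries
  u_ij^*. Multiplying by u_kj and summing over j removes them, as u u^* = 1.\<close>

lemma haar_form_invariant:
  assumes ub: "unitary_basis n e \<psi> u V" and k: "k < n"
  shows "slice1 (haar_form (e k)) (\<Delta> y) = (\<Sum>j<n. haar_form (e j) y *\<^sub>C u k j)"
proof -
  note u = unitary_basisD[OF ub]
  obtain m a b where y: "\<Delta> y = (\<Sum>r<(m::nat). a r \<otimes> b r)" by (rule tensor_expand)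
  have inv: "haar_form (e j) y *\<^sub>C 1 = (\<Sum>i<n. \<Sum>r<m. haar_form (e i) (a r) *\<^sub>C (star (u i j) * b r))"
    if j: "j < n" for j
    unfolding haar_right_invariant[symmetric] comult_mult_sum[OF comult_star_sum[OF u(3)[OF j]] y]
      clinear_sum[OF clinear_slice1[OF haar_linear]] slice1_tensor[OF haar_linear] ..
  have "(\<Sum>j<n. haar_form (e j) y *\<^sub>C u k j) = (\<Sum>j<n. u k j * (haar_form (e j) y *\<^sub>C 1))"
    by (simp add: mult_scaleC_right)
  also have "\<dots> = (\<Sum>j<n. \<Sum>i<n. \<Sum>r<m. haar_form (e i) (a r) *\<^sub>C (u k j * star (u i j) * b r))"
    by (intro sum.cong refl) (simp add: inv sum_distrib_left mult_scaleC_right mult.assoc)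
  also have "\<dots> = (\<Sum>i<n. \<Sum>j<n. \<Sum>r<m. haar_form (e i) (a r) *\<^sub>C (u k j * star (u i j) * b r))"
    by (rule sum.swap)
  also have "\<dots> = (\<Sum>i<n. \<Sum>r<m. haar_form (e i) (a r) *\<^sub>C ((\<Sum>j<n. u k j * star (u i j)) * b r))"
    unfolding sum_distrib_right complex_vector.scale_sum_right by (intro sum.cong refl sum.swap)
  also have "\<dots> = (\<Sum>i<n. (if k = i then 1 else 0) *\<^sub>C (\<Sum>r<m. haar_form (e i) (a r) *\<^sub>C b r))"
    by (intro sum.cong refl) (simp add: u(5) k scaleC_one)
  also have "\<dots> = (\<Sum>r<m. haar_form (e k) (a r) *\<^sub>C b r)" by (rule sum_delta_scaleC[OF k])
  also have "\<dots> = slice1 (haar_form (e k)) (\<Delta> y)" unfolding y slice1_sum[OF haar_form_linear] ..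
  finally show ?thesis ..
qed

lemma haar_form_act:
  assumes ub: "unitary_basis n e \<psi> u V" and k: "k < n" and \<phi>: "clinear \<phi>"
  shows "haar_form (e k) (act \<phi> y) = (\<Sum>j<n. haar_form (e j) y * \<phi> (u k j))"
proof -
  have "haar_form (e k) (act \<phi> y) = \<phi> (slice1 (haar_form (e k)) (\<Delta> y))"
    unfolding act_def by (rule slice_swap[OF \<phi> haar_form_linear, symmetric])
  then show ?thesis
    by (simp add: haar_form_invariant[OF ub k] clinear_sum[OF \<phi>] clinear_scale[OF \<phi>] scaleC_complex)
qed

lemma act_basis:
  assumes "unitary_basis n e \<psi> u V" "j < n" "clinear \<phi>"
  shows "act \<phi> (e j) = (\<Sum>i<n. \<phi> (u i j) *\<^sub>C e i)"
  by (rule act_sum[OF assms(3) unitary_basisD(3)[OF assms(1,2)]])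

text \<open>\<open>haar_form_act\<close> expresses the pairings of \<open>act \<phi> v\<close> with
  a basis of \<open>W\<close> through those of \<open>v\<close>. Invariance alone is used, so the
  result is available in the proof of positivity.\<close>

lemma subcomodule_orthogonal:
  assumes W: "subcomodule W" "finite_dim W" and V: "subcomodule V"
  shows "subcomodule {v \<in> V. \<forall>w\<in>W. haar_form w v = 0}"
  unfolding subcomodule_def
proof (intro conjI allI impI ballI)
  note lin = clinear_add[OF haar_form_linear] clinear_scale[OF haar_form_linear] clinear_zero[OF haar_form_linear]
  show "csubspace {v \<in> V. \<forall>w\<in>W. haar_form w v = 0}"
    using subcomoduleD(1)[OF V] by (simp add: complex_vector.subspace_def lin scaleC_complex clinear_zero[OF haar_linear])
  fix \<phi> :: "'h \<Rightarrow> complex" and v assume \<phi>: "clinear \<phi>" and v: "v \<in> {v \<in> V. \<forall>w\<in>W. haar_form w v = 0}"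
  obtain n e \<psi> u where ub: "unitary_basis n e \<psi> u W" using unitary_basis_exists[OF W] by blast
  note d = dual_basisD[OF unitary_basisD(1)[OF ub]]
  have "haar_form w (act \<phi> v) = 0" if w: "w \<in> W" for w
  proof -
    have "haar_form w (act \<phi> v) = (\<Sum>k<n. cnj (\<psi> k w) * haar_form (e k) (act \<phi> v))"
      by (subst d(4)[OF w, symmetric]) (rule haar_form_sum_left)
    also have "\<dots> = 0" using v d(1) by (simp add: haar_form_act[OF ub _ \<phi>])
    finally show ?thesis .
  qed
  then show "act \<phi> v \<in> {v \<in> V. \<forall>w\<in>W. haar_form w v = 0}"
    using v subcomoduleD(2)[OF V \<phi>] by simp
qed

text \<open>
  For an orthonormal basis of a subcomodule, the element \<open>\<Sum>\<^sub>j f\<^sub>j f\<^sub>j\<^sup>*\<close> is coinvariant, hence a scalar,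
  and evaluating \<open>\<epsilon>\<close> shows that this scalar is positive.
\<close>

lemma sum_mult_star_basis:
  assumes ub: "unitary_basis n f \<psi> u V"
  shows "(\<Sum>j<n. f j * star (f j)) = complex_of_real (\<Sum>j<n. (cmod (\<epsilon> (f j)))\<^sup>2) *\<^sub>C 1"
    "0 < n \<Longrightarrow> 0 < (\<Sum>j<n. (cmod (\<epsilon> (f j)))\<^sup>2)"
proof -
  note u = unitary_basisD[OF ub] and d = dual_basisD[OF unitary_basisD(1)[OF ub]]
  define Z where "Z = (\<Sum>j<n. f j * star (f j))"
  have "\<Delta> Z = (\<Sum>j<n. \<Sum>i<n. \<Sum>k<n. (f i * star (f k)) \<otimes> (u i j * star (u k j)))"
    unfolding Z_def clinear_sum[OF comult_linear]
    by (intro sum.cong refl comult_mult_sum u(3) comult_star_sum) simp_all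
  also have "\<dots> = (\<Sum>i<n. \<Sum>j<n. \<Sum>k<n. (f i * star (f k)) \<otimes> (u i j * star (u k j)))"
    by (rule sum.swap)
  also have "\<dots> = (\<Sum>i<n. \<Sum>k<n. (f i * star (f k)) \<otimes> (\<Sum>j<n. u i j * star (u k j)))"
    unfolding tensor_sum_right by (intro sum.cong refl sum.swap)
  also have "\<dots> = (\<Sum>i<n. \<Sum>k<n. (if i = k then 1 else 0) *\<^sub>C ((f i * star (f k)) \<otimes> 1))"
    by (intro sum.cong refl) (simp add: u(5) scaleC_one)
  also have "\<dots> = (\<Sum>i<n. (f i * star (f i)) \<otimes> 1)"
    by (intro sum.cong refl) (simp only: sum_delta_scaleC lessThan_iff)
  also have "\<dots> = Z \<otimes> 1" by (simp add: Z_def tensor_sum_left)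
  finally have "Z = \<epsilon> Z *\<^sub>C 1" by (rule coinvariant)
  moreover have "\<epsilon> Z = complex_of_real (\<Sum>j<n. (cmod (\<epsilon> (f j)))\<^sup>2)"
    unfolding Z_def clinear_sum[OF counit_linear] of_real_sum
    by (intro sum.cong refl) (simp only: complex_norm_square counit_mult counit_star)
  ultimately show "(\<Sum>j<n. f j * star (f j)) = complex_of_real (\<Sum>j<n. (cmod (\<epsilon> (f j)))\<^sup>2) *\<^sub>C 1"
    by (simp add: Z_def)
  \<comment> \<open>If \<open>\<epsilon>\<close> vanished on the whole basis,
    \<open>corep_expand\<close> would make every basis vector zero.\<close>
  show "0 < (\<Sum>j<n. (cmod (\<epsilon> (f j)))\<^sup>2)" if "0 < n"
  proof (rule ccontr)
    assume "\<not> 0 < (\<Sum>j<n. (cmod (\<epsilon> (f j)))\<^sup>2)"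
    moreover have "0 \<le> (\<Sum>j<n. (cmod (\<epsilon> (f j)))\<^sup>2)" by (simp add: sum_nonneg)
    ultimately have "(\<Sum>j<n. (cmod (\<epsilon> (f j)))\<^sup>2) = 0" by linarith
    then have "\<And>j. j < n \<Longrightarrow> \<epsilon> (f j) = 0" by (simp add: sum_nonneg_eq_0_iff)
    then have "f 0 = 0" using corep_expand[OF u(1,3) that] by simp
    then show False using d(3)[OF that that] clinear_zero[OF d(2)[OF that]] by simp
  qed
qed

text \<open>Schur's lemma: the Gram operator \<open>T\<close> of the form is colinear and has an
  eigenvalue, hence is a scalar \<open>z\<close>, and the form is \<open>z\<close> times the
  Euclidean form of the basis. Applying \<open>haar\<close> to the coinvariant \<Sum> f_j f_j^* of
  the conjugate comodule gives \<open>c = z * s\<close> with \<open>c\<close> positive and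
  \<open>s\<close> nonnegative, so \<open>z\<close> has positive real part.\<close>

lemma haar_positive_simple:
  assumes V: "subcomodule V" "finite_dim V" and nonzero: "V \<noteq> {0}"
    and simple: "\<And>W. subcomodule W \<Longrightarrow> W \<subseteq> V \<Longrightarrow> W = V \<or> W = {0}"
    and x: "x \<in> V" "x \<noteq> 0"
  shows "0 < Re (haar_form x x)"
proof -
  obtain n e \<psi> u where ub: "unitary_basis n e \<psi> u V" using unitary_basis_exists[OF V] by blast
  note d = dual_basisD[OF unitary_basisD(1)[OF ub]]
  define T where "T v = (\<Sum>j<n. haar_form (e j) v *\<^sub>C e j)" for v
  have T: "clinear T" unfolding T_def by (rule clinear_sum_scale) (rule haar_form_linear)
  have TV: "T v \<in> V" for v unfolding T_def
    by (intro complex_vector.subspace_sum complex_vector.subspace_scale subcomoduleD(1)[OF V(1)] d(1)) simp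
  have T_act: "T (act \<phi> v) = act \<phi> (T v)" if \<phi>: "clinear \<phi>" for \<phi> v
  proof -
    have "T (act \<phi> v) = (\<Sum>k<n. \<Sum>j<n. (haar_form (e j) v * \<phi> (u k j)) *\<^sub>C e k)"
      unfolding T_def complex_vector.scale_sum_left[symmetric]
      by (intro sum.cong refl) (simp add: haar_form_act[OF ub _ \<phi>])
    also have "\<dots> = (\<Sum>j<n. \<Sum>k<n. (haar_form (e j) v * \<phi> (u k j)) *\<^sub>C e k)" by (rule sum.swap)
    also have "\<dots> = act \<phi> (T v)"
      unfolding T_def clinear_sum[OF clinear_act[OF \<phi>]] clinear_scale[OF clinear_act[OF \<phi>]]
      by (intro sum.cong refl) (simp add: act_basis[OF ub _ \<phi>] complex_vector.scale_sum_right scaleC_scaleC)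
    finally show ?thesis .
  qed
  obtain z w where w: "w \<in> V" "w \<noteq> 0" "T w = z *\<^sub>C w"
    using eigenvector_exists[OF T V(2) TV x] by blast
  \<comment> \<open>An eigenspace of a colinear map is a subcomodule, hence all of the simple
    \<open>V\<close>.\<close>
  have "subcomodule {v \<in> V. T v = z *\<^sub>C v}"
    unfolding subcomodule_def
  proof (intro conjI allI impI ballI)
    show "csubspace {v \<in> V. T v = z *\<^sub>C v}"
      using subcomoduleD(1)[OF V(1)]
      by (simp add: complex_vector.subspace_def clinear_add[OF T] clinear_scale[OF T] clinear_zero[OF T]
          scaleC_add_right scaleC_scaleC mult.commute)
    fix \<phi> :: "'h \<Rightarrow> complex" and v assume "clinear \<phi>" "v \<in> {v \<in> V. T v = z *\<^sub>C v}"
    then show "act \<phi> v \<in> {v \<in> V. T v = z *\<^sub>C v}"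
      using subcomoduleD(2)[OF V(1)] by (simp add: T_act clinear_scale[OF clinear_act])
  qed
  moreover have "w \<in> {v \<in> V. T v = z *\<^sub>C v}" using w by simp
  ultimately have "V = {v \<in> V. T v = z *\<^sub>C v}" using simple[of "{v \<in> V. T v = z *\<^sub>C v}"] w(2) by blast
  then have Tz: "\<And>v. v \<in> V \<Longrightarrow> T v = z *\<^sub>C v" by blast
  have form: "haar_form v v = z * complex_of_real (\<Sum>j<n. (cmod (\<psi> j v))\<^sup>2)" if v: "v \<in> V" for v
  proof -
    have coeff: "haar_form (e j) v = z * \<psi> j v" if j: "j < n" for j
    proof -
      have "\<psi> j (T v) = (\<Sum>i<n. haar_form (e i) v * (if i = j then 1 else 0))"
        unfolding T_def clinear_sum[OF d(2)[OF j]]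
        by (intro sum.cong refl) (simp add: clinear_scale[OF d(2)[OF j]] scaleC_complex d(3) j)
      also have "\<dots> = haar_form (e j) v" by (rule sum_delta_mult[OF j])
      finally show ?thesis by (simp add: Tz[OF v] clinear_scale[OF d(2)[OF j]] scaleC_complex)
    qed
    have "haar_form v v = (\<Sum>j<n. cnj (\<psi> j v) * haar_form (e j) v)"
      using haar_form_sum_left[of "\<lambda>j. \<psi> j v" e "{..<n}" v] by (simp only: d(4)[OF v])
    also have "\<dots> = z * complex_of_real (\<Sum>j<n. (cmod (\<psi> j v))\<^sup>2)"
      unfolding sum_distrib_left of_real_sum
      by (intro sum.cong refl) (simp only: lessThan_iff coeff complex_norm_square mult_ac)
    finally show ?thesis .
  qed
  have star_V: "finite_dim (star ` V)"
  proof -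
    obtain B where B: "finite B" "V = cspan B" using V(2) by (auto simp: finite_dim_def)
    have "star y \<in> cspan (star ` B)" if "y \<in> cspan B" for y
      using that
    proof (induction rule: complex_vector.span_induct_alt)
      case base
      then show ?case by (simp add: complex_vector.span_zero)
    next
      case (step c x y)
      then show ?case unfolding star_add star_scaleC
        using step by (intro complex_vector.span_add[OF complex_vector.span_scale[OF complex_vector.span_base]]) auto
    qed
    then show ?thesis
      using B by (intro finite_dimI[OF subcomoduleD(1)[OF subcomodule_star[OF V(1)]], of "star ` B"]) auto
  qed
  obtain m f \<chi> v where ub': "unitary_basis m f \<chi> v (star ` V)"
    using unitary_basis_exists[OF subcomodule_star[OF V(1)] star_V] by blast
  note d' = dual_basisD[OF unitary_basisD(1)[OF ub']]
  have "0 < m"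
  proof (rule ccontr)
    assume "\<not> 0 < m"
    then have "star x = 0" using d'(4)[of "star x"] x(1) by simp
    then show False using star_star[of x] x(2) by simp
  qed
  define c where "c = (\<Sum>j<m. (cmod (\<epsilon> (f j)))\<^sup>2)"
  have c: "0 < c" unfolding c_def by (rule sum_mult_star_basis(2)[OF ub' \<open>0 < m\<close>])
  define s where "s = (\<Sum>j<m. \<Sum>i<n. (cmod (\<psi> i (star (f j))))\<^sup>2)"
  have s: "0 \<le> s" unfolding s_def by (simp add: sum_nonneg)
  have "complex_of_real c = haar (\<Sum>j<m. f j * star (f j))"
    unfolding sum_mult_star_basis(1)[OF ub'] clinear_scale[OF haar_linear] haar_one by (simp add: c_def scaleC_complex)
  also have "\<dots> = (\<Sum>j<m. haar_form (star (f j)) (star (f j)))"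
    unfolding clinear_sum[OF haar_linear] by (simp add: star_star)
  also have "\<dots> = z * complex_of_real s"
    unfolding s_def of_real_sum sum_distrib_left
  proof (intro sum.cong refl)
    fix j assume "j \<in> {..<m}"
    then have "star (f j) \<in> V" using d'(1)[of j] by (auto simp: star_star)
    from form[OF this] show "haar_form (star (f j)) (star (f j)) = (\<Sum>i<n. z * complex_of_real ((cmod (\<psi> i (star (f j))))\<^sup>2))"
      by (simp only: of_real_sum sum_distrib_left)
  qed
  finally have cz: "complex_of_real c = z * complex_of_real s" .
  have "c = Re z * s" using arg_cong[OF cz, of Re] by simp
  then have "0 < Re z" using c s by (metis linorder_not_less mult_nonpos_nonneg)
  moreover have "0 < (\<Sum>j<n. (cmod (\<psi> j x))\<^sup>2)"
  proof (rule ccontr)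
    assume "\<not> 0 < (\<Sum>j<n. (cmod (\<psi> j x))\<^sup>2)"
    moreover have "0 \<le> (\<Sum>j<n. (cmod (\<psi> j x))\<^sup>2)" by (simp add: sum_nonneg)
    ultimately have "(\<Sum>j<n. (cmod (\<psi> j x))\<^sup>2) = 0" by linarith
    then have "\<And>j. j < n \<Longrightarrow> \<psi> j x = 0" by (simp add: sum_nonneg_eq_0_iff)
    then show False using d(4)[OF x(1)] x(2) by simp
  qed
  ultimately show ?thesis unfolding form[OF x(1)] by simp
qed

text \<open>Induction over subcomodules: simple ones are settled, and otherwise \<open>x\<close>
  splits into its parts in a proper subcomodule and in the orthogonal complement, both of which are
  smaller than \<open>V\<close>.\<close>

lemma haar_positive_finite_dim:
  assumes "subcomodule V" "finite B" "V = cspan B" "x \<in> V" "x \<noteq> 0"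
  shows "0 < Re (haar_form x x)"
  using assms
proof (induction "card B" arbitrary: B V x rule: less_induct)
  case less
  have fin: "finite_dim V" using less.prems finite_dimI[OF subcomoduleD(1)[OF less.prems(1)]] by blast
  have IH: "0 < Re (haar_form y y)" if W: "subcomodule W" "W \<subset> V" "y \<in> W" "y \<noteq> 0" for W y
  proof -
    obtain C where "finite C" "W = cspan C" "card C < card B"
      using proper_subspace_smaller[OF subcomoduleD(1)[OF W(1)] W(2) _ less.prems(2)] less.prems(3) by blast
    then show ?thesis using less.hyps W by blast
  qed
  show ?case
  proof (cases "\<exists>W. subcomodule W \<and> W \<subset> V \<and> W \<noteq> {0}")
    case False
    have "V \<noteq> {0}" using less.prems by blast
    then show ?thesis using haar_positive_simple[OF less.prems(1) fin _ _ less.prems(4,5)] False by blast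
  next
    case True
    then obtain W where W: "subcomodule W" "W \<subset> V" "W \<noteq> {0}" by blast
    note WS = subcomoduleD(1)[OF W(1)]
    have finW: "finite_dim W" using finite_dim_subset[OF fin WS] W(2) by blast
    define W' where "W' = {v \<in> V. \<forall>w\<in>W. haar_form w v = 0}"
    have W': "subcomodule W'" unfolding W'_def by (rule subcomodule_orthogonal[OF W(1) finW less.prems(1)])
    obtain w where w: "w \<in> W" "w \<noteq> 0" using W(3) complex_vector.subspace_0[OF WS] by blast
    \<comment> \<open>Positivity on \<open>W\<close> prevents \<open>w\<close> from being orthogonal
      to itself; this makes the complement a proper subcomodule, so that induction applies to
      it.\<close>
    have "w \<notin> W'"
    proof
      assume "w \<in> W'"
      then have "haar_form w w = 0" using w(1) by (simp add: W'_def)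
      then show False using IH[OF W(1,2) w] by simp
    qed
    then have W'V: "W' \<subset> V" using w(1) W(2) by (auto simp: W'_def)
    have ip: "inner_product_on W haar_form"
      unfolding inner_product_on_def clinear_on_def
      using IH[OF W(1,2)] haar_form_sym by (simp add: clinear_add[OF haar_form_linear] clinear_scale[OF haar_form_linear])
    obtain n e where ob: "orthonormal_basis haar_form n e W"
      using orthonormal_basis_exists[OF ip WS finW order_refl] by blast
    note e = orthonormal_basisD[OF ob]
    define k where "k = (\<Sum>i<n. haar_form (e i) x *\<^sub>C e i)"
    have k: "k \<in> W" unfolding k_def
      by (intro complex_vector.subspace_sum complex_vector.subspace_scale WS e(1)) simp
    have ek: "haar_form (e j) (x - k) = 0" if j: "j < n" for j
    proof -
      have "haar_form (e j) k = (\<Sum>i<n. haar_form (e i) x * (if i = j then 1 else 0))"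
        unfolding k_def clinear_sum[OF haar_form_linear] clinear_scale[OF haar_form_linear]
        by (intro sum.cong refl) (use j in \<open>auto simp: e(2) scaleC_complex\<close>)
      also have "\<dots> = haar_form (e j) x" by (rule sum_delta_mult[OF j])
      finally show ?thesis by (simp add: clinear_diff[OF haar_form_linear])
    qed
    have orth: "haar_form y (x - k) = 0" if "y \<in> W" for y
    proof -
      have "haar_form y (x - k) = (\<Sum>j<n. cnj (haar_form (e j) y) * haar_form (e j) (x - k))"
        by (subst e(3)[OF that, symmetric]) (rule haar_form_sum_left)
      then show ?thesis by (simp add: ek)
    qed
    have z: "x - k \<in> W'"
      using orth less.prems(4) k W(2) complex_vector.subspace_diff[OF subcomoduleD(1)[OF less.prems(1)]]
      by (auto simp: W'_def)
    have "haar_form (x - k) k = 0" using orth[OF k] haar_form_sym[of k "x - k"] by simp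
    then have "haar_form (k + (x - k)) (k + (x - k)) = haar_form k k + haar_form (x - k) (x - k)"
      unfolding haar_form_add_left clinear_add[OF haar_form_linear] using orth[OF k] by simp
    then have sum: "Re (haar_form x x) = Re (haar_form k k) + Re (haar_form (x - k) (x - k))" by simp
    have k0: "0 \<le> Re (haar_form k k)" using IH[OF W(1,2) k] by (cases "k = 0") (auto simp: clinear_zero[OF haar_linear])
    have z0: "0 \<le> Re (haar_form (x - k) (x - k))"
      using IH[OF W' W'V z] by (cases "x - k = 0") (auto simp: clinear_zero[OF haar_linear])
    show ?thesis
    proof (cases "k = 0")
      case True
      then have "x - k \<noteq> 0" using less.prems(5) by simp
      then show ?thesis using IH[OF W' W'V z] sum k0 by linarith
    next
      case False
      then show ?thesis using IH[OF W(1,2) k] sum z0 by linarith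
    qed
  qed
qed

lemma haar_positive: "x \<noteq> 0 \<Longrightarrow> 0 < Re (haar_form x x)"
proof -
  assume x: "x \<noteq> 0"
  obtain V where V: "subcomodule V" "finite_dim V" "{x} \<subseteq> V" using finite_dim_subcomodule[of "{x}"] by auto
  then obtain B where "finite B" "V = cspan B" by (auto simp: finite_dim_def)
  then show ?thesis using haar_positive_finite_dim[OF V(1) _ _ _ x] V(3) by blast
qed

end

section \<open>Orthogonal projections onto relative Hopf modules\<close>

text \<open>The n-th power of a vector space; padding by zeros keeps all powers in one type.\<close>

definition hvec :: "nat \<Rightarrow> (nat \<Rightarrow> 'a::complex_vector) set"
  where "hvec n = {f. \<forall>i\<ge>n. f i = 0}"

lemma subspace_hvec: "csubspace (hvec n)"
  by (simp add: complex_vector.subspace_def hvec_def scaleC_fun_def)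

lemma sum_fun_apply: "(\<Sum>i\<in>I. f i) x = (\<Sum>i\<in>I. f i x)"
  by (induction I rule: infinite_finite_induct) simp_all

lemma finite_dim_hvec_components:
  assumes "finite_dim C"
  shows "finite_dim {f \<in> hvec n. \<forall>i. f i \<in> C}"
proof -
  obtain m c \<psi> where dc: "dual_basis m c \<psi> C" using finite_dim_dual_basis[OF assms] by blast
  note d = dual_basisD[OF dc]
  let ?s = "\<lambda>(r, s). (\<lambda>i. if i = r then c s else 0)"
  show ?thesis
  proof (rule finite_dimI)
    show "csubspace {f \<in> hvec n. \<forall>i. f i \<in> C}"
      using finite_dim_subspace[OF assms] by (simp add: complex_vector.subspace_def hvec_def scaleC_fun_def)
    show "finite (?s ` ({..<n} \<times> {..<m}))" by simp
    show "{f \<in> hvec n. \<forall>i. f i \<in> C} \<subseteq> cspan (?s ` ({..<n} \<times> {..<m}))"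
    proof
      fix f assume f: "f \<in> {f \<in> hvec n. \<forall>i. f i \<in> C}"
      have "f = (\<Sum>r<n. \<Sum>s<m. \<psi> s (f r) *\<^sub>C ?s (r, s))"
      proof
        fix i
        have "(\<Sum>r<n. \<Sum>s<m. \<psi> s (f r) *\<^sub>C ?s (r, s)) i = (\<Sum>r<n. \<Sum>s<m. \<psi> s (f r) *\<^sub>C (if i = r then c s else 0))"
          by (simp only: sum_fun_apply scaleC_fun_def case_prod_conv)
        also have "\<dots> = (\<Sum>r<n. if i = r then f r else 0)"
          using f by (intro sum.cong refl) (simp add: d(4))
        also have "\<dots> = f i" using f by (auto simp: hvec_def)
        finally show "f i = (\<Sum>r<n. \<Sum>s<m. \<psi> s (f r) *\<^sub>C ?s (r, s)) i" ..
      qed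
      also have "\<dots> \<in> cspan (?s ` ({..<n} \<times> {..<m}))"
        by (intro complex_vector.span_sum complex_vector.span_scale complex_vector.span_base) auto
      finally show "f \<in> cspan (?s ` ({..<n} \<times> {..<m}))" .
    qed
  qed
qed

section \<open>Projections within the powers of \<open>H\<close>\<close>

context cqg_algebra
begin

lemma inner_product_haar_form: "inner_product_on UNIV haar_form"
  unfolding inner_product_on_def clinear_on_def
  using haar_positive haar_form_sym by (simp add: clinear_add[OF haar_form_linear] clinear_scale[OF haar_form_linear])

text \<open>The counterpart of \<open>haar_form_invariant\<close> on the other side of
  \<open>\<Delta>\<close>. Here \<open>u\<close> need not be unitary, so the matrix of the u_ij^* is
  inverted by applying \<open>S\<close> to its entries.\<close>

lemma haar_form_left_invariant:
  assumes u: "corep n u" and l: "l < n" and j: "j < n"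
  shows "act (haar_form (u l j)) y = (\<Sum>i<n. haar_form (u i j) y *\<^sub>C S (star (u l i)))"
proof -
  obtain m a b where y: "\<Delta> y = (\<Sum>r<(m::nat). a r \<otimes> b r)" by (rule tensor_expand)
  have inv: "haar_form (u i j) y *\<^sub>C 1 = (\<Sum>k<n. \<Sum>r<m. haar_form (u k j) (b r) *\<^sub>C (star (u i k) * a r))"
    if i: "i < n" for i
    unfolding haar_left_invariant[symmetric] act_def comult_mult_sum[OF comult_star_sum[OF corepD(1)[OF u i j]] y]
      clinear_sum[OF clinear_slice2[OF haar_linear]] slice2_tensor[OF haar_linear] ..
  have "(\<Sum>i<n. haar_form (u i j) y *\<^sub>C S (star (u l i))) = (\<Sum>i<n. S (star (u l i)) * (haar_form (u i j) y *\<^sub>C 1))"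
    by (simp add: mult_scaleC_right)
  also have "\<dots> = (\<Sum>i<n. \<Sum>k<n. \<Sum>r<m. haar_form (u k j) (b r) *\<^sub>C (S (star (u l i)) * star (u i k) * a r))"
    by (intro sum.cong refl) (simp add: inv sum_distrib_left mult_scaleC_right mult.assoc)
  also have "\<dots> = (\<Sum>k<n. \<Sum>i<n. \<Sum>r<m. haar_form (u k j) (b r) *\<^sub>C (S (star (u l i)) * star (u i k) * a r))"
    by (rule sum.swap)
  also have "\<dots> = (\<Sum>k<n. \<Sum>r<m. haar_form (u k j) (b r) *\<^sub>C ((\<Sum>i<n. S (star (u l i)) * star (u i k)) * a r))"
    unfolding sum_distrib_right complex_vector.scale_sum_right by (intro sum.cong refl sum.swap)
  also have "\<dots> = (\<Sum>k<n. (if l = k then 1 else 0) *\<^sub>C (\<Sum>r<m. haar_form (u k j) (b r) *\<^sub>C a r))"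
    by (intro sum.cong refl) (simp add: corep_antipode(1)[OF corep_star[OF u]] l scaleC_one)
  also have "\<dots> = (\<Sum>r<m. haar_form (u l j) (b r) *\<^sub>C a r)" by (rule sum_delta_scaleC[OF l])
  also have "\<dots> = act (haar_form (u l j)) y" by (rule act_sum[OF haar_form_linear y, symmetric])
  finally show ?thesis ..
qed

text \<open>
  The orthogonal projection onto a finite-dimensional subcoalgebra is left colinear, hence of the form
  \<open>act \<theta>\<close>; in particular it preserves every subcomodule.
\<close>

lemma coefficient_projection:
  assumes "finite F"
  obtains C \<theta> where "finite_dim C" "F \<subseteq> C" "clinear \<theta>" "\<And>x. act \<theta> x \<in> C" "\<And>x. x \<in> C \<Longrightarrow> act \<theta> x = x"
    "\<And>x y. haar_form (act \<theta> x) y = haar_form x (act \<theta> y)"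
proof -
  obtain V where V: "subcomodule V" "finite_dim V" "F \<subseteq> V" using finite_dim_subcomodule[OF assms] by blast
  obtain n e \<psi> where de: "dual_basis n e \<psi> V" using finite_dim_dual_basis[OF V(2)] by blast
  obtain u where u: "corep n u" "\<And>j. j < n \<Longrightarrow> \<Delta> (e j) = (\<Sum>i<n. e i \<otimes> u i j)"
    using corep_of_subcomodule[OF V(1) de] by blast
  define U where "U = (\<lambda>(i, j). u i j) ` ({..<n} \<times> {..<n})"
  define C where "C = cspan U"
  have uU: "u i j \<in> U" if "i < n" "j < n" for i j using that by (force simp: U_def)
  have finC: "finite_dim C" unfolding C_def by (rule finite_dimI[of _ U]) (auto simp: U_def)
  have "V \<subseteq> C"
  proof
    fix v assume v: "v \<in> V"
    have "e j \<in> C" if j: "j < n" for j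
    proof -
      have "e j = (\<Sum>i<n. \<epsilon> (e i) *\<^sub>C u i j)" by (rule corep_expand[OF de u(2) j])
      also have "\<dots> \<in> C"
        unfolding C_def
        by (intro complex_vector.span_sum complex_vector.span_scale complex_vector.span_base uU) (use j in auto)
      finally show ?thesis .
    qed
    then have "(\<Sum>j<n. \<psi> j v *\<^sub>C e j) \<in> C"
      unfolding C_def by (intro complex_vector.span_sum complex_vector.span_scale) auto
    then show "v \<in> C" by (simp only: dual_basisD(4)[OF de v])
  qed
  note UN = complex_vector.subspace_UNIV
  obtain m f where ob: "orthonormal_basis haar_form m f C"
    using orthonormal_basis_exists[OF inner_product_haar_form UN finC subset_UNIV] by blast
  note f = orthonormal_basisD[OF ob]
  define p where "p y = (\<Sum>r<m. haar_form (f r) y *\<^sub>C f r)" for y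
  \<comment> \<open>A left colinear \<open>p\<close> satisfies p(x) = \<epsilon>(p(x_2)) x_1, which
    dictates this choice.\<close>
  define \<theta> where "\<theta> y = \<epsilon> (p y)" for y
  have p: "clinear p" unfolding p_def by (rule clinear_sum_scale) (rule haar_form_linear)
  have \<theta>: "clinear \<theta>" unfolding \<theta>_def by (rule clinear_compose[OF counit_linear p])
  have pC: "p y \<in> C" for y
    unfolding p_def using f(1)
    by (intro complex_vector.subspace_sum complex_vector.subspace_scale finite_dim_subspace[OF finC]) auto
  have p_id: "p y = y" if "y \<in> C" for y unfolding p_def by (rule f(3)[OF that])
  have orth: "haar_form c (y - p y) = 0" if "c \<in> C" for c y
    unfolding p_def by (rule orthonormal_basis_orthogonal[OF inner_product_haar_form UN subset_UNIV ob UNIV_I that])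
  \<comment> \<open>On the matrix coefficients \<theta> agrees with \<open>\<epsilon>\<close>, so
    \<open>act \<theta>\<close> reproduces them.\<close>
  have act_C: "act \<theta> y = y" if "y \<in> C" for y
  proof (rule complex_vector_pair.linear_eq_on_span[OF clinear_act[OF \<theta>] clinear_ident])
    show "y \<in> cspan U" using that by (simp add: C_def)
    fix x assume "x \<in> U"
    then obtain i j where ij: "i < n" "j < n" "x = u i j" by (auto simp: U_def)
    have "act \<theta> x = (\<Sum>k<n. \<theta> (u k j) *\<^sub>C u i k)"
      unfolding ij(3) by (rule act_sum[OF \<theta> corepD(1)[OF u(1) ij(1,2)]])
    also have "\<dots> = (\<Sum>k<n. (if k = j then 1 else 0) *\<^sub>C u i k)"
    proof (intro sum.cong refl arg_cong2[where f = scaleC])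
      fix k assume "k \<in> {..<n}"
      then show "\<theta> (u k j) = (if k = j then 1 else 0)"
        using p_id[of "u k j"] uU[of k j] ij corepD(2)[OF u(1)] by (simp add: \<theta>_def C_def complex_vector.span_base)
    qed
    also have "\<dots> = x" unfolding ij(3) by (rule sum_delta_scaleC[OF ij(2)])
    finally show "act \<theta> x = x" .
  qed
  \<comment> \<open>By left invariance, orthogonality to all u_ij passes from \<open>z\<close> to
    every right leg of \<open>\<Delta> z\<close>, and \<theta> kills what is orthogonal to
    \<open>C\<close>.\<close>
  have act_orth: "act \<theta> z = 0" if z: "\<And>c. c \<in> C \<Longrightarrow> haar_form c z = 0" for z
  proof (rule functionals_separate)
    fix \<phi> :: "'h \<Rightarrow> complex" assume \<phi>: "clinear \<phi>"
    have "haar_form (u l j) (slice1 \<phi> (\<Delta> z)) = 0" if "l < n" "j < n" for l j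
    proof -
      have "act (haar_form (u l j)) z = 0"
        unfolding haar_form_left_invariant[OF u(1) that]
        by (intro sum.neutral) (use that in \<open>simp add: z C_def complex_vector.span_base uU\<close>)
      then show ?thesis
        unfolding slice_swap[OF haar_form_linear \<phi>] by (simp add: act_def clinear_zero[OF \<phi>])
    qed
    then have *: "haar_form (slice1 \<phi> (\<Delta> z)) c = 0" if "c \<in> U" for c
      using that haar_form_sym[of c "slice1 \<phi> (\<Delta> z)"] by (force simp: U_def)
    have **: "haar_form (slice1 \<phi> (\<Delta> z)) c = 0" if "c \<in> C" for c
    proof (rule complex_vector_pair.linear_eq_0_on_span[OF haar_form_linear])
      show "c \<in> cspan U" using that by (simp add: C_def)
    qed (rule *)
    have "slice1 \<phi> (\<Delta> z) \<in> {w. p w = 0}"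
      using ** haar_form_sym[of "slice1 \<phi> (\<Delta> z)"] f(1) by (simp add: p_def flip: haar_form_sym[of "slice1 \<phi> (\<Delta> z)"])
    then have "\<theta> (slice1 \<phi> (\<Delta> z)) = 0" by (simp add: \<theta>_def clinear_zero[OF counit_linear])
    then show "\<phi> (act \<theta> z) = \<phi> 0"
      unfolding act_def slice_swap[OF \<theta> \<phi>] by (simp add: clinear_zero[OF \<phi>])
  qed
  have act_p: "act \<theta> y = p y" for y
  proof -
    have "act \<theta> (p y) + act \<theta> (y - p y) = act \<theta> y" by (simp add: clinear_diff[OF clinear_act[OF \<theta>]])
    then show ?thesis using act_C[OF pC] act_orth[OF orth] by simp
  qed
  have "haar_form (p x) y = haar_form x (p y)" for x y
    unfolding p_def haar_form_sum_left clinear_sum[OF haar_form_linear] clinear_scale[OF haar_form_linear]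
    by (intro sum.cong refl) (simp add: haar_form_sym scaleC_complex mult.commute)
  then show thesis
    using finC \<open>V \<subseteq> C\<close> V(3) \<theta> pC act_C that[of C \<theta>] by (simp add: act_p)
qed

definition vform :: "nat \<Rightarrow> (nat \<Rightarrow> 'h) \<Rightarrow> (nat \<Rightarrow> 'h) \<Rightarrow> complex"
  where "vform n x y = (\<Sum>i<n. haar_form (x i) (y i))"

lemma vform_linear: "clinear (vform n x)"
  by (intro clinearI) (simp_all add: vform_def scaleC_fun_def clinear_add[OF haar_form_linear]
      clinear_scale[OF haar_form_linear] sum.distrib complex_vector.scale_sum_right)

lemma vform_sym: "cnj (vform n x y) = vform n y x"
  by (simp add: vform_def haar_form_sym)

lemma inner_product_vform: "inner_product_on (hvec n) (vform n)"
  unfolding inner_product_on_def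
proof (intro conjI ballI impI)
  fix x y :: "nat \<Rightarrow> 'h"
  show "clinear_on (hvec n) (vform n x)"
    by (simp add: clinear_on_def clinear_add[OF vform_linear] clinear_scale[OF vform_linear])
  show "vform n x y = cnj (vform n y x)" by (simp add: vform_sym)
  assume x: "x \<in> hvec n" "x \<noteq> 0"
  have "\<exists>i<n. x i \<noteq> 0"
  proof (rule ccontr)
    assume "\<not> (\<exists>i<n. x i \<noteq> 0)"
    then have "x = 0" using x(1) by (auto simp: fun_eq_iff hvec_def not_less)
    then show False using x(2) by simp
  qed
  then obtain i where i: "i < n" "x i \<noteq> 0" by blast
  have nonneg: "0 \<le> Re (haar_form y y)" for y
    using haar_positive[of y] by (cases "y = 0") (auto simp: clinear_zero[OF haar_linear])
  have "0 < (\<Sum>i<n. Re (haar_form (x i) (x i)))"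
    using i haar_positive[OF i(2)] nonneg by (intro sum_pos2[of _ i]) auto
  then show "0 < Re (vform n x x)" by (simp add: vform_def)
qed

text \<open>Subcomodules of the n-th power of \<open>H\<close>, with the coaction taken
  entrywise.\<close>

definition vact_stable :: "nat \<Rightarrow> (nat \<Rightarrow> 'h) set \<Rightarrow> bool"
  where "vact_stable n X \<longleftrightarrow> csubspace X \<and> X \<subseteq> hvec n \<and> (\<forall>\<phi>. clinear \<phi> \<longrightarrow> (\<forall>x\<in>X. (\<lambda>i. act \<phi> (x i)) \<in> X))"

text \<open>The orthogonal projection onto \<open>X\<close>. A choice is made because
  \<open>X\<close> may be infinite-dimensional; that a suitable \<open>k\<close> exists is shown in
  \<open>vproj\<close>, its uniqueness in \<open>vproj_unique\<close>.\<close>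

definition vproj :: "nat \<Rightarrow> (nat \<Rightarrow> 'h) set \<Rightarrow> (nat \<Rightarrow> 'h) \<Rightarrow> nat \<Rightarrow> 'h"
  where "vproj n X x = (SOME k. k \<in> X \<and> (\<forall>y\<in>X. vform n y (x - k) = 0))"

text \<open>Project onto the finite-dimensional part \<open>X0\<close> of \<open>X\<close> with
  entries in \<open>C\<close>. The error has entries in \<open>C\<close>, so it is fixed by
  \<open>act \<theta>\<close>; moving this self-adjoint map onto a test vector from \<open>X\<close>
  lands in \<open>X0\<close>, where the error is orthogonal. That \<open>k\<close> has entries in
  \<open>C\<close> is used again in \<open>expand_in_module\<close>.\<close>

lemma vproj_exists:
  assumes X: "vact_stable n X" and C: "finite_dim C" "clinear \<theta>" "\<And>x. act \<theta> x \<in> C" "\<And>x. x \<in> C \<Longrightarrow> act \<theta> x = x"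
    "\<And>x y. haar_form (act \<theta> x) y = haar_form x (act \<theta> y)" and x: "x \<in> hvec n" "\<And>i. x i \<in> C"
  obtains k where "k \<in> X" "\<And>i. k i \<in> C" "\<And>y. y \<in> X \<Longrightarrow> vform n y (x - k) = 0"
proof -
  have XS: "csubspace X" "X \<subseteq> hvec n" using X by (auto simp: vact_stable_def)
  note CS = finite_dim_subspace[OF C(1)]
  define X0 where "X0 = {k \<in> X. \<forall>i. k i \<in> C}"
  have X0: "csubspace X0"
    using XS(1) CS by (simp add: X0_def complex_vector.subspace_def scaleC_fun_def)
  have "finite_dim X0"
    by (rule finite_dim_subset[OF finite_dim_hvec_components[OF C(1), of n] X0]) (use XS(2) in \<open>auto simp: X0_def\<close>)
  moreover have X0V: "X0 \<subseteq> hvec n" using XS(2) by (auto simp: X0_def)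
  ultimately obtain m g where ob: "orthonormal_basis (vform n) m g X0"
    using orthonormal_basis_exists[OF inner_product_vform subspace_hvec] by blast
  define k where "k = (\<Sum>s<m. vform n (g s) x *\<^sub>C g s)"
  have k: "k \<in> X0"
    unfolding k_def using orthonormal_basisD(1)[OF ob]
    by (intro complex_vector.subspace_sum complex_vector.subspace_scale X0) auto
  have xk: "act \<theta> ((x - k) i) = (x - k) i" for i
    using complex_vector.subspace_diff[OF CS x(2)] k C(4) by (auto simp: X0_def)
  have "vform n y (x - k) = 0" if y: "y \<in> X" for y
  proof -
    have "(\<lambda>i. act \<theta> (y i)) \<in> X0"
      using X y C(2,3) by (auto simp: X0_def vact_stable_def)
    from orthonormal_basis_orthogonal[OF inner_product_vform subspace_hvec X0V ob x(1) this]
    have "vform n (\<lambda>i. act \<theta> (y i)) (x - k) = 0" by (simp only: k_def)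
    then show ?thesis by (simp only: vform_def C(5) xk)
  qed
  with k show thesis using that by (auto simp: X0_def)
qed

lemma vproj_unique:
  assumes X: "vact_stable n X" and "k \<in> X" "\<And>y. y \<in> X \<Longrightarrow> vform n y (x - k) = 0"
    and "k' \<in> X" "\<And>y. y \<in> X \<Longrightarrow> vform n y (x - k') = 0"
  shows "k = k'"
proof (rule ccontr)
  assume "k \<noteq> k'"
  have "k - k' \<in> X"
    using X assms(2,4) complex_vector.subspace_diff[of X] by (auto simp: vact_stable_def)
  moreover from this have "k - k' \<in> hvec n" using X by (auto simp: vact_stable_def)
  moreover have "vform n (k - k') (k - k') = vform n (k - k') (x - k') - vform n (k - k') (x - k)"
    by (simp add: clinear_diff[OF vform_linear])
  ultimately show False
    using inner_product_onD(6)[OF inner_product_vform subspace_hvec, of "k - k'" n] \<open>k \<noteq> k'\<close> assms(3,5) by simp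
qed

lemma vproj:
  assumes X: "vact_stable n X" and x: "x \<in> hvec n"
  shows "vproj n X x \<in> X" "y \<in> X \<Longrightarrow> vform n y (x - vproj n X x) = 0"
proof -
  obtain C \<theta> where C: "finite_dim C" "insert 0 (x ` {..<n}) \<subseteq> C" "clinear \<theta>" "\<And>x. act \<theta> x \<in> C"
    "\<And>x. x \<in> C \<Longrightarrow> act \<theta> x = x" "\<And>x y. haar_form (act \<theta> x) y = haar_form x (act \<theta> y)"
    by (rule coefficient_projection[of "insert 0 (x ` {..<n})"]) auto
  have xC: "x i \<in> C" for i
    using C(2) x by (cases "i < n") (auto simp: hvec_def)
  obtain k where "k \<in> X" "\<And>y. y \<in> X \<Longrightarrow> vform n y (x - k) = 0"
    by (rule vproj_exists[OF X C(1,3-6) x xC]) auto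
  then have "\<exists>k. k \<in> X \<and> (\<forall>y\<in>X. vform n y (x - k) = 0)" by blast
  then have "vproj n X x \<in> X \<and> (\<forall>y\<in>X. vform n y (x - vproj n X x) = 0)"
    unfolding vproj_def by (rule someI_ex)
  then show "vproj n X x \<in> X" "y \<in> X \<Longrightarrow> vform n y (x - vproj n X x) = 0" by auto
qed

lemma vproj_eqI:
  assumes "vact_stable n X" "x \<in> hvec n" "k \<in> X" "\<And>y. y \<in> X \<Longrightarrow> vform n y (x - k) = 0"
  shows "vproj n X x = k"
  using vproj_unique[OF assms(1) vproj[OF assms(1,2)] assms(3,4)] by simp

lemma vproj_add:
  assumes X: "vact_stable n X" and "x \<in> hvec n" "x' \<in> hvec n"
  shows "vproj n X (x + x') = vproj n X x + vproj n X x'"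
proof (rule vproj_eqI[OF X])
  show "x + x' \<in> hvec n" by (rule complex_vector.subspace_add[OF subspace_hvec assms(2,3)])
  show "vproj n X x + vproj n X x' \<in> X"
    using X vproj(1)[OF X] assms(2,3) complex_vector.subspace_add[of X] by (auto simp: vact_stable_def)
  fix y assume y: "y \<in> X"
  have "x + x' - (vproj n X x + vproj n X x') = (x - vproj n X x) + (x' - vproj n X x')" by simp
  then show "vform n y (x + x' - (vproj n X x + vproj n X x')) = 0"
    by (simp only: clinear_add[OF vform_linear] vproj(2)[OF X assms(2) y] vproj(2)[OF X assms(3) y]) simp
qed

text \<open>Left multiplication by \<open>a\<close> has left multiplication by \<open>star a\<close>
  as its adjoint, so it preserves the orthogonal complement of an \<open>X\<close> stable under
  \<open>star a\<close>.\<close>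

lemma vproj_mult:
  assumes X: "vact_stable n X" and x: "x \<in> hvec n"
    and a: "\<And>y. y \<in> X \<Longrightarrow> (\<lambda>i. a * y i) \<in> X" "\<And>y. y \<in> X \<Longrightarrow> (\<lambda>i. star a * y i) \<in> X"
  shows "vproj n X (\<lambda>i. a * x i) = (\<lambda>i. a * vproj n X x i)"
proof (rule vproj_eqI[OF X])
  show "(\<lambda>i. a * x i) \<in> hvec n" using x by (simp add: hvec_def)
  show "(\<lambda>i. a * vproj n X x i) \<in> X" by (rule a(1)[OF vproj(1)[OF X x]])
  fix y assume y: "y \<in> X"
  have "vform n y ((\<lambda>i. a * x i) - (\<lambda>i. a * vproj n X x i)) = vform n (\<lambda>i. star a * y i) (x - vproj n X x)"
    by (simp add: vform_def star_mult star_star mult.assoc right_diff_distrib)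
  then show "vform n y ((\<lambda>i. a * x i) - (\<lambda>i. a * vproj n X x i)) = 0"
    by (simp only: vproj(2)[OF X x a(2)[OF y]])
qed

end

section \<open>Local projectivity over a coideal *-subalgebra\<close>

definition linear_functional :: "'r::ring_1 set \<Rightarrow> ('r \<Rightarrow> 'k \<Rightarrow> 'k) \<Rightarrow> ('k::ab_group_add \<Rightarrow> 'r) \<Rightarrow> bool"
  where "linear_functional A l s \<longleftrightarrow>
    (\<forall>x y. s (x + y) = s x + s y) \<and> (\<forall>a\<in>A. \<forall>x. s (l a x) = a * s x) \<and> (\<forall>x. s x \<in> A)"

lemma linear_functionalI:
  assumes "\<And>x y. s (x + y) = s x + s y" "\<And>a x. a \<in> A \<Longrightarrow> s (l a x) = a * s x" "\<And>x. s x \<in> A"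
  shows "linear_functional A l s"
  using assms by (simp add: linear_functional_def)

lemma linear_functionalD:
  assumes "linear_functional A l s"
  shows "s (x + y) = s x + s y" "a \<in> A \<Longrightarrow> s (l a x) = a * s x" "s x \<in> A" "s 0 = 0" "s (x - y) = s x - s y"
proof -
  show add: "s (x + y) = s x + s y" for x y using assms by (simp add: linear_functional_def)
  show "a \<in> A \<Longrightarrow> s (l a x) = a * s x" "s x \<in> A" using assms by (simp_all add: linear_functional_def)
  show "s 0 = 0" using add[of 0 0] by simp
  show "s (x - y) = s x - s y" using add[of "x - y" y] by (simp add: algebra_simps)
qed

locale cqg_coideal = cqg_algebra \<Delta> \<epsilon> S star
  for \<Delta> :: "'h::complex_algebra_1 \<Rightarrow> ('h, 'h) ctensor" and \<epsilon> S star +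
  fixes A :: "'h set"
  assumes coideal: "coideal_star_subalgebra \<Delta> star A"
begin

section \<open>Column modules over the coideal subalgebra\<close>

lemma subspace_A: "csubspace A" and one_A: "1 \<in> A"
  and mult_A: "x \<in> A \<Longrightarrow> y \<in> A \<Longrightarrow> x * y \<in> A" and star_A: "x \<in> A \<Longrightarrow> star x \<in> A"
  using coideal by (auto simp: coideal_star_subalgebra_def)

lemma subcomodule_A: "subcomodule A"
proof -
  have "\<Delta> v \<in> tensor_subspace A UNIV" if "v \<in> A" for v
    using coideal that by (auto simp: coideal_star_subalgebra_def)
  then show ?thesis
    by (simp add: subcomodule_def act_def subspace_A slice2_tensor_subspace[OF subspace_A])
qed

lemmas closed_A = complex_vector.subspace_0[OF subspace_A] complex_vector.subspace_add[OF subspace_A]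
  complex_vector.subspace_diff[OF subspace_A] complex_vector.subspace_scale[OF subspace_A]
  complex_vector.subspace_sum[OF subspace_A] mult_A star_A one_A

text \<open>
  The free \<open>A\<close>-module on the columns of \<open>u\<close>.  As a Hopf module it is \<open>A \<otimes> V\<close> with diagonal coaction,
  for \<open>V\<close> the comodule of \<open>u\<close>, embedded into \<open>H\<^sup>n\<close> so that the coaction becomes componentwise.
\<close>

definition column_module :: "nat \<Rightarrow> (nat \<Rightarrow> nat \<Rightarrow> 'h) \<Rightarrow> (nat \<Rightarrow> 'h) set"
  where "column_module n u = {f. \<exists>a. (\<forall>j<n. a j \<in> A) \<and> f = (\<lambda>i. if i < n then \<Sum>j<n. a j * u i j else 0)}"

lemma column_moduleI:
  "(\<And>j. j < n \<Longrightarrow> a j \<in> A) \<Longrightarrow> (\<And>i. f i = (if i < n then \<Sum>j<n. a j * u i j else 0)) \<Longrightarrow> f \<in> column_module n u"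
  by (auto simp: column_module_def)

lemma column_module_mult:
  assumes "a \<in> A" "f \<in> column_module n u"
  shows "(\<lambda>i. a * f i) \<in> column_module n u"
proof -
  obtain b where "\<forall>j<n. b j \<in> A" "f = (\<lambda>i. if i < n then \<Sum>j<n. b j * u i j else 0)"
    using assms(2) by (auto simp: column_module_def)
  then show ?thesis
    by (intro column_moduleI[of n "\<lambda>j. a * b j"]) (auto simp: closed_A assms(1) sum_distrib_left mult.assoc)
qed

text \<open>The coaction is diagonal on a column with coefficient \<open>a\<close>: the new
  coefficients are slices of \<open>a\<close>, which stay in \<open>A\<close> when \<open>a\<close>
  is in \<open>A\<close>.\<close>

lemma act_mult_corep:
  assumes "corep n u" "i < n" "j < n" "clinear \<phi>"
  shows "act \<phi> (a * u i j) = (\<Sum>k<n. act (\<lambda>z. \<phi> (z * u k j)) a * u i k)"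
proof -
  obtain m b c where a: "\<Delta> a = (\<Sum>r<(m::nat). b r \<otimes> c r)" by (rule tensor_expand)
  have lin: "clinear (\<lambda>z. \<phi> (z * u k j))" for k
    using assms(4) by (intro clinearI) (simp_all add: distrib_right mult_scaleC_left clinear_add clinear_scale)
  have "act \<phi> (a * u i j) = (\<Sum>r<m. \<Sum>k<n. \<phi> (c r * u k j) *\<^sub>C (b r * u i k))"
    unfolding act_def comult_mult_sum[OF a corepD(1)[OF assms(1-3)]] clinear_sum[OF clinear_slice2[OF assms(4)]]
      slice2_tensor[OF assms(4)] ..
  also have "\<dots> = (\<Sum>k<n. act (\<lambda>z. \<phi> (z * u k j)) a * u i k)"
    unfolding act_sum[OF lin a] mult_sum_scale by (rule sum.swap)
  finally show ?thesis .
qed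

lemma column_module_stable:
  assumes u: "corep n u"
  shows "vact_stable n (column_module n u)"
  unfolding vact_stable_def
proof (intro conjI allI impI ballI)
  show "csubspace (column_module n u)"
  proof (rule complex_vector.subspaceI)
    show "0 \<in> column_module n u" by (rule column_moduleI[of _ "\<lambda>_. 0"]) (simp_all add: closed_A)
    fix f g c assume "f \<in> column_module n u" "g \<in> column_module n u"
    then obtain a b where "\<forall>j<n. a j \<in> A" "f = (\<lambda>i. if i < n then \<Sum>j<n. a j * u i j else 0)"
      "\<forall>j<n. b j \<in> A" "g = (\<lambda>i. if i < n then \<Sum>j<n. b j * u i j else 0)"
      unfolding column_module_def by blast
    then show "f + g \<in> column_module n u" "c *\<^sub>C f \<in> column_module n u"
      by (intro column_moduleI[of _ "\<lambda>j. a j + b j"] column_moduleI[of _ "\<lambda>j. c *\<^sub>C a j"];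
          auto simp: closed_A distrib_right sum.distrib scaleC_fun_def mult_scaleC_left complex_vector.scale_sum_right)+
  qed
  show "column_module n u \<subseteq> hvec n" by (auto simp: column_module_def hvec_def)
  fix \<phi> :: "'h \<Rightarrow> complex" and f assume \<phi>: "clinear \<phi>" and "f \<in> column_module n u"
  then obtain a where a: "\<forall>j<n. a j \<in> A" "f = (\<lambda>i. if i < n then \<Sum>j<n. a j * u i j else 0)"
    unfolding column_module_def by blast
  have lin: "clinear (\<lambda>z. \<phi> (z * y))" for y
    using \<phi> by (intro clinearI) (simp_all add: distrib_right mult_scaleC_left clinear_add clinear_scale)
  show "(\<lambda>i. act \<phi> (f i)) \<in> column_module n u"
  proof (rule column_moduleI[of _ "\<lambda>k. \<Sum>j<n. act (\<lambda>z. \<phi> (z * u k j)) (a j)"])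
    show "(\<Sum>j<n. act (\<lambda>z. \<phi> (z * u k j)) (a j)) \<in> A" for k
      by (intro closed_A subcomoduleD(2)[OF subcomodule_A lin]) (use a(1) in auto)
    fix i
    show "act \<phi> (f i) = (if i < n then \<Sum>k<n. (\<Sum>j<n. act (\<lambda>z. \<phi> (z * u k j)) (a j)) * u i k else 0)"
    proof (cases "i < n")
      case True
      then have "act \<phi> (f i) = (\<Sum>j<n. \<Sum>k<n. act (\<lambda>z. \<phi> (z * u k j)) (a j) * u i k)"
        unfolding a(2) by (simp add: clinear_sum[OF clinear_act[OF \<phi>]] act_mult_corep[OF u True _ \<phi>])
      also have "\<dots> = (\<Sum>k<n. (\<Sum>j<n. act (\<lambda>z. \<phi> (z * u k j)) (a j)) * u i k)"
        unfolding sum_distrib_right by (rule sum.swap)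
      finally show ?thesis using True by simp
    qed (simp add: a(2) clinear_zero[OF clinear_act[OF \<phi>]])
  qed
qed

lemma vproj_column_module_mult:
  assumes "corep n u" "x \<in> hvec n" "a \<in> A"
  shows "vproj n (column_module n u) (\<lambda>i. a * x i) = (\<lambda>i. a * vproj n (column_module n u) x i)"
  by (rule vproj_mult[OF column_module_stable[OF assms(1)] assms(2)])
    (auto intro: column_module_mult star_A assms(3))

text \<open>In a Hopf *-algebra \<open>star \<circ> S \<circ> star\<close> is the inverse of the
  antipode. It is the right choice here because the products u_ij S^-1(u_li) are summed over the row
  index i, that is, with the factors in the order opposite to that in the antipode law.\<close>

definition column_coord :: "nat \<Rightarrow> (nat \<Rightarrow> nat \<Rightarrow> 'h) \<Rightarrow> nat \<Rightarrow> (nat \<Rightarrow> 'h) \<Rightarrow> 'h"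
  where "column_coord n u l f = (\<Sum>i<n. f i * star (S (star (u l i))))"

lemma column_coord:
  assumes u: "corep n u" and f: "f = (\<lambda>i. if i < n then \<Sum>j<n. a j * u i j else 0)" and l: "l < n"
  shows "column_coord n u l f = a l"
proof -
  have inv: "(\<Sum>i<n. u i j * star (S (star (u l i)))) = (if j = l then 1 else 0)" if j: "j < n" for j
  proof -
    have "(\<Sum>i<n. u i j * star (S (star (u l i)))) = star (\<Sum>i<n. S (star (u l i)) * star (u i j))"
      by (simp add: star_sum star_mult star_star)
    also have "\<dots> = star (if l = j then 1 else 0)"
      by (simp only: corep_antipode(1)[OF corep_star[OF u] l j])
    finally show ?thesis by auto
  qed
  have "column_coord n u l f = (\<Sum>i<n. \<Sum>j<n. a j * (u i j * star (S (star (u l i)))))"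
    unfolding column_coord_def by (intro sum.cong refl) (simp add: f sum_distrib_right mult.assoc)
  also have "\<dots> = (\<Sum>j<n. a j * (\<Sum>i<n. u i j * star (S (star (u l i)))))"
    unfolding sum_distrib_left by (rule sum.swap)
  also have "\<dots> = (\<Sum>j<n. a j * (if j = l then 1 else 0))"
    by (intro sum.cong refl) (simp add: inv)
  also have "\<dots> = a l" by (rule sum_delta_mult[OF l])
  finally show ?thesis .
qed

lemma column_module_expand:
  assumes "corep n u" "f \<in> column_module n u"
  shows "l < n \<Longrightarrow> column_coord n u l f \<in> A" "i < n \<Longrightarrow> f i = (\<Sum>l<n. column_coord n u l f * u i l)"
proof -
  obtain a where a: "\<forall>j<n. a j \<in> A" "f = (\<lambda>i. if i < n then \<Sum>j<n. a j * u i j else 0)"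
    using assms(2) by (auto simp: column_module_def)
  show "column_coord n u l f \<in> A" if "l < n" using column_coord[OF assms(1) a(2) that] a(1) that by simp
  show "f i = (\<Sum>l<n. column_coord n u l f * u i l)" if "i < n"
  proof -
    have "f i = (\<Sum>j<n. a j * u i j)" using that by (simp add: a(2))
    also have "\<dots> = (\<Sum>l<n. column_coord n u l f * u i l)"
      by (intro sum.cong refl) (simp add: column_coord[OF assms(1) a(2)])
    finally show ?thesis .
  qed
qed

text \<open>
  The \<open>A\<close>-linear functionals come from \<open>T = \<pi> P \<pi>\<^sup>*\<close>, where \<open>\<pi> : H\<^sup>n \<rightarrow> H\<close> maps the columns of \<open>u\<close> to
  the basis \<open>e\<close> of the comodule, \<open>\<pi>\<^sup>*\<close> is its adjoint and \<open>P\<close> is the projection onto the column module.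
  The operator \<open>T\<close> is positive with kernel orthogonal to the \<open>A\<close>-module generated by \<open>e\<close>.
\<close>

lemma expand_in_module:
  obtains n s e where "\<And>l. l < n \<Longrightarrow> linear_functional A (*) (s l)" "x = (\<Sum>l<(n::nat). s l x * e l)"
proof -
  obtain V where V: "subcomodule V" "finite_dim V" "{x} \<subseteq> V" using finite_dim_subcomodule[of "{x}"] by blast
  obtain n e \<psi> where de: "dual_basis n e \<psi> V" using finite_dim_dual_basis[OF V(2)] by blast
  obtain u where u: "corep n u" "\<And>j. j < n \<Longrightarrow> \<Delta> (e j) = (\<Sum>i<n. e i \<otimes> u i j)"
    using corep_of_subcomodule[OF V(1) de] by blast
  obtain C \<theta> where C: "finite_dim C" "{x} \<subseteq> C" "clinear \<theta>" "\<And>x. act \<theta> x \<in> C"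
    "\<And>x. x \<in> C \<Longrightarrow> act \<theta> x = x" "\<And>x y. haar_form (act \<theta> x) y = haar_form x (act \<theta> y)"
    by (rule coefficient_projection[of "{x}"]) auto
  note CS = finite_dim_subspace[OF C(1)]
  \<comment> \<open>By \<open>corep_expand\<close>, \<open>pi\<close> below sends the l-th column of
    \<open>u\<close> to \<open>e l\<close>; \<open>pi_adj\<close> is its adjoint, and the
    coordinates \<open>t l\<close> of \<open>Q y\<close> are the coefficients of T(y) = \<Sum>
    t_l(y) e_l.\<close>
  define X where "X = column_module n u"
  have X: "vact_stable n X" unfolding X_def by (rule column_module_stable[OF u(1)])
  define pi_adj where "pi_adj y = (\<lambda>i. if i < n then cnj (\<epsilon> (e i)) *\<^sub>C y else 0)" for y :: 'h
  define pi where "pi f = (\<Sum>i<n. \<epsilon> (e i) *\<^sub>C f i)" for f :: "nat \<Rightarrow> 'h"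
  define Q where "Q y = vproj n X (pi_adj y)" for y
  define t where "t l y = column_coord n u l (Q y)" for l y
  have adj: "vform n (pi_adj y) f = haar_form y (pi f)" for y f
    unfolding vform_def pi_def clinear_sum[OF haar_form_linear] clinear_scale[OF haar_form_linear]
    by (intro sum.cong refl) (simp add: pi_adj_def star_scaleC mult_scaleC_left clinear_scale[OF haar_linear])
  have hv: "pi_adj y \<in> hvec n" for y by (simp add: pi_adj_def hvec_def)
  have QX: "Q y \<in> X" for y unfolding Q_def by (rule vproj(1)[OF X hv])
  have t_lin: "linear_functional A (*) (t l)" if l: "l < n" for l
  proof (rule linear_functionalI)
    show "t l y \<in> A" for y
      unfolding t_def using column_module_expand(1)[OF u(1) _ l] QX by (simp add: X_def)
    have "pi_adj (y + z) = pi_adj y + pi_adj z" for y z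
      by (simp add: pi_adj_def fun_eq_iff scaleC_add_right)
    then have "Q (y + z) = Q y + Q z" for y z by (simp only: Q_def vproj_add[OF X hv hv])
    then show "t l (y + z) = t l y + t l z" for y z
      by (simp add: t_def column_coord_def distrib_right sum.distrib)
    have "Q (a * y) = (\<lambda>i. a * Q y i)" if a: "a \<in> A" for a y
    proof -
      have "pi_adj (a * y) = (\<lambda>i. a * pi_adj y i)" by (simp add: pi_adj_def fun_eq_iff mult_scaleC_right)
      then show ?thesis
        by (simp only: Q_def X_def vproj_column_module_mult[OF u(1) hv a])
    qed
    then show "t l (a * y) = a * t l y" if "a \<in> A" for a y
      using that by (simp add: t_def column_coord_def sum_distrib_left mult.assoc)
  qed
  have pi_X: "pi f = (\<Sum>l<n. column_coord n u l f * e l)" if "f \<in> X" for f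
  proof -
    have "pi f = (\<Sum>i<n. \<Sum>l<n. \<epsilon> (e i) *\<^sub>C (column_coord n u l f * u i l))"
      unfolding pi_def
      by (intro sum.cong refl) (use that in \<open>simp add: X_def column_module_expand(2)[OF u(1)] complex_vector.scale_sum_right[symmetric]\<close>)
    also have "\<dots> = (\<Sum>l<n. column_coord n u l f * (\<Sum>i<n. \<epsilon> (e i) *\<^sub>C u i l))"
      unfolding mult_sum_scale by (rule sum.swap)
    also have "\<dots> = (\<Sum>l<n. column_coord n u l f * e l)"
      by (intro sum.cong refl arg_cong2[where f = "(*)"] corep_expand[OF de u(2), symmetric]) auto
    finally show ?thesis .
  qed
  \<comment> \<open>\<open>vproj_exists\<close> offers a projection with entries in
    \<open>C\<close>, and uniqueness identifies it with \<open>Q y\<close>.\<close>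
  have T_C: "(\<Sum>l<n. t l y * e l) \<in> C" if y: "y \<in> C" for y
  proof -
    have "pi_adj y i \<in> C" for i
      using complex_vector.subspace_scale[OF CS y] complex_vector.subspace_0[OF CS] by (simp add: pi_adj_def)
    then obtain k where "k \<in> X" "\<And>i. k i \<in> C" "\<And>f. f \<in> X \<Longrightarrow> vform n f (pi_adj y - k) = 0"
      using vproj_exists[OF X C(1,3-6) hv] by metis
    then have "Q y i \<in> C" for i unfolding Q_def using vproj_eqI[OF X hv] by metis
    then have "pi (Q y) \<in> C" unfolding pi_def
      by (intro complex_vector.subspace_sum complex_vector.subspace_scale CS)
    then show ?thesis using pi_X[OF QX] by (simp add: t_def)
  qed
  \<comment> \<open>The pairing of \<open>y\<close> with T(y) is the squared norm of
    \<open>Q y\<close>. If it vanishes, \<open>pi_adj y\<close> is orthogonal to the column module,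
    so \<open>y\<close> is orthogonal to all \<open>A\<close>-combinations of the
    \<open>e l\<close>.\<close>
  have kernel: "haar_form y (\<Sum>l<n. a l * e l) = 0"
    if y: "haar_form y (\<Sum>l<n. t l y * e l) = 0" and a: "\<And>l. l < n \<Longrightarrow> a l \<in> A" for y a
  proof -
    have QV: "Q y \<in> hvec n" using QX X by (auto simp: vact_stable_def)
    have orth: "vform n f (pi_adj y - Q y) = 0" if "f \<in> X" for f
      unfolding Q_def by (rule vproj(2)[OF X hv that])
    have "vform n (Q y) (Q y) = vform n (Q y) (pi_adj y)"
      using orth[OF QX] by (simp add: clinear_diff[OF vform_linear])
    also have "\<dots> = cnj (haar_form y (pi (Q y)))" unfolding adj[symmetric] vform_sym ..
    also have "\<dots> = 0" using y pi_X[OF QX] by (simp add: t_def)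
    finally have "Q y = 0"
      using inner_product_onD(6)[OF inner_product_vform subspace_hvec QV] by force
    define f where "f = (\<lambda>i. if i < n then \<Sum>j<n. a j * u i j else 0)"
    have fX: "f \<in> X" unfolding X_def f_def by (rule column_moduleI[OF a]) auto
    have "haar_form y (pi f) = cnj (vform n f (pi_adj y))" unfolding adj[symmetric] vform_sym ..
    also have "\<dots> = 0" using orth[OF fX] \<open>Q y = 0\<close> by simp
    finally show ?thesis unfolding pi_X[OF fX] by (simp add: column_coord[OF u(1) f_def])
  qed
  \<comment> \<open>The values at \<open>x\<close> of all candidate expansions, cut down to
    \<open>C\<close> so that they form a finite-dimensional space with a best approximation
    \<open>y\<close> to \<open>x\<close>.\<close>
  define B where "B = {y \<in> C. \<exists>s. (\<forall>l<n. linear_functional A (*) (s l)) \<and> y = (\<Sum>l<n. s l x * e l)}"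
  have B_I: "w \<in> B" if "\<forall>l<n. linear_functional A (*) (r l)" "w = (\<Sum>l<n. r l x * e l)" "w \<in> C" for r w
    unfolding B_def using that by blast
  have "csubspace B"
  proof (rule complex_vector.subspaceI)
    have "linear_functional A (*) (\<lambda>_. 0)" by (rule linear_functionalI) (simp_all add: closed_A)
    then show "0 \<in> B" unfolding B_def using complex_vector.subspace_0[OF CS]
      by (auto intro!: exI[of _ "\<lambda>_ _. 0"])
    fix y z c assume "y \<in> B" "z \<in> B"
    then obtain s s' where s: "y \<in> C" "z \<in> C" "\<forall>l<n. linear_functional A (*) (s l)" "y = (\<Sum>l<n. s l x * e l)"
      "\<forall>l<n. linear_functional A (*) (s' l)" "z = (\<Sum>l<n. s' l x * e l)" unfolding B_def by blast
    have "\<forall>l<n. linear_functional A (*) (\<lambda>x. s l x + s' l x)" "\<forall>l<n. linear_functional A (*) (\<lambda>x. c *\<^sub>C s l x)"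
      using s(3,5) by (auto simp: linear_functional_def distrib_left closed_A scaleC_add_right mult_scaleC_right)
    moreover have "y + z = (\<Sum>l<n. (s l x + s' l x) * e l)" "c *\<^sub>C y = (\<Sum>l<n. (c *\<^sub>C s l x) * e l)"
      by (simp_all add: s(4,6) distrib_right sum.distrib mult_scaleC_left complex_vector.scale_sum_right)
    ultimately show "y + z \<in> B" "c *\<^sub>C y \<in> B"
      using B_I[of "\<lambda>l x. s l x + s' l x" "y + z"] B_I[of "\<lambda>l x. c *\<^sub>C s l x" "c *\<^sub>C y"]
        complex_vector.subspace_add[OF CS s(1,2)] complex_vector.subspace_scale[OF CS s(1), of c] by auto
  qed
  moreover have "B \<subseteq> C" by (auto simp: B_def)
  ultimately have "finite_dim B" using finite_dim_subset[OF C(1)] by blast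
  then obtain m g where ob: "orthonormal_basis haar_form m g B"
    using orthonormal_basis_exists[OF inner_product_haar_form complex_vector.subspace_UNIV _ subset_UNIV] by blast
  define y where "y = (\<Sum>i<m. haar_form (g i) x *\<^sub>C g i)"
  have yB: "y \<in> B" unfolding y_def using orthonormal_basisD(1)[OF ob] \<open>csubspace B\<close>
    by (intro complex_vector.subspace_sum complex_vector.subspace_scale) auto
  then obtain s where s: "\<And>l. l < n \<Longrightarrow> linear_functional A (*) (s l)" "y = (\<Sum>l<n. s l x * e l)"
    unfolding B_def by blast
  have orth: "haar_form w (x - y) = 0" if "w \<in> B" for w
    unfolding y_def
    by (rule orthonormal_basis_orthogonal[OF inner_product_haar_form complex_vector.subspace_UNIV subset_UNIV ob UNIV_I that])
  have xyC: "x - y \<in> C" using C(2) yB \<open>B \<subseteq> C\<close> complex_vector.subspace_diff[OF CS] by blast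
  \<comment> \<open>Applying T to the error of the functionals \<open>s\<close> gives another
    admissible expansion, evaluated at \<open>x\<close>; it is therefore orthogonal to
    \<open>x - y\<close>.\<close>
  have "(\<Sum>l<n. t l (x - y) * e l) \<in> B"
    unfolding B_def
  proof (intro CollectI conjI exI[of _ "\<lambda>l x. t l (x - (\<Sum>k<n. s k x * e k))"] allI impI T_C[OF xyC])
    show "linear_functional A (*) (\<lambda>x. t l (x - (\<Sum>k<n. s k x * e k)))" if l: "l < n" for l
    proof (rule linear_functionalI)
      note tl = linear_functionalD[OF t_lin[OF l]] and sl = linear_functionalD[OF s(1)]
      show "t l (z - (\<Sum>k<n. s k z * e k)) \<in> A" for z by (rule tl(3))
      fix z z' a
      have "(\<Sum>k<n. s k (z + z') * e k) = (\<Sum>k<n. s k z * e k) + (\<Sum>k<n. s k z' * e k)"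
        by (simp add: sl(1) distrib_right sum.distrib)
      then have "z + z' - (\<Sum>k<n. s k (z + z') * e k) = (z - (\<Sum>k<n. s k z * e k)) + (z' - (\<Sum>k<n. s k z' * e k))"
        by simp
      then show "t l (z + z' - (\<Sum>k<n. s k (z + z') * e k)) =
          t l (z - (\<Sum>k<n. s k z * e k)) + t l (z' - (\<Sum>k<n. s k z' * e k))"
        by (simp only: tl(1))
      assume a: "a \<in> A"
      have "(\<Sum>k<n. s k (a * z) * e k) = a * (\<Sum>k<n. s k z * e k)"
        by (simp add: sl(2) a sum_distrib_left mult.assoc)
      then have "a * z - (\<Sum>k<n. s k (a * z) * e k) = a * (z - (\<Sum>k<n. s k z * e k))"
        by (simp only: right_diff_distrib)
      then show "t l (a * z - (\<Sum>k<n. s k (a * z) * e k)) = a * t l (z - (\<Sum>k<n. s k z * e k))"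
        by (simp only: tl(2)[OF a])
    qed
    show "(\<Sum>l<n. t l (x - y) * e l) = (\<Sum>l<n. t l (x - (\<Sum>k<n. s k x * e k)) * e l)"
      by (simp only: s(2))
  qed
  then have k0: "haar_form (x - y) (\<Sum>l<n. t l (x - y) * e l) = 0"
    using orth haar_form_sym by (metis complex_cnj_zero)
  \<comment> \<open>Both \<open>x\<close> and \<open>y\<close> are \<open>A\<close>-combinations of
    the \<open>e l\<close>, with scalars viewed inside \<open>A\<close> for \<open>x\<close>. Hence
    \<open>kernel\<close> makes \<open>x - y\<close> orthogonal to itself.\<close>
  have xy: "x - y = (\<Sum>l<n. (\<psi> l x *\<^sub>C 1 - s l x) * e l)"
    using dual_basisD(4)[OF de, of x] V(3)
    by (simp add: s(2) left_diff_distrib mult_scaleC_left sum_subtractf)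
  have "haar_form (x - y) (\<Sum>l<n. (\<psi> l x *\<^sub>C 1 - s l x) * e l) = 0"
    by (rule kernel[OF k0]) (intro closed_A linear_functionalD(3)[OF s(1)])
  then have "haar_form (x - y) (x - y) = 0" by (simp only: xy[symmetric])
  then have "x - y = 0" using haar_positive[of "x - y"] by force
  then show thesis using that[of n s e] s by simp
qed

text \<open>For n = 1 and the trivial corepresentation the column module is \<open>A\<close> itself,
  so \<open>E\<close> is the orthogonal projection of \<open>H\<close> onto \<open>A\<close>, and it
  fixes 1.\<close>

lemma retraction_exists: "\<exists>E. linear_functional A (*) E \<and> E 1 = 1"
proof -
  let ?u = "\<lambda>_ _. 1 :: 'h"
  have u: "corep 1 ?u" by (simp add: corep_def comult_one counit_one)
  define X where "X = column_module 1 ?u"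
  have X: "vact_stable 1 X" unfolding X_def by (rule column_module_stable[OF u])
  define v where "v x = (\<lambda>i::nat. if i = 0 then x else 0)" for x :: 'h
  have hv: "v x \<in> hvec 1" for x by (auto simp: hvec_def v_def)
  define E where "E x = vproj 1 X (v x) 0" for x
  have "linear_functional A (*) E"
  proof (rule linear_functionalI)
    show "E x \<in> A" for x
      using vproj(1)[OF X hv, of x] by (auto simp: E_def X_def column_module_def)
    have "v (x + y) = v x + v y" for x y by (auto simp: v_def)
    then show "E (x + y) = E x + E y" for x y by (simp only: E_def vproj_add[OF X hv hv] plus_fun_apply)
    have "v (a * x) = (\<lambda>i. a * v x i)" for a x by (auto simp: v_def)
    then show "E (a * x) = a * E x" if "a \<in> A" for a x
      using that by (simp only: E_def X_def vproj_column_module_mult[OF u hv])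
  qed
  moreover have "v 1 \<in> X" unfolding X_def by (rule column_moduleI[of _ "\<lambda>_. 1"]) (auto simp: closed_A v_def)
  then have "vproj 1 X (v 1) = v 1"
    by (intro vproj_eqI[OF X hv]) (simp_all add: clinear_zero[OF vform_linear])
  then have "E 1 = 1" by (simp add: E_def v_def)
  ultimately show ?thesis by blast
qed

text \<open>The remainder \<open>q\<close> of an expansion valid for the earlier elements is
  \<open>A\<close>-linear and vanishes on them. Expanding \<open>q (h m)\<close> and composing the
  new functionals with \<open>q\<close> corrects the last element without disturbing the
  others.\<close>

lemma expand_finite_family:
  fixes h :: "nat \<Rightarrow> 'h"
  shows "\<exists>n s e. (\<forall>j<n. linear_functional A (*) (s j)) \<and> (\<forall>k<m. (\<Sum>j<(n::nat). s j (h k) * e j) = h k)"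
proof (induction m)
  case 0
  show ?case by (rule exI[of _ 0]) simp
next
  case (Suc m)
  then obtain n1 s1 e1 where 1: "\<And>j. j < n1 \<Longrightarrow> linear_functional A (*) (s1 j)"
    "\<And>k. k < m \<Longrightarrow> (\<Sum>j<(n1::nat). s1 j (h k) * e1 j) = h k" by blast
  define q where "q x = x - (\<Sum>j<n1. s1 j x * e1 j)" for x
  obtain n2 s2 e2 where 2: "\<And>j. j < n2 \<Longrightarrow> linear_functional A (*) (s2 j)"
    "q (h m) = (\<Sum>j<(n2::nat). s2 j (q (h m)) * e2 j)"
    using expand_in_module[of "q (h m)"] by metis
  note lin1 = linear_functionalD[OF 1(1)] and lin2 = linear_functionalD[OF 2(1)]
  have q_add: "q (x + y) = q x + q y" for x y
    by (simp add: q_def lin1(1) distrib_right sum.distrib)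
  have q_mult: "q (a * x) = a * q x" if "a \<in> A" for a x
    using that by (simp add: q_def lin1(2) right_diff_distrib sum_distrib_left mult.assoc)
  let ?s = "\<lambda>j x. if j < n1 then s1 j x else s2 (j - n1) (q x)"
    and ?e = "\<lambda>j. if j < n1 then e1 j else e2 (j - n1)"
  have sum: "(\<Sum>j<n1 + n2. ?s j x * ?e j) = x - q x + (\<Sum>j<n2. s2 j (q x) * e2 j)" for x
  proof -
    have "(\<Sum>j<n1 + n2. ?s j x * ?e j) = (\<Sum>j<n1 + n2. if j < n1 then s1 j x * e1 j else s2 (j - n1) (q x) * e2 (j - n1))"
      by (intro sum.cong refl) auto
    also have "\<dots> = x - q x + (\<Sum>j<n2. s2 j (q x) * e2 j)"
      unfolding sum_append_index[of n1 "\<lambda>j. s1 j x * e1 j" "\<lambda>j. s2 j (q x) * e2 j"] by (simp add: q_def)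
    finally show ?thesis .
  qed
  have lin: "linear_functional A (*) (?s j)" if "j < n1 + n2" for j
    using that by (intro linear_functionalI) (auto simp: lin1 lin2 q_add q_mult)
  have exp: "(\<Sum>j<n1 + n2. ?s j (h k) * ?e j) = h k" if k: "k < Suc m" for k
  proof (cases "k = m")
    case True
    then show ?thesis unfolding True sum 2(2)[symmetric] by simp
  next
    case False
    then have "q (h k) = 0" using k 1(2) by (simp add: q_def)
    then show ?thesis unfolding sum by (simp add: lin2(4))
  qed
  show ?case
    by (intro exI[of _ "n1 + n2"] exI[of _ ?s] exI[of _ ?e] conjI allI impI lin exp)
qed

end

section \<open>Faithful flatness\<close>

lemma frag_eval_tensor_map:
  "frag_eval b (frag_tensor_map f g s) = frag_eval (\<lambda>(x, y). b (f x, g y)) s"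
  unfolding frag_tensor_map_def
  by (induction s rule: frag_induction[OF subset_UNIV]) (auto simp: frag_extend_diff frag_eval_diff)

lemma frag_eval_additive:
  assumes "\<And>x y. g (x + y) = g x + g y"
  shows "g (frag_eval b s) = frag_eval (\<lambda>p. g (b p)) s"
proof -
  have g0: "g 0 = 0" using assms[of 0 0] by simp
  have g_diff: "g (x - y) = g x - g y" for x y using assms[of "x - y" y] by (simp add: algebra_simps)
  show ?thesis
    by (induction s rule: frag_induction[OF subset_UNIV]) (auto simp: frag_eval_diff g0 g_diff)
qed

lemma frag_tensor_map_of [simp]: "frag_tensor_map f g (frag_of (x, y)) = frag_of (f x, g y)"
  by (simp add: frag_tensor_map_def)

lemma frag_tensor_map_0 [simp]: "frag_tensor_map f g 0 = 0"
  and frag_tensor_map_diff: "frag_tensor_map f g (s - t) = frag_tensor_map f g s - frag_tensor_map f g t"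
  and frag_tensor_map_add: "frag_tensor_map f g (s + t) = frag_tensor_map f g s + frag_tensor_map f g t"
  by (simp_all add: frag_tensor_map_def frag_extend_diff frag_extend_add)

lemma frag_tensor_map_sum: "frag_tensor_map f g (sum h I) = (\<Sum>i\<in>I. frag_tensor_map f g (h i))"
  by (induction I rule: infinite_finite_induct) (simp_all add: frag_tensor_map_add)

lemma group_closure_frag_tensor_map:
  assumes "s \<in> group_closure R" "\<And>u. u \<in> R \<Longrightarrow> frag_tensor_map f g u \<in> R'"
  shows "frag_tensor_map f g s \<in> group_closure R'"
  using assms unfolding frag_tensor_map_def
  by (intro group_closure_frag_extend[OF assms(1)] group_closure.base) auto

lemma tensor_cong_map:
  assumes "\<And>x x'. f (x + x') = f x + f x'" "\<And>y y'. g (y + y') = g y + g y'"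
    and "\<And>a x. a \<in> A \<Longrightarrow> f (r x a) = r' (f x) a" "\<And>a y. a \<in> A \<Longrightarrow> g (l a y) = l' a (g y)"
    and "(s, t) \<in> tensor_cong A r l"
  shows "(frag_tensor_map f g s, frag_tensor_map f g t) \<in> tensor_cong A r' l'"
proof -
  have "frag_tensor_map f g (s - t) \<in> group_closure (tensor_relators A r' l')"
  proof (rule group_closure_frag_tensor_map)
    show "s - t \<in> group_closure (tensor_relators A r l)" using assms(5) by (simp add: tensor_cong_def)
    show "frag_tensor_map f g u \<in> tensor_relators A r' l'" if "u \<in> tensor_relators A r l" for u
      using that unfolding tensor_relators_def
      by (elim UnE CollectE exE conjE) (simp add: frag_tensor_map_diff assms(1-4), blast)+
  qed
  then show ?thesis by (simp add: tensor_cong_def frag_tensor_map_diff)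
qed

text \<open>Equality of sets of equivalence classes is replaced by a condition on representatives,
  which the evaluation maps can handle.\<close>

lemma quotient_exact_iff:
  assumes R: "equiv UNIV R" and R': "equiv UNIV R'" and R'': "equiv UNIV R''"
    and F: "\<And>s t. (s, t) \<in> R \<Longrightarrow> (F s, F t) \<in> R'" and G: "\<And>s t. (s, t) \<in> R' \<Longrightarrow> (G s, G t) \<in> R''"
  shows "(\<lambda>X. \<Union>s\<in>X. R' `` {F s}) ` (UNIV // R) = {Y \<in> UNIV // R'. (\<Union>s\<in>Y. R'' `` {G s}) = R'' `` {z}} \<longleftrightarrow>
    (\<forall>t. (\<exists>s. (t, F s) \<in> R') \<longleftrightarrow> (G t, z) \<in> R'')"
proof -
  have map: "(\<Union>s\<in>Q `` {t}. Q' `` {K s}) = Q' `` {K t}"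
    if "equiv UNIV Q" "equiv UNIV Q'" "\<And>s t. (s, t) \<in> Q \<Longrightarrow> (K s, K t) \<in> Q'" for Q Q' K t
    by (rule UN_equiv_class[OF that(1)]) (auto simp: congruent_def intro!: equiv_class_eq[OF that(2)] that(3))
  have mapF: "(\<Union>s\<in>R `` {t}. R' `` {F s}) = R' `` {F t}" for t by (rule map[OF R R']) (rule F)
  have mapG: "(\<Union>s\<in>R' `` {t}. R'' `` {G s}) = R'' `` {G t}" for t by (rule map[OF R' R'']) (rule G)
  have eq: "Q `` {s} = Q `` {t} \<longleftrightarrow> (s, t) \<in> Q" if "equiv UNIV Q" for Q s t
    by (rule eq_equiv_class_iff[OF that]) simp_all
  have quot: "UNIV // Q = range (\<lambda>s. Q `` {s})" for Q by (auto simp: quotient_def)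
  have "(\<lambda>X. \<Union>s\<in>X. R' `` {F s}) ` (UNIV // R) = range (\<lambda>s. R' `` {F s})"
    unfolding quot image_image mapF ..
  moreover have "{Y \<in> UNIV // R'. (\<Union>s\<in>Y. R'' `` {G s}) = R'' `` {z}} = (\<lambda>t. R' `` {t}) ` {t. (G t, z) \<in> R''}"
    unfolding quot
  proof (intro set_eqI iffI)
    fix Y assume "Y \<in> {Y \<in> range (\<lambda>t. R' `` {t}). (\<Union>s\<in>Y. R'' `` {G s}) = R'' `` {z}}"
    then obtain t where t: "Y = R' `` {t}" "(\<Union>s\<in>Y. R'' `` {G s}) = R'' `` {z}" by blast
    then have "(G t, z) \<in> R''" by (simp only: mapG eq[OF R''])
    then show "Y \<in> (\<lambda>t. R' `` {t}) ` {t. (G t, z) \<in> R''}" unfolding t(1) by (intro imageI CollectI)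
  next
    fix Y assume "Y \<in> (\<lambda>t. R' `` {t}) ` {t. (G t, z) \<in> R''}"
    then obtain t where t: "Y = R' `` {t}" "(G t, z) \<in> R''" by blast
    then have "(\<Union>s\<in>Y. R'' `` {G s}) = R'' `` {z}" by (simp only: mapG eq[OF R''])
    then show "Y \<in> {Y \<in> range (\<lambda>t. R' `` {t}). (\<Union>s\<in>Y. R'' `` {G s}) = R'' `` {z}}" using t(1) by blast
  qed
  moreover have "range (\<lambda>s. R' `` {F s}) = (\<lambda>t. R' `` {t}) ` {t. (G t, z) \<in> R''} \<longleftrightarrow>
      (\<forall>t. (\<exists>s. (t, F s) \<in> R') \<longleftrightarrow> (G t, z) \<in> R'')" (is "?L = ?M \<longleftrightarrow> ?P")
  proof
    have mem_L: "R' `` {t} \<in> ?L \<longleftrightarrow> (\<exists>s. (t, F s) \<in> R')" for t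
      by (auto simp: image_iff eq[OF R'])
    have mem_M: "R' `` {t} \<in> ?M \<longleftrightarrow> (G t, z) \<in> R''" for t
    proof
      assume "R' `` {t} \<in> ?M"
      then obtain t' where "(t, t') \<in> R'" "(G t', z) \<in> R''" by (auto simp: eq[OF R'])
      then show "(G t, z) \<in> R''" using G R'' by (meson equivE transD)
    qed auto
    show ?P if LM: "?L = ?M"
    proof
      fix t
      have "(\<exists>s. (t, F s) \<in> R') \<longleftrightarrow> R' `` {t} \<in> ?L" by (rule mem_L[symmetric])
      also have "\<dots> \<longleftrightarrow> R' `` {t} \<in> ?M" by (simp only: LM)
      also have "\<dots> \<longleftrightarrow> (G t, z) \<in> R''" by (rule mem_M)
      finally show "(\<exists>s. (t, F s) \<in> R') \<longleftrightarrow> (G t, z) \<in> R''" .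
    qed
    show "?L = ?M" if P: ?P
    proof -
      have key: "R' `` {t} \<in> ?L \<longleftrightarrow> R' `` {t} \<in> ?M" for t
        by (rule trans[OF mem_L trans[OF P[rule_format] mem_M[symmetric]]])
      show ?thesis
      proof (intro set_eqI iffI)
        fix Y assume Y: "Y \<in> ?L"
        then obtain s where "Y = R' `` {F s}" by blast
        with Y key[of "F s"] show "Y \<in> ?M" by (simp only:)
      next
        fix Y assume Y: "Y \<in> ?M"
        then obtain t where "Y = R' `` {t}" by blast
        with Y key[of t] show "Y \<in> ?L" by (simp only:)
      qed
    qed
  qed
  ultimately show ?thesis by simp
qed

lemma tensor_exact_iff:
  assumes "\<And>s t. (s, t) \<in> tensor_cong A r l \<Longrightarrow> (frag_tensor_map f f' s, frag_tensor_map f f' t) \<in> tensor_cong A r' l'"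
    and "\<And>s t. (s, t) \<in> tensor_cong A r' l' \<Longrightarrow> (frag_tensor_map g g' s, frag_tensor_map g g' t) \<in> tensor_cong A r'' l''"
  shows "tensor_over_map A r' l' f f' ` tensor_over A r l =
      {Y \<in> tensor_over A r' l'. tensor_over_map A r'' l'' g g' Y = tensor_cong A r'' l'' `` {0}} \<longleftrightarrow>
    (\<forall>t. (\<exists>s. (t, frag_tensor_map f f' s) \<in> tensor_cong A r' l') \<longleftrightarrow> (frag_tensor_map g g' t, 0) \<in> tensor_cong A r'' l'')"
  unfolding tensor_over_def tensor_over_map_def
  by (rule quotient_exact_iff[OF equiv_tensor_cong equiv_tensor_cong equiv_tensor_cong assms])

lemma balanced_over_functional:
  assumes "right_module A r" "linear_functional A l s"
  shows "balanced_over A r l (\<lambda>p x. r p (s x))"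
  using assms by (auto simp: balanced_over_def right_module_def linear_functional_def)

text \<open>
  Functionals \<open>s : K \<rightarrow> A\<close> give additive maps \<open>P \<otimes>\<^sub>A K \<rightarrow> P\<close>, \<open>p \<otimes> x \<mapsto> p s(x)\<close>, that are natural in
  \<open>P\<close>.
\<close>

lemma exact_tensor_iff:
  fixes l :: "'r::ring_1 \<Rightarrow> 'k::ab_group_add \<Rightarrow> 'k"
    and rM :: "'m::ab_group_add \<Rightarrow> 'r \<Rightarrow> 'm" and rN :: "'n::ab_group_add \<Rightarrow> 'r \<Rightarrow> 'n"
    and rP :: "'p::ab_group_add \<Rightarrow> 'r \<Rightarrow> 'p"
  assumes expand: "\<And>m (h :: nat \<Rightarrow> 'k). \<exists>n s e. (\<forall>j<n. linear_functional A l (s j)) \<and>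
      (\<forall>k<m. (\<Sum>j<(n::nat). l (s j (h k)) (e j)) = h k)"
    and E: "linear_functional A l E" "E u = 1"
    and mods: "right_module A rM" "right_module A rN" "right_module A rP"
    and homs: "right_module_hom A rM rN f" "right_module_hom A rN rP g"
  shows "range f = {y. g y = 0} \<longleftrightarrow>
    (\<forall>t. (\<exists>s. (t, frag_tensor_map f (\<lambda>x. x) s) \<in> tensor_cong A rN l) \<longleftrightarrow>
      (frag_tensor_map g (\<lambda>x. x) t, 0) \<in> tensor_cong A rP l)"
    (is "_ \<longleftrightarrow> (\<forall>t. (\<exists>s. (t, ?F s) \<in> ?cN) \<longleftrightarrow> (?G t, 0) \<in> ?cP)")
proof -
  have f_add: "f (x + y) = f x + f y" and f_mult: "a \<in> A \<Longrightarrow> f (rM x a) = rN (f x) a" for x y a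
    using homs(1) by (auto simp: right_module_hom_def)
  have g_add: "g (x + y) = g x + g y" and g_mult: "a \<in> A \<Longrightarrow> g (rN z a) = rP (g z) a" for x y z a
    using homs(2) by (auto simp: right_module_hom_def)
  have g0: "g 0 = 0" using g_add[of 0 0] by simp
  have g_sum: "g (sum h I) = (\<Sum>i\<in>I. g (h i))" for h :: "nat \<Rightarrow> 'n" and I
    by (induction I rule: infinite_finite_induct) (simp_all add: g0 g_add)
  define evN where "evN s = frag_eval (\<lambda>(p, x). rN p (s x))" for s :: "'k \<Rightarrow> 'r"
  define evP where "evP s = frag_eval (\<lambda>(p, x). rP p (s x))" for s :: "'k \<Rightarrow> 'r"
  have evN_cong: "evN s t = evN s t'" if "linear_functional A l s" "(t, t') \<in> ?cN" for s t t'
    unfolding evN_def by (rule frag_eval_tensor_cong[OF balanced_over_functional[OF mods(2) that(1)] that(2)])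
  have evP_cong: "evP s t = evP s t'" if "linear_functional A l s" "(t, t') \<in> ?cP" for s t t'
    unfolding evP_def by (rule frag_eval_tensor_cong[OF balanced_over_functional[OF mods(3) that(1)] that(2)])
  have evP_G: "evP s (?G t) = g (evN s t)" if "linear_functional A l s" for s t
    unfolding evP_def evN_def frag_eval_tensor_map frag_eval_additive[of g, OF g_add]
    using linear_functionalD(3)[OF that] by (simp add: g_mult split_def)
  show ?thesis
  proof (intro iffI allI)
    fix t assume exact: "range f = {y. g y = 0}"
    show "(?G t, 0) \<in> ?cP" if ex: "\<exists>s. (t, ?F s) \<in> ?cN"
    proof -
      obtain s where s: "(t, ?F s) \<in> ?cN" using ex by blast
      have "(?G (?F s), 0) \<in> ?cP"
      proof (induction s rule: frag_induction[OF subset_UNIV])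
        case (2 p)
        have "g (f (fst p)) = 0" using exact by auto
        then show ?case by (cases p) (simp add: tensor_cong_zero_left)
      next
        case (3 a b)
        then show ?case using tensor_cong_diff[OF 3] by (simp add: frag_tensor_map_diff)
      qed simp
      moreover have "(?G t, ?G (?F s)) \<in> ?cP"
        by (rule tensor_cong_map[OF g_add _ g_mult _ s]) auto
      ultimately show ?thesis by (blast intro: tensor_cong_trans)
    qed
    show "\<exists>s. (t, ?F s) \<in> ?cN" if Gt: "(?G t, 0) \<in> ?cP"
    proof -
      obtain m y h where t: "(t, \<Sum>k<(m::nat). frag_of (y k, h k)) \<in> ?cN" using tensor_cong_frag_sum[of t A rN l] by blast
      obtain n s e where s: "\<And>j. j < n \<Longrightarrow> linear_functional A l (s j)"
        "\<And>k. k < m \<Longrightarrow> (\<Sum>j<(n::nat). l (s j (h k)) (e j)) = h k" using expand[of m h] by blast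
      \<comment> \<open>The image of the tensor under evaluation by the j-th functional. Moving the
        coefficients \<open>s j (h k)\<close> across the tensor sign rewrites \<open>t\<close> as
        the sum of the w_j \<otimes> e_j, and naturality gives g(w_j) = 0.\<close>
      define w where "w j = (\<Sum>k<m. rN (y k) (s j (h k)))" for j
      have "(\<Sum>k<m. frag_of (y k, h k), \<Sum>k<m. \<Sum>j<n. frag_of (rN (y k) (s j (h k)), e j)) \<in> ?cN"
      proof (rule tensor_cong_sum)
        fix k assume "k \<in> {..<m}"
        then have "(frag_of (y k, h k), \<Sum>j<n. frag_of (y k, l (s j (h k)) (e j))) \<in> ?cN"
          using tensor_cong_sum_right[of "y k" "\<lambda>j. l (s j (h k)) (e j)" "{..<n}"] by (simp add: s(2))
        moreover have "(\<Sum>j<n. frag_of (y k, l (s j (h k)) (e j)), \<Sum>j<n. frag_of (rN (y k) (s j (h k)), e j)) \<in> ?cN"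
          by (intro tensor_cong_sum tensor_cong_sym[OF tensor_cong_move]) (simp add: linear_functionalD(3)[OF s(1)])
        ultimately show "(frag_of (y k, h k), \<Sum>j<n. frag_of (rN (y k) (s j (h k)), e j)) \<in> ?cN"
          by (rule tensor_cong_trans)
      qed
      also have "(\<Sum>k<m. \<Sum>j<n. frag_of (rN (y k) (s j (h k)), e j)) = (\<Sum>j<n. \<Sum>k<m. frag_of (rN (y k) (s j (h k)), e j))"
        by (rule sum.swap)
      also have "(\<dots>, \<Sum>j<n. frag_of (w j, e j)) \<in> ?cN"
        unfolding w_def by (intro tensor_cong_sum tensor_cong_sym[OF tensor_cong_sum_left])
      finally have t': "(t, \<Sum>j<n. frag_of (w j, e j)) \<in> ?cN" by (rule tensor_cong_trans[OF t])
      have "\<exists>x. w j = f x" if j: "j < n" for j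
      proof -
        have "evN (s j) (\<Sum>k<m. frag_of (y k, h k)) = w j"
        proof -
          have "evN (s j) (\<Sum>k<i. frag_of (y k, h k)) = (\<Sum>k<i. rN (y k) (s j (h k)))" for i
            by (induction i) (simp_all add: evN_def frag_eval_add)
          then show ?thesis by (simp add: w_def)
        qed
        then have "g (w j) = evP (s j) (?G t)"
          using evN_cong[OF s(1)[OF j] t] by (simp add: evP_G[OF s(1)[OF j]])
        also have "\<dots> = 0" using evP_cong[OF s(1)[OF j] Gt] by (simp add: evP_def)
        finally show ?thesis using exact by blast
      qed
      then obtain x where x: "\<And>j. j < n \<Longrightarrow> w j = f (x j)" by metis
      have "?F (\<Sum>j<n. frag_of (x j, e j)) = (\<Sum>j<n. frag_of (w j, e j))"
        by (simp add: frag_tensor_map_sum x)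
      then have "(t, ?F (\<Sum>j<n. frag_of (x j, e j))) \<in> ?cN" using t' by (simp only:)
      then show ?thesis by (rule exI)
    qed
  next
    assume exact: "\<forall>t. (\<exists>s. (t, ?F s) \<in> ?cN) \<longleftrightarrow> (?G t, 0) \<in> ?cP"
    have one: "rN y 1 = y" for y using mods(2) by (simp add: right_module_def)
    \<comment> \<open>Evaluation by \<open>E\<close> is a left inverse of y \<mapsto> y \<otimes> u,
      so exactness can be read back from tensors with right leg \<open>u\<close>.\<close>
    have ev1: "evN E (frag_of (y, u)) = y" for y by (simp add: evN_def E(2) one)
    show "range f = {y. g y = 0}"
    proof (intro set_eqI iffI)
      fix y assume "y \<in> range f"
      then obtain x where x: "y = f x" by blast
      have "(frag_of (y, u), ?F (frag_of (x, u))) \<in> ?cN" by (simp add: x)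
      then have "(?G (frag_of (y, u)), 0) \<in> ?cP" using exact by blast
      then have "g (evN E (frag_of (y, u))) = evP E 0" using evP_cong[OF E(1), of "?G (frag_of (y, u))" 0] by (simp only: evP_G[OF E(1)])
      then show "y \<in> {y. g y = 0}" by (simp add: ev1) (simp add: evP_def)
    next
      fix y assume "y \<in> {y. g y = 0}"
      then have "(?G (frag_of (y, u)), 0) \<in> ?cP" by (simp add: tensor_cong_zero_left)
      then obtain s where s: "(frag_of (y, u), ?F s) \<in> ?cN" using exact by blast
      have "y = evN E (?F s)" using evN_cong[OF E(1) s] by (simp add: ev1)
      also have "\<dots> = f (frag_eval (\<lambda>(p, x). rM p (E x)) s)"
        unfolding evN_def frag_eval_tensor_map frag_eval_additive[of f, OF f_add]
        using linear_functionalD(3)[OF E(1)] by (simp add: f_mult split_def)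
      finally show "y \<in> range f" by blast
    qed
  qed
qed

lemma faithfully_flat_leftI:
  fixes l :: "'r::ring_1 \<Rightarrow> 'k::ab_group_add \<Rightarrow> 'k"
  assumes "left_module A l"
    and expand: "\<And>m (h :: nat \<Rightarrow> 'k). \<exists>n s e. (\<forall>j<n. linear_functional A l (s j)) \<and>
      (\<forall>k<m. (\<Sum>j<(n::nat). l (s j (h k)) (e j)) = h k)"
    and E: "linear_functional A l E" "E u = 1"
  shows "faithfully_flat_left TYPE('m::ab_group_add) TYPE('n::ab_group_add) TYPE('p::ab_group_add) A l"
  unfolding faithfully_flat_left_def
proof (intro conjI allI impI assms(1))
  fix rM :: "'m \<Rightarrow> 'r \<Rightarrow> 'm" and rN :: "'n \<Rightarrow> 'r \<Rightarrow> 'n" and rP :: "'p \<Rightarrow> 'r \<Rightarrow> 'p" and f g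
  assume mods: "right_module A rM" "right_module A rN" "right_module A rP"
    and homs: "right_module_hom A rM rN f" "right_module_hom A rN rP g"
  have "(frag_tensor_map f (\<lambda>x. x) s, frag_tensor_map f (\<lambda>x. x) t) \<in> tensor_cong A rN l"
    if "(s, t) \<in> tensor_cong A rM l" for s t
    by (rule tensor_cong_map[OF _ _ _ _ that]) (use homs in \<open>auto simp: right_module_hom_def\<close>)
  moreover have "(frag_tensor_map g (\<lambda>x. x) s, frag_tensor_map g (\<lambda>x. x) t) \<in> tensor_cong A rP l"
    if "(s, t) \<in> tensor_cong A rN l" for s t
    by (rule tensor_cong_map[OF _ _ _ _ that]) (use homs in \<open>auto simp: right_module_hom_def\<close>)
  ultimately show "range f = {y. g y = 0} \<longleftrightarrow>
      tensor_over_map A rN l f (\<lambda>x. x) ` tensor_over A rM l =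
        {Y \<in> tensor_over A rN l. tensor_over_map A rP l g (\<lambda>x. x) Y = tensor_cong A rP l `` {0}}"
    unfolding exact_tensor_iff[OF expand E mods homs] by (rule tensor_exact_iff[symmetric])
qed

section \<open>Exchanging the tensor factors along an involution\<close>

definition frag_swap :: "('a \<times> 'b \<Rightarrow>\<^sub>0 int) \<Rightarrow> ('b \<times> 'a \<Rightarrow>\<^sub>0 int)"
  where "frag_swap = frag_extend (\<lambda>(x, y). frag_of (y, x))"

lemma frag_swap_of [simp]: "frag_swap (frag_of (x, y)) = frag_of (y, x)"
  and frag_swap_0 [simp]: "frag_swap 0 = 0"
  and frag_swap_diff: "frag_swap (s - t) = frag_swap s - frag_swap t"
  and frag_swap_add: "frag_swap (s + t) = frag_swap s + frag_swap t"
  by (simp_all add: frag_swap_def frag_extend_diff frag_extend_add)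

lemma frag_swap_swap [simp]: "frag_swap (frag_swap s) = s"
  by (induction s rule: frag_induction[OF subset_UNIV]) (auto simp: frag_swap_diff)

lemma frag_swap_tensor_map: "frag_swap (frag_tensor_map f g s) = frag_tensor_map g f (frag_swap s)"
  by (induction s rule: frag_induction[OF subset_UNIV]) (auto simp: frag_swap_diff frag_tensor_map_diff)

text \<open>Additivity relators of the two sides are exchanged, and the balancing relator at
  \<open>a\<close> becomes the negative of the one at \<open>\<iota> a\<close>.\<close>

lemma tensor_cong_swap:
  assumes i: "\<And>a. a \<in> A \<Longrightarrow> \<iota> a \<in> A" "\<And>a. \<iota> (\<iota> a) = a" and "(s, t) \<in> tensor_cong A r l"
  shows "(frag_swap s, frag_swap t) \<in> tensor_cong A (\<lambda>y a. l (\<iota> a) y) (\<lambda>a x. r x (\<iota> a))"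
proof -
  let ?R = "tensor_relators A (\<lambda>y a. l (\<iota> a) y) (\<lambda>a x. r x (\<iota> a))"
  have "frag_swap (s - t) \<in> group_closure ?R"
    unfolding frag_swap_def
  proof (rule group_closure_frag_extend)
    show "s - t \<in> group_closure (tensor_relators A r l)" using assms(3) by (simp add: tensor_cong_def)
    fix u assume "u \<in> tensor_relators A r l"
    then consider x x' y where "u = frag_of (x + x', y) - frag_of (x, y) - frag_of (x', y)"
      | x y y' where "u = frag_of (x, y + y') - frag_of (x, y) - frag_of (x, y')"
      | x y a where "u = frag_of (r x a, y) - frag_of (x, l a y)" "a \<in> A"
      unfolding tensor_relators_def by blast
    then have "frag_swap u \<in> group_closure ?R"
    proof cases
      case 1
      then show ?thesis
        using tensor_cong_add_right[of y x x' A "\<lambda>y a. l (\<iota> a) y" "\<lambda>a x. r x (\<iota> a)"]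
        by (simp add: frag_swap_diff frag_swap_add tensor_cong_def diff_diff_eq)
    next
      case 2
      then show ?thesis
        using tensor_cong_add_left[of y y' x A "\<lambda>y a. l (\<iota> a) y" "\<lambda>a x. r x (\<iota> a)"]
        by (simp add: frag_swap_diff frag_swap_add tensor_cong_def diff_diff_eq)
    next
      case 3
      then show ?thesis
        using tensor_cong_sym[OF tensor_cong_move[OF i(1)[OF 3(2)], of "\<lambda>y a. l (\<iota> a) y" y x "\<lambda>a x. r x (\<iota> a)"]]
        by (simp add: frag_swap_diff tensor_cong_def i(2))
    qed
    then show "frag_extend (\<lambda>(x, y). frag_of (y, x)) u \<in> group_closure ?R" by (simp add: frag_swap_def)
  qed
  then show ?thesis by (simp add: tensor_cong_def frag_swap_diff)
qed

lemma tensor_cong_swap_iff: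
  assumes i: "\<And>a. a \<in> A \<Longrightarrow> \<iota> a \<in> A" "\<And>a. \<iota> (\<iota> a) = a"
  shows "(frag_swap s, frag_swap t) \<in> tensor_cong A (\<lambda>y a. l (\<iota> a) y) (\<lambda>a x. r x (\<iota> a)) \<longleftrightarrow>
    (s, t) \<in> tensor_cong A r l"
proof
  assume "(frag_swap s, frag_swap t) \<in> tensor_cong A (\<lambda>y a. l (\<iota> a) y) (\<lambda>a x. r x (\<iota> a))"
  from tensor_cong_swap[OF i this] show "(s, t) \<in> tensor_cong A r l" by (simp add: i(2))
qed (rule tensor_cong_swap[OF i])

context cqg_coideal
begin

lemma flat_left:
  "faithfully_flat_left TYPE('m::ab_group_add) TYPE('n::ab_group_add) TYPE('p::ab_group_add) A (\<lambda>a h. a * h)"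
proof -
  obtain E where E: "linear_functional A (*) E" "E 1 = 1" using retraction_exists by blast
  have "left_module A (*)" by (simp add: left_module_def distrib_left distrib_right mult.assoc)
  from faithfully_flat_leftI[OF this expand_finite_family E] show ?thesis .
qed

lemma linear_functional_star:
  assumes "linear_functional A (*) s"
  shows "linear_functional A (\<lambda>a h. h * star a) (\<lambda>h. s (star h))"
  using linear_functionalD[OF assms] by (intro linear_functionalI) (simp_all add: star_add star_mult star_star)

text \<open>
  The involution turns right \<open>A\<close>-modules into left ones: \<open>H\<close> with \<open>a \<cdot> h = h a\<^sup>*\<close> is isomorphic to the left
  regular module, and \<open>H \<otimes>\<^sub>A M\<close> is identified with \<open>M \<otimes>\<^sub>A H\<close>.
\<close>

lemma flat_right:
  "faithfully_flat_right TYPE('m::ab_group_add) TYPE('n::ab_group_add) TYPE('p::ab_group_add) A (\<lambda>h a. h * a)"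
  unfolding faithfully_flat_right_def
proof (intro conjI allI impI)
  show "right_module A (\<lambda>h a. h * a)" by (simp add: right_module_def distrib_left distrib_right mult.assoc)
  fix lM :: "'h \<Rightarrow> 'm \<Rightarrow> 'm" and lN :: "'h \<Rightarrow> 'n \<Rightarrow> 'n" and lP :: "'h \<Rightarrow> 'p \<Rightarrow> 'p" and f g
  assume mods: "left_module A lM" "left_module A lN" "left_module A lP"
    and homs: "left_module_hom A lM lN f" "left_module_hom A lN lP g"
  let ?l = "\<lambda>a h. h * star a"
  let ?N = "tensor_cong A (\<lambda>h a. h * a) lN" and ?P = "tensor_cong A (\<lambda>h a. h * a) lP"
  let ?N' = "tensor_cong A (\<lambda>y a. lN (star a) y) ?l" and ?P' = "tensor_cong A (\<lambda>y a. lP (star a) y) ?l"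
  let ?F = "frag_tensor_map (\<lambda>x. x) f" and ?G = "frag_tensor_map (\<lambda>x. x) g"
  let ?F' = "frag_tensor_map f (\<lambda>x. x)" and ?G' = "frag_tensor_map g (\<lambda>x. x)"
  have expand: "\<exists>n s e. (\<forall>j<n. linear_functional A ?l (s j)) \<and> (\<forall>k<m. (\<Sum>j<(n::nat). ?l (s j (h k)) (e j)) = h k)"
    for m and h :: "nat \<Rightarrow> 'h"
  proof -
    obtain n s e where s: "\<forall>j<n. linear_functional A (*) (s j)"
      "\<forall>k<m. (\<Sum>j<(n::nat). s j (star (h k)) * e j) = star (h k)"
      using expand_finite_family[of m "\<lambda>k. star (h k)"] by blast
    have "(\<Sum>j<n. ?l (s j (star (h k))) (star (e j))) = h k" if "k < m" for k
    proof -
      have "(\<Sum>j<n. ?l (s j (star (h k))) (star (e j))) = star (\<Sum>j<n. s j (star (h k)) * e j)"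
        by (simp add: star_sum star_mult)
      then show ?thesis using s(2) that by (simp add: star_star)
    qed
    then show ?thesis
      using s(1) linear_functional_star
      by (intro exI[of _ n] exI[of _ "\<lambda>j h. s j (star h)"] exI[of _ "\<lambda>j. star (e j)"]) simp
  qed
  obtain E where E: "linear_functional A (*) E" "E 1 = 1" using retraction_exists by blast
  have E': "linear_functional A ?l (\<lambda>h. E (star h))" "E (star 1) = 1"
    using linear_functional_star[OF E(1)] E(2) by simp_all
  have mod: "right_module A (\<lambda>y a. lQ (star a) y)" if "left_module A lQ" for lQ :: "'h \<Rightarrow> 'q::ab_group_add \<Rightarrow> 'q"
    using that by (auto simp: left_module_def right_module_def star_add star_mult star_A)
  have hom: "right_module_hom A (\<lambda>y a. lQ (star a) y) (\<lambda>y a. lR (star a) y) q" if "left_module_hom A lQ lR q"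
    for lQ :: "'h \<Rightarrow> 'q::ab_group_add \<Rightarrow> 'q" and lR :: "'h \<Rightarrow> 'r::ab_group_add \<Rightarrow> 'r" and q
    using that by (auto simp: left_module_hom_def right_module_hom_def star_A)
  have swap_N: "(frag_swap s, frag_swap t) \<in> ?N' \<longleftrightarrow> (s, t) \<in> ?N" for s t
    by (rule tensor_cong_swap_iff) (simp_all add: star_A star_star)
  have swap_P: "(frag_swap s, frag_swap t) \<in> ?P' \<longleftrightarrow> (s, t) \<in> ?P" for s t
    by (rule tensor_cong_swap_iff) (simp_all add: star_A star_star)
  have "range f = {y. g y = 0} \<longleftrightarrow> (\<forall>t. (\<exists>s. (t, ?F' s) \<in> ?N') \<longleftrightarrow> (?G' t, 0) \<in> ?P')"
    by (rule exact_tensor_iff[OF expand E' mod[OF mods(1)] mod[OF mods(2)] mod[OF mods(3)] hom[OF homs(1)] hom[OF homs(2)]])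
  also have "\<dots> \<longleftrightarrow> (\<forall>t. (\<exists>s. (t, ?F s) \<in> ?N) \<longleftrightarrow> (?G t, 0) \<in> ?P)"
  proof -
    have F: "(\<exists>s. (frag_swap t, ?F' s) \<in> ?N') \<longleftrightarrow> (\<exists>s. (t, ?F s) \<in> ?N)" for t
    proof
      assume "\<exists>s. (frag_swap t, ?F' s) \<in> ?N'"
      then obtain s where "(frag_swap t, frag_swap (?F (frag_swap s))) \<in> ?N'" by (auto simp: frag_swap_tensor_map)
      then show "\<exists>s. (t, ?F s) \<in> ?N" unfolding swap_N by (rule exI)
    next
      assume "\<exists>s. (t, ?F s) \<in> ?N"
      then obtain s where "(t, ?F s) \<in> ?N" by blast
      then have "(frag_swap t, ?F' (frag_swap s)) \<in> ?N'" by (simp only: swap_N flip: frag_swap_tensor_map)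
      then show "\<exists>s. (frag_swap t, ?F' s) \<in> ?N'" by (rule exI)
    qed
    have G: "(?G' (frag_swap t), 0) \<in> ?P' \<longleftrightarrow> (?G t, 0) \<in> ?P" for t
      using swap_P[of "?G t" 0] by (simp add: frag_swap_tensor_map)
    \<comment> \<open>\<open>frag_swap\<close> is its own inverse, so quantifying over swapped
      formal sums is no restriction.\<close>
    have "(\<forall>t. (\<exists>s. (t, ?F' s) \<in> ?N') \<longleftrightarrow> (?G' t, 0) \<in> ?P') \<longleftrightarrow>
        (\<forall>t. (\<exists>s. (frag_swap t, ?F' s) \<in> ?N') \<longleftrightarrow> (?G' (frag_swap t), 0) \<in> ?P')" (is "(\<forall>t. ?Q t) \<longleftrightarrow> _")
    proof (rule iffI; rule allI)
      fix t assume "\<forall>t. ?Q (frag_swap t)"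
      then have "?Q (frag_swap (frag_swap t))" ..
      then show "?Q t" by (simp only: frag_swap_swap)
    qed (rule spec)
    then show ?thesis by (simp only: F G)
  qed
  also have "\<dots> \<longleftrightarrow> tensor_over_map A (\<lambda>h a. h * a) lN (\<lambda>x. x) f ` tensor_over A (\<lambda>h a. h * a) lM =
      {Y \<in> tensor_over A (\<lambda>h a. h * a) lN. tensor_over_map A (\<lambda>h a. h * a) lP (\<lambda>x. x) g Y = ?P `` {0}}"
  proof (rule tensor_exact_iff[symmetric])
    show "(?F s, ?F t) \<in> ?N" if "(s, t) \<in> tensor_cong A (\<lambda>h a. h * a) lM" for s t
      by (rule tensor_cong_map[OF _ _ _ _ that]) (use homs in \<open>auto simp: left_module_hom_def\<close>)
    show "(?G s, ?G t) \<in> ?P" if "(s, t) \<in> ?N" for s t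
      by (rule tensor_cong_map[OF _ _ _ _ that]) (use homs in \<open>auto simp: left_module_hom_def\<close>)
  qed
  finally show "range f = {y. g y = 0} \<longleftrightarrow>
      tensor_over_map A (\<lambda>h a. h * a) lN (\<lambda>x. x) f ` tensor_over A (\<lambda>h a. h * a) lM =
      {Y \<in> tensor_over A (\<lambda>h a. h * a) lN. tensor_over_map A (\<lambda>h a. h * a) lP (\<lambda>x. x) g Y = ?P `` {0}}" .
qed

end

theorem mainTheorem1:
  fixes \<Delta> :: "'h::complex_algebra_1 \<Rightarrow> ('h, 'h) ctensor"
    and \<epsilon> :: "'h \<Rightarrow> complex"
    and S star :: "'h \<Rightarrow> 'h"
    and A :: "'h set"
  assumes "cqg_algebra \<Delta> \<epsilon> S star"
    and "coideal_star_subalgebra \<Delta> star A"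
  shows "faithfully_flat_left TYPE('m::ab_group_add) TYPE('n::ab_group_add) TYPE('p::ab_group_add)
           A (\<lambda>a h. a * h) \<and>
         faithfully_flat_right TYPE('m) TYPE('n) TYPE('p) A (\<lambda>h a. h * a)"
proof -
  interpret cqg_coideal \<Delta> \<epsilon> S star A
    using assms by (simp add: cqg_coideal_def cqg_coideal_axioms_def)
  show ?thesis using flat_left flat_right by blast
qed

end
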